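(* In the deconvolution setting of the context, suppose that the source condition $(\varphi,T)\in\mathcal F(0,\beta,C)$ and Assumption D hold, and that $\alpha_n^{3/2+\beta\wedge1}n^{1/2}\to0$. Then for any $\gamma\in(0,1)$, $$\inf_{(\varphi,T)\in\mathcal F}\Pr\left(\varphi\in C^{2,\mathrm{ci}}_{1-\gamma,n}\right)\ge1-\gamma-o(1),\qquad \inf_{(\varphi,T)\in\mathcal F}\Pr\left(\varphi\in C^{2,\mathrm g}_{1-\gamma,n}\right)\ge1-\gamma-O(n^{-1/6})-o(1).$$
   Context: Deconvolution model: $Y=Z+U$, $Z,U$ independent real random variables; $Z$ has density $\varphi$, $U$ has known density $f$, $Y$ has density $r$. On $L_2[a,b]$: $(T\varphi)(y)=\int\varphi(z)f(y-z)dz$, $(T^*\psi)(z)=\int\psi(y)f(y-z)dy$, $r=T\varphi$. From an i.i.d. sample $(Y_i)_{i=1}^n$: $\widehat{T^*r}(z)=\frac1n\sum_if(Y_i-z)$, $\hat\varphi_{\alpha_n}=(\alpha_nI+T^*T)^{-1}\widehat{T^*r}$, $\alpha_n>0$, $\alpha_n\to0$. $\|\cdot\|$: $L_2$ norm; $\|\cdot\|_\infty$: sup norm; $\|A\|_{2,\infty}=\sup_{\|\psi\|\le1}\|A\psi\|_\infty$. Source class $\mathcal F(0,\beta,C)$: pairs $(\varphi,T)$ with $\varphi$ continuous on $[a,b]$, $\|\varphi\|_\infty\le M$, $T^*$ bounded from $L_2[a,b]$ into continuous functions, $\varphi=(T^*T)^\beta T^*\psi$ with $\psi\in L_2[a,b]$,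 $\|T^*\|_{2,\infty}\vee\|\psi\|\vee\|T\|^{-1}\le C$. Assumption D: (i) i.i.d. sample of $Y$; (ii) $f,\varphi,r$ continuous and compactly supported in subsets of $[a,b]$; (iii) $f\in C^s_M[a,b]$, $s\in(0,1]$ ($\|f\|_\infty\le M$, $|f(x)-f(x')|\le M|x-x'|^s$); (iv) $T$ one-to-one. Confidence sets: $C^{2,s}_{1-\gamma,n}(z)=[\hat\varphi_{\alpha_n}(z)-q^{2,s},\hat\varphi_{\alpha_n}(z)+q^{2,s}]$, $z\in[a,b]$, with $q^{2,\mathrm{ci}}=2\|\nu^\varepsilon_{2,n}\|_\infty+\frac{3\|f\|_\infty(\|T^*\|_{2,\infty}/2+\alpha_n^{1/2})\sqrt{2\log(2/\gamma)}}{\alpha_n^{3/2}n^{1/2}}$, where $\nu^\varepsilon_{2,n}=\frac1n\sum_i(\alpha_nI+T^*T)^{-1}\varepsilon_if(Y_i-\cdot)$ with i.i.d. Rademacher $\varepsilon_i$ independent of the data; and $q^{2,\mathrm g}=c_{2,1-\gamma}\frac{\|T^*\|_{2,\infty}/2+\alpha_n^{1/2}}{\alpha_n^{3/2}n^{1/2}}$, with $c_{2,1-\gamma}$ the $(1-\gamma)$-quantile of $\|\mathbb G_2\|_\infty$ for a centered Gaussian process $\mathbb G_2$ on $[a,b]$ with covariance $(s,t)\mapsto\mathbb E[f(Y-s)f(Y-t)]$. "$\varphi\in C$" means $\varphi(z)\in C(z)$ for all $z$. *)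

theory Defs
  imports "HOL-Probability.Probability"
begin

section \<open>The Hilbert space L2[a,b] (functions real => real, only values on [a,b] matter)\<close>

definition L2fun :: "real \<Rightarrow> real \<Rightarrow> (real \<Rightarrow> real) \<Rightarrow> bool" where
  "L2fun a b g \<longleftrightarrow> g \<in> borel_measurable lborel \<and> set_integrable lborel {a..b} (\<lambda>x. (g x)\<^sup>2)"

definition L2inner :: "real \<Rightarrow> real \<Rightarrow> (real \<Rightarrow> real) \<Rightarrow> (real \<Rightarrow> real) \<Rightarrow> real" where
  "L2inner a b g h = (LINT x:{a..b}|lborel. g x * h x)"

definition L2norm :: "real \<Rightarrow> real \<Rightarrow> (real \<Rightarrow> real) \<Rightarrow> real" where
  "L2norm a b g = sqrt (LINT x:{a..b}|lborel. (g x)\<^sup>2)"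

definition supnorm :: "real \<Rightarrow> real \<Rightarrow> (real \<Rightarrow> real) \<Rightarrow> real" where
  "supnorm a b g = (SUP z\<in>{a..b}. \<bar>g z\<bar>)"

definition Top :: "real \<Rightarrow> real \<Rightarrow> (real \<Rightarrow> real) \<Rightarrow> (real \<Rightarrow> real) \<Rightarrow> (real \<Rightarrow> real)" where
  "Top a b f \<phi> = (\<lambda>y. LINT z:{a..b}|lborel. \<phi> z * f (y - z))"

definition Tadj :: "real \<Rightarrow> real \<Rightarrow> (real \<Rightarrow> real) \<Rightarrow> (real \<Rightarrow> real) \<Rightarrow> (real \<Rightarrow> real)" where
  "Tadj a b f \<psi> = (\<lambda>z. LINT y:{a..b}|lborel. \<psi> y * f (y - z))"

definition TadjT :: "real \<Rightarrow> real \<Rightarrow> (real \<Rightarrow> real) \<Rightarrow> (real \<Rightarrow> real) \<Rightarrow> (real \<Rightarrow> real)" where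
  "TadjT a b f g = Tadj a b f (Top a b f g)"

text \<open>(alpha I + T*T)^(-1) h, applied to a (measurable, bounded) function h: the unique
  L2[a,b] function g (normalised to vanish outside [a,b]) with alpha g + T*T g = h on [a,b].\<close>
definition resolvent :: "real \<Rightarrow> real \<Rightarrow> (real \<Rightarrow> real) \<Rightarrow> real \<Rightarrow> (real \<Rightarrow> real) \<Rightarrow> (real \<Rightarrow> real)" where
  "resolvent a b f \<alpha> h = (THE g. L2fun a b g \<and> (\<forall>z. z \<notin> {a..b} \<longrightarrow> g z = 0)
      \<and> (\<forall>z\<in>{a..b}. \<alpha> * g z + TadjT a b f g z = h z))"

definition Tadj_norm_2inf :: "real \<Rightarrow> real \<Rightarrow> (real \<Rightarrow> real) \<Rightarrow> real" where
  "Tadj_norm_2inf a b f =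
     (SUP \<psi>\<in>{\<psi>. L2fun a b \<psi> \<and> L2norm a b \<psi> \<le> 1}. supnorm a b (Tadj a b f \<psi>))"

definition T_norm :: "real \<Rightarrow> real \<Rightarrow> (real \<Rightarrow> real) \<Rightarrow> real" where
  "T_norm a b f = (SUP \<psi>\<in>{\<psi>. L2fun a b \<psi> \<and> L2norm a b \<psi> \<le> 1}. L2norm a b (Top a b f \<psi>))"

definition T_injective :: "real \<Rightarrow> real \<Rightarrow> (real \<Rightarrow> real) \<Rightarrow> bool" where
  "T_injective a b f \<longleftrightarrow>
     (\<forall>g. L2fun a b g \<and> L2norm a b (Top a b f g) = 0 \<longrightarrow> L2norm a b g = 0)"

definition spectral_system :: "real \<Rightarrow> real \<Rightarrow> (real \<Rightarrow> real) \<Rightarrow> (nat \<Rightarrow> real) \<Rightarrow> (nat \<Rightarrow> real \<Rightarrow> real) \<Rightarrow> bool" where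
  "spectral_system a b f lam e \<longleftrightarrow>
     (\<forall>j. L2fun a b (e j)) \<and>
     (\<forall>i j. L2inner a b (e i) (e j) = (if i = j then 1 else 0)) \<and>
     (\<forall>j. lam j > 0) \<and>
     (\<forall>h. L2fun a b h \<longrightarrow>
        (\<lambda>N. L2norm a b (\<lambda>z. TadjT a b f h z - (\<Sum>j<N. lam j * L2inner a b h (e j) * e j z)))
          \<longlonglongrightarrow> 0)"

text \<open>phi = (T*T)^beta T* psi  (equality in L2[a,b])\<close>
definition source_condition :: "real \<Rightarrow> real \<Rightarrow> (real \<Rightarrow> real) \<Rightarrow> real \<Rightarrow> (real \<Rightarrow> real) \<Rightarrow> (real \<Rightarrow> real) \<Rightarrow> bool" where
  "source_condition a b f \<beta> \<phi> \<psi> \<longleftrightarrow>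
     (\<exists>lam e. spectral_system a b f lam e \<and>
        (\<lambda>N. L2norm a b (\<lambda>z. \<phi> z -
            (\<Sum>j<N. lam j powr \<beta> * L2inner a b (Tadj a b f \<psi>) (e j) * e j z))) \<longlonglongrightarrow> 0)"

definition in_class :: "real \<Rightarrow> real \<Rightarrow> real \<Rightarrow> real \<Rightarrow> real \<Rightarrow> real \<Rightarrow> (real \<Rightarrow> real) \<Rightarrow> (real \<Rightarrow> real) \<Rightarrow> bool" where
  "in_class a b M s \<beta> C \<phi> f \<longleftrightarrow>
     \<comment> \<open>phi and f are probability densities\<close>
     (\<forall>x. \<phi> x \<ge> 0) \<and> \<phi> \<in> borel_measurable lborel \<and> integral\<^sup>L lborel \<phi> = 1 \<and>
     (\<forall>x. f x \<ge> 0) \<and> f \<in> borel_measurable lborel \<and> integral\<^sup>L lborel f = 1 \<and>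
     \<comment> \<open>Assumption D(ii): f, phi, r = T phi continuous, supported in [a,b]\<close>
     continuous_on {a..b} f \<and> continuous_on {a..b} \<phi> \<and> continuous_on {a..b} (Top a b f \<phi>) \<and>
     (\<forall>x. x \<notin> {a..b} \<longrightarrow> f x = 0 \<and> \<phi> x = 0 \<and> Top a b f \<phi> x = 0) \<and>
     \<comment> \<open>Assumption D(iii): f in C^s_M[a,b]\<close>
     (\<forall>x\<in>{a..b}. \<bar>f x\<bar> \<le> M) \<and>
     (\<forall>x\<in>{a..b}. \<forall>x'\<in>{a..b}. \<bar>f x - f x'\<bar> \<le> M * \<bar>x - x'\<bar> powr s) \<and>
     \<comment> \<open>Assumption D(iv): T one-to-one\<close>
     T_injective a b f \<and>
     \<comment> \<open>source class F(0,beta,C)\<close>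
     (\<forall>x\<in>{a..b}. \<bar>\<phi> x\<bar> \<le> M) \<and>
     (\<forall>\<psi>. L2fun a b \<psi> \<longrightarrow> continuous_on {a..b} (Tadj a b f \<psi>)) \<and>
     bdd_above ((\<lambda>\<psi>. supnorm a b (Tadj a b f \<psi>)) ` {\<psi>. L2fun a b \<psi> \<and> L2norm a b \<psi> \<le> 1}) \<and>
     Tadj_norm_2inf a b f \<le> C \<and>
     (\<exists>\<psi>. L2fun a b \<psi> \<and> L2norm a b \<psi> \<le> C \<and> source_condition a b f \<beta> \<phi> \<psi>) \<and>
     T_norm a b f > 0 \<and> 1 / T_norm a b f \<le> C"

definition Ymeasure :: "real \<Rightarrow> real \<Rightarrow> (real \<Rightarrow> real) \<Rightarrow> (real \<Rightarrow> real) \<Rightarrow> real measure" where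
  "Ymeasure a b f \<phi> = density lborel (\<lambda>y. ennreal (Top a b f \<phi> y))"

definition rademacher :: "real measure" where
  "rademacher = measure_pmf (pmf_of_set {-1, 1})"

definition sample_space :: "real \<Rightarrow> real \<Rightarrow> (real \<Rightarrow> real) \<Rightarrow> (real \<Rightarrow> real) \<Rightarrow> nat \<Rightarrow> ((nat \<Rightarrow> real) \<times> (nat \<Rightarrow> real)) measure" where
  "sample_space a b f \<phi> n =
     (\<Pi>\<^sub>M i\<in>{..<n}. Ymeasure a b f \<phi>) \<Otimes>\<^sub>M (\<Pi>\<^sub>M i\<in>{..<n}. rademacher)"

definition sample_Y :: "real \<Rightarrow> real \<Rightarrow> (real \<Rightarrow> real) \<Rightarrow> (real \<Rightarrow> real) \<Rightarrow> nat \<Rightarrow> (nat \<Rightarrow> real) measure" where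
  "sample_Y a b f \<phi> n = (\<Pi>\<^sub>M i\<in>{..<n}. Ymeasure a b f \<phi>)"

definition phihat :: "real \<Rightarrow> real \<Rightarrow> (real \<Rightarrow> real) \<Rightarrow> real \<Rightarrow> nat \<Rightarrow> (nat \<Rightarrow> real) \<Rightarrow> (real \<Rightarrow> real)" where
  "phihat a b f \<alpha> n Y = resolvent a b f \<alpha> (\<lambda>z. (\<Sum>i<n. f (Y i - z)) / real n)"

definition nu_eps :: "real \<Rightarrow> real \<Rightarrow> (real \<Rightarrow> real) \<Rightarrow> real \<Rightarrow> nat \<Rightarrow> (nat \<Rightarrow> real) \<Rightarrow> (nat \<Rightarrow> real) \<Rightarrow> (real \<Rightarrow> real)" where
  "nu_eps a b f \<alpha> n Y \<epsilon> = resolvent a b f \<alpha> (\<lambda>z. (\<Sum>i<n. \<epsilon> i * f (Y i - z)) / real n)"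

definition q_ci :: "real \<Rightarrow> real \<Rightarrow> (real \<Rightarrow> real) \<Rightarrow> real \<Rightarrow> real \<Rightarrow> nat \<Rightarrow> (nat \<Rightarrow> real) \<Rightarrow> (nat \<Rightarrow> real) \<Rightarrow> real" where
  "q_ci a b f \<alpha> \<gamma> n Y \<epsilon> =
     2 * supnorm a b (nu_eps a b f \<alpha> n Y \<epsilon>) +
     3 * (SUP x. \<bar>f x\<bar>) * (Tadj_norm_2inf a b f / 2 + sqrt \<alpha>) * sqrt (2 * ln (2 / \<gamma>))
       / (\<alpha> powr (3/2) * sqrt (real n))"

text \<open>covariance E[f(Y-s) f(Y-t)] of the limiting Gaussian process\<close>
definition cov_G2 :: "real \<Rightarrow> real \<Rightarrow> (real \<Rightarrow> real) \<Rightarrow> (real \<Rightarrow> real) \<Rightarrow> real \<Rightarrow> real \<Rightarrow> real" where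
  "cov_G2 a b f \<phi> s t = (LINT y|lborel. Top a b f \<phi> y * f (y - s) * f (y - t))"

definition centered_gp :: "real \<Rightarrow> real \<Rightarrow> (real \<Rightarrow> real \<Rightarrow> real) \<Rightarrow> 'w measure \<Rightarrow> (real \<Rightarrow> 'w \<Rightarrow> real) \<Rightarrow> bool" where
  "centered_gp a b K M G \<longleftrightarrow>
     prob_space M \<and> (\<forall>t\<in>{a..b}. G t \<in> borel_measurable M) \<and>
     (\<forall>\<omega>\<in>space M. continuous_on {a..b} (\<lambda>t. G t \<omega>)) \<and>
     (\<forall>(I::nat set) (t::nat \<Rightarrow> real) (c::nat \<Rightarrow> real). finite I \<longrightarrow> (\<forall>i\<in>I. t i \<in> {a..b}) \<longrightarrow>
        distr M borel (\<lambda>\<omega>. \<Sum>i\<in>I. c i * G (t i) \<omega>) =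
          (let v = (\<Sum>i\<in>I. \<Sum>j\<in>I. c i * c j * K (t i) (t j)) in
           if v = 0 then return borel 0
           else density lborel (\<lambda>x. ennreal (normal_density 0 (sqrt v) x))))"

text \<open>(1-gamma)-quantile of sup_{[a,b]} |G2| (depends only on the law of the process)\<close>
definition gauss_sup_quantile :: "real \<Rightarrow> real \<Rightarrow> (real \<Rightarrow> real \<Rightarrow> real) \<Rightarrow> real \<Rightarrow> real" where
  "gauss_sup_quantile a b K \<gamma> =
     (THE c. \<forall>(M::(nat \<Rightarrow> real) measure) G. centered_gp a b K M G \<longrightarrow>
        c = Inf {x. measure M {\<omega>\<in>space M. (SUP t\<in>{a..b}. \<bar>G t \<omega>\<bar>) \<le> x} \<ge> 1 - \<gamma>})"

definition q_g :: "real \<Rightarrow> real \<Rightarrow> (real \<Rightarrow> real) \<Rightarrow> (real \<Rightarrow> real) \<Rightarrow> real \<Rightarrow> real \<Rightarrow> nat \<Rightarrow> real" where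
  "q_g a b f \<phi> \<alpha> \<gamma> n =
     gauss_sup_quantile a b (cov_G2 a b f \<phi>) \<gamma> * (Tadj_norm_2inf a b f / 2 + sqrt \<alpha>)
       / (\<alpha> powr (3/2) * sqrt (real n))"

definition in_band :: "real \<Rightarrow> real \<Rightarrow> (real \<Rightarrow> real) \<Rightarrow> (real \<Rightarrow> real) \<Rightarrow> real \<Rightarrow> bool" where
  "in_band a b \<phi> c q \<longleftrightarrow> (\<forall>z\<in>{a..b}. c z - q \<le> \<phi> z \<and> \<phi> z \<le> c z + q)"

definition coverage_ci :: "real \<Rightarrow> real \<Rightarrow> (real \<Rightarrow> real) \<Rightarrow> (real \<Rightarrow> real) \<Rightarrow> real \<Rightarrow> real \<Rightarrow> nat \<Rightarrow> real" where
  "coverage_ci a b f \<phi> \<alpha> \<gamma> n =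
     measure (sample_space a b f \<phi> n)
       {(Y, \<epsilon>) \<in> space (sample_space a b f \<phi> n).
          in_band a b \<phi> (phihat a b f \<alpha> n Y) (q_ci a b f \<alpha> \<gamma> n Y \<epsilon>)}"

definition coverage_g :: "real \<Rightarrow> real \<Rightarrow> (real \<Rightarrow> real) \<Rightarrow> (real \<Rightarrow> real) \<Rightarrow> real \<Rightarrow> real \<Rightarrow> nat \<Rightarrow> real" where
  "coverage_g a b f \<phi> \<alpha> \<gamma> n =
     measure (sample_Y a b f \<phi> n)
       {Y \<in> space (sample_Y a b f \<phi> n).
          in_band a b \<phi> (phihat a b f \<alpha> n Y) (q_g a b f \<phi> \<alpha> \<gamma> n)}"

end

theory Submission
  imports Defs "HOL-Real_Asymp.Real_Asymp"
begin

text \<open>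
  Both radii are at least \<open>\<kappa> / (\<alpha> powr (3/2) * \<surd>n)\<close> with \<open>\<kappa> > 0\<close> uniform over the class, and this alone dominates
  the error of the estimator: the coverage probabilities tend to 1 uniformly, so that the rate \<open>n powr (-1/6)\<close> is
  absorbed in \<open>o(1)\<close> and no Gaussian approximation of the empirical process is needed.

  Write \<open>T'\<close> for the adjoint of \<open>T\<close>. The bias is \<open>O(\<alpha> powr min \<beta> 1)\<close> in the supremum norm, negligible by the rate
  assumption. The noise is \<open>(\<alpha> + T'T)\<^sup>-\<^sup>1 h\<close> with \<open>h\<close> the empirical process \<open>z \<mapsto> (P\<^sub>n - P) f(\<cdot> - z)\<close>, at most
  \<open>(sup \<bar>h\<bar> + \<Parallel>T'\<Parallel> \<Parallel>T (\<alpha> + T'T)\<^sup>-\<^sup>1 h\<Parallel>) / \<alpha>\<close>. Hoeffding's inequality on a grid makes the first term small. For the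
  second one, averaging \<open>f(y - z)\<close> over \<open>N\<close> cells in \<open>y\<close> splits \<open>h = T' w + \<rho>\<close>; then
  \<open>\<Parallel>T (\<alpha> + T'T)\<^sup>-\<^sup>1 h\<Parallel> \<le> \<Parallel>w\<Parallel> + \<Parallel>\<rho>\<Parallel> / (2 \<surd>\<alpha>)\<close>, where \<open>\<Parallel>w\<Parallel>\<^sup>2\<close> has mean \<open>O(N / n)\<close> and \<open>n \<Parallel>\<rho>\<Parallel>\<^sup>2\<close> has a mean that tends
  to 0 as \<open>N\<close> grows. This gains a factor \<open>o(1)\<close> over the trivial bound.

  The quantile in the second radius is a definite description. For it to denote the quantile there must be a
  continuous Gaussian process with the given covariance (Cholesky factorization on the dyadic points, extended by
  chaining), and the law of its supremum must be unique (Cramer--Wold, by replacing one coordinate after the other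
  in the characteristic function).
\<close>

section \<open>The Cauchy--Schwarz inequality for integrals\<close>

lemma integrable_mult_of_squares:
  fixes g h :: "'a \<Rightarrow> real"
  assumes [measurable]: "g \<in> borel_measurable N" "h \<in> borel_measurable N"
    and "integrable N (\<lambda>x. (g x)\<^sup>2)" "integrable N (\<lambda>x. (h x)\<^sup>2)"
  shows "integrable N (\<lambda>x. g x * h x)"
proof (rule Bochner_Integration.integrable_bound)
  show "integrable N (\<lambda>x. (g x)\<^sup>2 + (h x)\<^sup>2)" using assms by auto
  have "\<bar>u * v\<bar> \<le> u\<^sup>2 + v\<^sup>2" for u v :: real
    using sum_squares_bound[of "\<bar>u\<bar>" "\<bar>v\<bar>"] mult_nonneg_nonneg[of "\<bar>u\<bar>" "\<bar>v\<bar>"]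
    unfolding abs_mult power2_abs by linarith
  then show "AE x in N. norm (g x * h x) \<le> norm ((g x)\<^sup>2 + (h x)\<^sup>2)" by simp
qed simp

lemma nonneg_quadratic_form_discriminant:
  fixes A B D :: real
  assumes form: "\<And>t u. 0 \<le> t\<^sup>2 * A + 2 * t * u * D + u\<^sup>2 * B"
  shows "D\<^sup>2 \<le> A * B"
proof -
  have A: "0 \<le> A" and B: "0 \<le> B" using form[of 1 0] form[of 0 1] by auto
  have "0 \<le> B * (A * B - D\<^sup>2)" using form[of B "- D"] by (simp add: power2_eq_square algebra_simps)
  moreover have "0 \<le> A * (A * B - D\<^sup>2)"
    using form[of "- D" A] by (simp add: power2_eq_square algebra_simps)
  moreover have "D = 0" if "A = 0" "B = 0" using form[of 1 1] form[of 1 "- 1"] that by simp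
  ultimately show ?thesis using A B by (cases "A = 0 \<and> B = 0") (auto simp: zero_le_mult_iff)
qed

lemma Cauchy_Schwarz_integral:
  fixes g h :: "'a \<Rightarrow> real"
  assumes [measurable]: "g \<in> borel_measurable N" "h \<in> borel_measurable N"
    and g_int: "integrable N (\<lambda>x. (g x)\<^sup>2)" and h_int: "integrable N (\<lambda>x. (h x)\<^sup>2)"
  shows "(\<integral>x. g x * h x \<partial>N)\<^sup>2 \<le> (\<integral>x. (g x)\<^sup>2 \<partial>N) * (\<integral>x. (h x)\<^sup>2 \<partial>N)"
proof (rule nonneg_quadratic_form_discriminant)
  fix t u :: real
  have gh_int: "integrable N (\<lambda>x. g x * h x)"
    by (rule integrable_mult_of_squares) (use assms in auto)
  have "0 \<le> (\<integral>x. (t * g x + u * h x)\<^sup>2 \<partial>N)" by simp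
  also have "\<dots> = (\<integral>x. t\<^sup>2 * (g x)\<^sup>2 + 2 * t * u * (g x * h x) + u\<^sup>2 * (h x)\<^sup>2 \<partial>N)"
    by (rule Bochner_Integration.integral_cong) (auto simp: power2_eq_square algebra_simps)
  also have "\<dots> = t\<^sup>2 * (\<integral>x. (g x)\<^sup>2 \<partial>N) + 2 * t * u * (\<integral>x. g x * h x \<partial>N) + u\<^sup>2 * (\<integral>x. (h x)\<^sup>2 \<partial>N)"
    using g_int h_int gh_int by (simp add: mult.assoc)
  finally show "0 \<le> t\<^sup>2 * (\<integral>x. (g x)\<^sup>2 \<partial>N) + 2 * t * u * (\<integral>x. g x * h x \<partial>N) + u\<^sup>2 * (\<integral>x. (h x)\<^sup>2 \<partial>N)" .
qed

section \<open>Square-integrable functions on an interval\<close>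

abbreviation lborel_Icc :: "real \<Rightarrow> real \<Rightarrow> real measure" where
  "lborel_Icc a b \<equiv> restrict_space lborel {a..b}"

lemma space_lborel_Icc [simp]: "space (lborel_Icc a b) = {a..b}"
  by (simp add: space_restrict_space)

lemma finite_measure_lborel_Icc: "finite_measure (lborel_Icc a b)"
  by (intro finite_measureI) (simp add: emeasure_restrict_space emeasure_lborel_Icc_eq)

lemma measure_lborel_Icc: "a \<le> b \<Longrightarrow> measure (lborel_Icc a b) {a..b} = b - a"
  by (simp add: measure_restrict_space)

lemma borel_measurable_lborel_Icc [measurable (raw)]:
  "g \<in> borel_measurable borel \<Longrightarrow> g \<in> borel_measurable (lborel_Icc a b)"
  by (auto intro: measurable_restrict_space1)

lemma measurable_ident_lborel_Icc: "(\<lambda>x. x) \<in> borel_measurable (lborel_Icc a b)"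
  by (rule borel_measurable_lborel_Icc) simp

lemma set_integral_eq_lborel_Icc: "(LINT x:{a..b}|lborel. g x) = (\<integral>x. g x \<partial>lborel_Icc a b :: real)"
  unfolding set_lebesgue_integral_def by (subst integral_restrict_space) auto

lemma integral_lborel_Icc_eq_lborel:
  assumes "\<And>x. x \<notin> {a..b} \<Longrightarrow> g x = 0"
  shows "(\<integral>x. g x \<partial>lborel_Icc a b) = (\<integral>x. g x \<partial>lborel :: real)"
proof -
  have "(\<integral>x. g x \<partial>lborel_Icc a b) = (\<integral>x. indicator {a..b} x *\<^sub>R g x \<partial>lborel)"
    by (rule integral_restrict_space) simp
  also have "(\<lambda>x. indicator {a..b} x *\<^sub>R g x) = g"
    by (rule ext) (use assms in \<open>auto simp: indicator_def\<close>)
  finally show ?thesis .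
qed

lemma L2fun_iff: "L2fun a b g \<longleftrightarrow> g \<in> borel_measurable borel \<and> integrable (lborel_Icc a b) (\<lambda>x. (g x)\<^sup>2)"
  unfolding L2fun_def set_integrable_def by (subst integrable_restrict_space) auto

lemma L2inner_eq: "L2inner a b g h = (\<integral>x. g x * h x \<partial>lborel_Icc a b)"
  unfolding L2inner_def set_integral_eq_lborel_Icc ..

lemma L2norm_eq: "L2norm a b g = sqrt (\<integral>x. (g x)\<^sup>2 \<partial>lborel_Icc a b)"
  unfolding L2norm_def set_integral_eq_lborel_Icc ..

lemma Top_eq: "Top a b f g y = (\<integral>z. g z * f (y - z) \<partial>lborel_Icc a b)"
  unfolding Top_def set_integral_eq_lborel_Icc ..

lemma Tadj_eq: "Tadj a b f g z = (\<integral>y. g y * f (y - z) \<partial>lborel_Icc a b)"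
  unfolding Tadj_def set_integral_eq_lborel_Icc ..

lemma L2fun_borel [measurable_dest]: "L2fun a b g \<Longrightarrow> g \<in> borel_measurable borel"
  by (simp add: L2fun_iff)

lemma L2fun_dominated:
  assumes "L2fun a b h" "g \<in> borel_measurable borel" "\<And>x. x \<in> {a..b} \<Longrightarrow> \<bar>g x\<bar> \<le> \<bar>h x\<bar>"
  shows "L2fun a b g"
proof -
  have "integrable (lborel_Icc a b) (\<lambda>x. (g x)\<^sup>2)"
  proof (rule Bochner_Integration.integrable_bound)
    show "integrable (lborel_Icc a b) (\<lambda>x. (h x)\<^sup>2)" using assms(1) by (simp add: L2fun_iff)
    show "AE x in lborel_Icc a b. norm ((g x)\<^sup>2) \<le> norm ((h x)\<^sup>2)"
      using assms(3) by (intro AE_I2) (simp add: abs_le_square_iff[symmetric])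
  qed (use assms(2) in simp)
  then show ?thesis using assms(2) by (simp add: L2fun_iff)
qed

lemma L2fun_const: "L2fun a b (\<lambda>_. c)"
  using finite_measure.integrable_const[OF finite_measure_lborel_Icc] by (simp add: L2fun_iff)

lemma L2fun_bounded:
  assumes "g \<in> borel_measurable borel" "\<And>x. x \<in> {a..b} \<Longrightarrow> \<bar>g x\<bar> \<le> B"
  shows "L2fun a b g"
  using assms by (intro L2fun_dominated[OF L2fun_const[of a b B]]) force+

lemma L2fun_integrable_mult:
  assumes "L2fun a b g" "L2fun a b h"
  shows "integrable (lborel_Icc a b) (\<lambda>x. g x * h x)"
  using assms by (intro integrable_mult_of_squares) (auto simp: L2fun_iff)

lemma L2fun_integrable: "L2fun a b g \<Longrightarrow> integrable (lborel_Icc a b) g"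
  using L2fun_integrable_mult[OF _ L2fun_const[of a b 1]] by simp

lemma L2fun_scale: "L2fun a b g \<Longrightarrow> L2fun a b (\<lambda>x. c * g x)"
  by (auto simp: L2fun_iff power_mult_distrib)

lemma L2fun_add:
  assumes "L2fun a b g" "L2fun a b h"
  shows "L2fun a b (\<lambda>x. g x + h x)"
proof -
  have "integrable (lborel_Icc a b) (\<lambda>x. (g x)\<^sup>2 + 2 * (g x * h x) + (h x)\<^sup>2)"
    using assms L2fun_integrable_mult[OF assms] by (auto simp: L2fun_iff)
  then show ?thesis using assms by (auto simp: L2fun_iff power2_sum algebra_simps)
qed

lemma L2fun_diff: "L2fun a b g \<Longrightarrow> L2fun a b h \<Longrightarrow> L2fun a b (\<lambda>x. g x - h x)"
  using L2fun_add[of a b g "\<lambda>x. - 1 * h x"] L2fun_scale[of a b h "- 1"] by simp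

lemma L2fun_sum: "(\<And>i. i \<in> I \<Longrightarrow> L2fun a b (g i)) \<Longrightarrow> L2fun a b (\<lambda>x. \<Sum>i\<in>I. g i x)"
  by (induction I rule: infinite_finite_induct) (auto intro: L2fun_add L2fun_const)

lemmas L2fun_intros = L2fun_add L2fun_diff L2fun_scale L2fun_sum

lemma L2norm_nonneg [simp]: "L2norm a b g \<ge> 0"
  by (simp add: L2norm_eq)

lemma L2norm_sq: "(L2norm a b g)\<^sup>2 = L2inner a b g g"
  by (simp add: L2norm_eq L2inner_eq power2_eq_square[symmetric])

lemma L2inner_commute: "L2inner a b g h = L2inner a b h g"
  by (simp add: L2inner_eq mult.commute)

lemma L2inner_Cauchy_Schwarz:
  assumes "L2fun a b g" "L2fun a b h"
  shows "\<bar>L2inner a b g h\<bar> \<le> L2norm a b g * L2norm a b h"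
proof -
  have "(L2inner a b g h)\<^sup>2 \<le> (L2norm a b g * L2norm a b h)\<^sup>2"
    using Cauchy_Schwarz_integral[of g "lborel_Icc a b" h] assms
    by (auto simp: L2inner_eq L2norm_eq power_mult_distrib L2fun_iff)
  then show ?thesis unfolding abs_le_square_iff[symmetric] by (simp add: abs_mult)
qed

lemma L2inner_add_left: "L2fun a b g \<Longrightarrow> L2fun a b g' \<Longrightarrow> L2fun a b h \<Longrightarrow>
    L2inner a b (\<lambda>x. g x + g' x) h = L2inner a b g h + L2inner a b g' h"
  by (simp add: L2inner_eq distrib_right L2fun_integrable_mult)

lemma L2inner_diff_left: "L2fun a b g \<Longrightarrow> L2fun a b g' \<Longrightarrow> L2fun a b h \<Longrightarrow>
    L2inner a b (\<lambda>x. g x - g' x) h = L2inner a b g h - L2inner a b g' h"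
  by (simp add: L2inner_eq left_diff_distrib L2fun_integrable_mult)

lemma L2inner_diff_right: "L2fun a b g \<Longrightarrow> L2fun a b g' \<Longrightarrow> L2fun a b h \<Longrightarrow>
    L2inner a b h (\<lambda>x. g x - g' x) = L2inner a b h g - L2inner a b h g'"
  by (simp add: L2inner_commute[of a b h] L2inner_diff_left)

lemma L2inner_scale_left: "L2inner a b (\<lambda>x. c * g x) h = c * L2inner a b g h"
  by (simp add: L2inner_eq mult.assoc)

lemma L2inner_scale_right: "L2inner a b g (\<lambda>x. c * h x) = c * L2inner a b g h"
  by (simp add: L2inner_commute[of a b g] L2inner_scale_left)

lemma L2inner_sum_left: "(\<And>i. i \<in> I \<Longrightarrow> L2fun a b (g i)) \<Longrightarrow> L2fun a b h \<Longrightarrow>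
    L2inner a b (\<lambda>x. \<Sum>i\<in>I. g i x) h = (\<Sum>i\<in>I. L2inner a b (g i) h)"
  by (simp add: L2inner_eq sum_distrib_right L2fun_integrable_mult)

lemma L2inner_sum_right: "(\<And>i. i \<in> I \<Longrightarrow> L2fun a b (g i)) \<Longrightarrow> L2fun a b h \<Longrightarrow>
    L2inner a b h (\<lambda>x. \<Sum>i\<in>I. g i x) = (\<Sum>i\<in>I. L2inner a b h (g i))"
  by (simp add: L2inner_commute[of a b h] L2inner_sum_left)

lemma L2inner_cong_AE:
  assumes "AE x in lborel_Icc a b. g x = g' x" "L2fun a b g" "L2fun a b g'" "L2fun a b h"
  shows "L2inner a b g h = L2inner a b g' h"
  unfolding L2inner_eq using assms by (intro integral_cong_AE) (auto simp: L2fun_iff)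

lemma L2norm_scale: "L2norm a b (\<lambda>x. c * g x) = \<bar>c\<bar> * L2norm a b g"
  by (simp add: L2norm_eq power_mult_distrib real_sqrt_mult)

lemma L2norm_cong_AE:
  assumes "AE x in lborel_Icc a b. g x = h x" "L2fun a b g" "L2fun a b h"
  shows "L2norm a b g = L2norm a b h"
  unfolding L2norm_eq using assms
  by (intro arg_cong[where f=sqrt] integral_cong_AE) (auto simp: L2fun_iff)

lemma L2norm_zero_AE:
  assumes "L2fun a b g" "L2norm a b g = 0"
  shows "AE x in lborel_Icc a b. g x = 0"
proof -
  have "(\<integral>x. (g x)\<^sup>2 \<partial>lborel_Icc a b) = 0" using assms by (simp add: L2norm_eq)
  then have "AE x in lborel_Icc a b. (g x)\<^sup>2 = 0"
    using assms by (subst integral_nonneg_eq_0_iff_AE[symmetric]) (auto simp: L2fun_iff)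
  then show ?thesis by simp
qed

lemma L2norm_mono:
  assumes "L2fun a b h" "g \<in> borel_measurable borel" "\<And>x. x \<in> {a..b} \<Longrightarrow> \<bar>g x\<bar> \<le> \<bar>h x\<bar>"
  shows "L2norm a b g \<le> L2norm a b h"
  unfolding L2norm_eq using assms
  by (intro real_sqrt_le_mono integral_mono_AE' AE_I2)
     (auto simp: L2fun_iff abs_le_square_iff[symmetric])

lemma L2norm_bounded:
  assumes "a \<le> b" "\<And>x. x \<in> {a..b} \<Longrightarrow> \<bar>g x\<bar> \<le> B" "g \<in> borel_measurable borel"
  shows "L2norm a b g \<le> B * sqrt (b - a)"
proof -
  have B: "B \<ge> 0" using assms(1) assms(2)[of a] by auto
  have "L2norm a b g \<le> L2norm a b (\<lambda>_. B)"
    using assms B by (intro L2norm_mono L2fun_const) auto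
  also have "\<dots> = B * sqrt (b - a)"
    using assms(1) B by (simp add: L2norm_eq measure_lborel_Icc real_sqrt_mult mult.commute)
  finally show ?thesis .
qed

lemma continuous_on_Icc_AE_le:
  assumes "a < b" and cont: "continuous_on {a..b} g" and le: "AE x in lborel_Icc a b. g x \<le> (B::real)"
    and x: "x \<in> {a..b}"
  shows "g x \<le> B"
proof -
  define S where "S = {x \<in> {a..b}. g x \<le> B}"
  have "closed S" unfolding S_def using cont by (intro continuous_on_closed_Collect_le) auto
  have "AE x in lborel. x \<in> {a..b} \<longrightarrow> g x \<le> B" using le by (simp add: AE_restrict_space_iff)
  then have "AE x in lebesgue. x \<in> {a<..<b} \<longrightarrow> x \<in> S"
    by (intro AE_completion) (auto simp: S_def elim!: eventually_mono)
  then have "{a<..<b} \<subseteq> S"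
    using mem_closed_if_AE_lebesgue_open[OF open_greaterThanLessThan \<open>closed S\<close>] by blast
  then have "closure {a<..<b} \<subseteq> S" using \<open>closed S\<close> by (intro closure_minimal)
  then show ?thesis using \<open>a < b\<close> x by (auto simp: S_def)
qed

lemma continuous_on_Icc_L2norm_zero:
  assumes "a < b" "continuous_on {a..b} g" "L2fun a b g" "L2norm a b g = 0" "x \<in> {a..b}"
  shows "g x = 0"
proof -
  have "AE x in lborel_Icc a b. g x \<le> 0" "AE x in lborel_Icc a b. - g x \<le> 0"
    using L2norm_zero_AE[OF assms(3,4)] by auto
  from continuous_on_Icc_AE_le[OF assms(1) assms(2) this(1) assms(5)]
    continuous_on_Icc_AE_le[OF assms(1) continuous_on_minus[OF assms(2)] this(2) assms(5)]
  show ?thesis by simp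
qed

lemma continuous_on_Icc_abs_le_L2_limit:
  fixes g :: "nat \<Rightarrow> real \<Rightarrow> real"
  assumes "a < b" and cont: "continuous_on {a..b} u" and u: "L2fun a b u" and g: "\<And>n. L2fun a b (g n)"
    and le: "\<And>n x. x \<in> {a..b} \<Longrightarrow> \<bar>g n x\<bar> \<le> B"
    and lim: "(\<lambda>n. L2norm a b (\<lambda>x. u x - g n x)) \<longlonglongrightarrow> 0" and x: "x \<in> {a..b}"
  shows "\<bar>u x\<bar> \<le> B"
proof -
  define excess where "excess x = max 0 (\<bar>u x\<bar> - B)" for x
  have [measurable]: "u \<in> borel_measurable borel" using L2fun_borel[OF u] .
  have excess_measurable: "excess \<in> borel_measurable borel"
    unfolding excess_def[abs_def] by measurable
  have excess_le: "\<bar>excess x\<bar> \<le> \<bar>u x - g n x\<bar>" if "x \<in> {a..b}" for x n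
    using le[OF that, of n] by (simp add: excess_def)
  note diff_L2 = L2fun_diff[OF u g]
  have excess_L2: "L2fun a b excess"
    by (rule L2fun_dominated[OF diff_L2 excess_measurable excess_le])
  have "L2norm a b excess \<le> L2norm a b (\<lambda>x. u x - g n x)" for n
    by (rule L2norm_mono[OF diff_L2 excess_measurable excess_le])
  with lim have "L2norm a b excess \<le> 0" by (meson LIMSEQ_le_const)
  then have "L2norm a b excess = 0" by (simp add: order_antisym)
  moreover have "continuous_on {a..b} excess"
    unfolding excess_def by (intro continuous_intros cont)
  ultimately have "excess x = 0" using continuous_on_Icc_L2norm_zero[OF \<open>a < b\<close> _ excess_L2 _ x] by blast
  then show ?thesis by (simp add: excess_def max_def split: if_splits)
qed

lemma L2norm_orthogonal_sum:
  assumes L2: "\<And>j. L2fun a b (u j)" and orth: "\<And>i j. i \<noteq> j \<Longrightarrow> L2inner a b (u i) (u j) = 0"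
    and "finite J"
  shows "(L2norm a b (\<lambda>x. \<Sum>j\<in>J. c j * u j x))\<^sup>2 = (\<Sum>j\<in>J. (c j)\<^sup>2 * L2inner a b (u j) (u j))"
proof -
  have "L2inner a b (u i) (\<lambda>x. \<Sum>j\<in>J. c j * u j x) = c i * L2inner a b (u i) (u i)" if "i \<in> J" for i
  proof -
    have "L2inner a b (u i) (\<lambda>x. \<Sum>j\<in>J. c j * u j x) = (\<Sum>j\<in>J. c j * L2inner a b (u i) (u j))"
      using L2 by (simp add: L2inner_sum_right L2fun_scale L2inner_scale_right)
    also have "\<dots> = (\<Sum>j\<in>J. if j = i then c i * L2inner a b (u i) (u i) else 0)"
      by (intro sum.cong) (auto simp: orth)
    finally show ?thesis using that \<open>finite J\<close> by simp
  qed
  then show ?thesis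
    unfolding L2norm_sq using L2
    by (subst L2inner_sum_left)
       (auto simp: L2inner_scale_left power2_eq_square mult.assoc intro!: L2fun_intros sum.cong)
qed

lemma
  assumes L2: "\<And>j. L2fun a b (u j)" and h: "L2fun a b h" and "finite J"
    and orthonormal: "\<And>i j. L2inner a b (u i) (u j) = (if i = j then 1 else 0)"
  shows L2norm_projection_residual_sq: "(L2norm a b (\<lambda>x. h x - (\<Sum>j\<in>J. L2inner a b h (u j) * u j x)))\<^sup>2
      = (L2norm a b h)\<^sup>2 - (\<Sum>j\<in>J. (L2inner a b h (u j))\<^sup>2)"
    and Bessel_inequality_L2: "(\<Sum>j\<in>J. (L2inner a b h (u j))\<^sup>2) \<le> (L2norm a b h)\<^sup>2"
proof -
  define p where "p x = (\<Sum>j\<in>J. L2inner a b h (u j) * u j x)" for x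
  have p: "L2fun a b p" unfolding p_def using L2 by (intro L2fun_intros)
  have "L2inner a b h p = (\<Sum>j\<in>J. (L2inner a b h (u j))\<^sup>2)"
    unfolding p_def using L2 h
    by (simp add: L2inner_sum_right L2fun_scale L2inner_scale_right power2_eq_square)
  moreover have "(L2norm a b p)\<^sup>2 = (\<Sum>j\<in>J. (L2inner a b h (u j))\<^sup>2)"
    unfolding p_def using L2norm_orthogonal_sum[OF L2 _ \<open>finite J\<close>] by (simp add: orthonormal)
  moreover have "(L2norm a b (\<lambda>x. h x - p x))\<^sup>2 = (L2norm a b h)\<^sup>2 - 2 * L2inner a b h p + (L2norm a b p)\<^sup>2"
    unfolding L2norm_sq using h p
    by (simp add: L2inner_diff_left L2fun_diff L2inner_diff_right L2inner_commute[of a b p h])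
  ultimately show residual: "(L2norm a b (\<lambda>x. h x - (\<Sum>j\<in>J. L2inner a b h (u j) * u j x)))\<^sup>2
      = (L2norm a b h)\<^sup>2 - (\<Sum>j\<in>J. (L2inner a b h (u j))\<^sup>2)"
    unfolding p_def by linarith
  show "(\<Sum>j\<in>J. (L2inner a b h (u j))\<^sup>2) \<le> (L2norm a b h)\<^sup>2"
    using zero_le_power2[of "L2norm a b (\<lambda>x. h x - (\<Sum>j\<in>J. L2inner a b h (u j) * u j x))"]
    unfolding residual by simp
qed

section \<open>The convolution operator and its adjoint\<close>

lemma borel_measurable_pair_lborel_Icc:
  fixes k :: "real \<times> real \<Rightarrow> real"
  assumes "k \<in> borel_measurable (borel \<Otimes>\<^sub>M borel)"
  shows "k \<in> borel_measurable (borel \<Otimes>\<^sub>M lborel_Icc a b)"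
    and "k \<in> borel_measurable (lborel_Icc a b \<Otimes>\<^sub>M lborel_Icc c d)"
proof -
  note ident = measurable_ident_lborel_Icc
  have "(\<lambda>p. (fst p, snd p)) \<in> (borel \<Otimes>\<^sub>M lborel_Icc a b) \<rightarrow>\<^sub>M (borel \<Otimes>\<^sub>M borel)"
    by (intro measurable_Pair measurable_fst measurable_compose[OF measurable_snd ident])
  from measurable_compose[OF this assms] show "k \<in> borel_measurable (borel \<Otimes>\<^sub>M lborel_Icc a b)" by simp
  have "(\<lambda>p. (fst p, snd p)) \<in> (lborel_Icc a b \<Otimes>\<^sub>M lborel_Icc c d) \<rightarrow>\<^sub>M (borel \<Otimes>\<^sub>M borel)"
    by (intro measurable_Pair measurable_compose[OF measurable_fst ident]
        measurable_compose[OF measurable_snd ident])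
  from measurable_compose[OF this assms]
  show "k \<in> borel_measurable (lborel_Icc a b \<Otimes>\<^sub>M lborel_Icc c d)" by simp
qed

lemma borel_measurable_integral_lborel_Icc:
  fixes k :: "real \<Rightarrow> real \<Rightarrow> real"
  assumes "(\<lambda>(y, z). k y z) \<in> borel_measurable (borel \<Otimes>\<^sub>M borel)"
  shows "(\<lambda>y. \<integral>z. k y z \<partial>lborel_Icc a b) \<in> borel_measurable borel"
proof -
  interpret finite_measure "lborel_Icc a b" by (rule finite_measure_lborel_Icc)
  show ?thesis
    by (rule borel_measurable_lebesgue_integral[OF borel_measurable_pair_lborel_Icc(1)[OF assms]])
qed

locale convolution_operator =
  fixes a b M :: real and f :: "real \<Rightarrow> real"
  assumes a_less_b: "a < b"
    and f_measurable [measurable]: "f \<in> borel_measurable borel"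
    and abs_f_le: "\<And>x. \<bar>f x\<bar> \<le> M"
    and continuous_on_Tadj: "\<And>\<psi>. L2fun a b \<psi> \<Longrightarrow> continuous_on {a..b} (Tadj a b f \<psi>)"
begin

abbreviation "L2 \<equiv> L2fun a b"
abbreviation "ip \<equiv> L2inner a b"
abbreviation "nrm \<equiv> L2norm a b"
abbreviation "T \<equiv> Top a b f"
abbreviation "T' \<equiv> Tadj a b f"
abbreviation "T'T \<equiv> TadjT a b f"

definition kernel_bound :: real where
  "kernel_bound = M * sqrt (b - a)"

lemma M_nonneg: "M \<ge> 0"
  using abs_f_le[of 0] by linarith

lemma kernel_bound_nonneg: "kernel_bound \<ge> 0"
  using a_less_b M_nonneg by (simp add: kernel_bound_def)

lemma L2_slice: "L2 (\<lambda>z. f (y - z))" "L2 (\<lambda>y. f (y - z))"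
  using abs_f_le by (auto intro!: L2fun_bounded[where B=M])

lemma nrm_slice: "nrm (\<lambda>z. f (y - z)) \<le> kernel_bound" "nrm (\<lambda>y. f (y - z)) \<le> kernel_bound"
  unfolding kernel_bound_def using abs_f_le a_less_b by (auto intro!: L2norm_bounded)

lemma T_eq_ip: "T g y = ip g (\<lambda>z. f (y - z))"
  by (simp add: Top_eq L2inner_eq)

lemma T'_eq_ip: "T' g z = ip g (\<lambda>y. f (y - z))"
  by (simp add: Tadj_eq L2inner_eq)

lemma T'T_eq: "T'T g = T' (T g)"
  by (simp add: TadjT_def)

lemma abs_ip_le_kernel_bound:
  assumes "L2 g" "L2 h" "nrm h \<le> kernel_bound"
  shows "\<bar>ip g h\<bar> \<le> kernel_bound * nrm g"
proof -
  have "\<bar>ip g h\<bar> \<le> nrm g * nrm h" by (rule L2inner_Cauchy_Schwarz[OF assms(1,2)])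
  also have "\<dots> \<le> nrm g * kernel_bound" using assms(3) by (intro mult_left_mono) auto
  finally show ?thesis by (simp add: mult.commute)
qed

lemma abs_T_le: "L2 g \<Longrightarrow> \<bar>T g y\<bar> \<le> kernel_bound * nrm g"
  unfolding T_eq_ip by (intro abs_ip_le_kernel_bound L2_slice nrm_slice)

lemma abs_T'_le: "L2 g \<Longrightarrow> \<bar>T' g z\<bar> \<le> kernel_bound * nrm g"
  unfolding T'_eq_ip by (intro abs_ip_le_kernel_bound L2_slice nrm_slice)

lemma borel_measurable_T:
  assumes "L2 g"
  shows "T g \<in> borel_measurable borel"
proof -
  note [measurable] = L2fun_borel[OF assms]
  show ?thesis unfolding Top_eq[abs_def] by (rule borel_measurable_integral_lborel_Icc) measurable
qed

lemma borel_measurable_T':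
  assumes "L2 g"
  shows "T' g \<in> borel_measurable borel"
proof -
  note [measurable] = L2fun_borel[OF assms]
  show ?thesis unfolding Tadj_eq[abs_def] by (rule borel_measurable_integral_lborel_Icc) measurable
qed

lemma L2_T: "L2 g \<Longrightarrow> L2 (T g)"
  by (rule L2fun_bounded[OF borel_measurable_T abs_T_le])

lemma L2_T': "L2 g \<Longrightarrow> L2 (T' g)"
  by (rule L2fun_bounded[OF borel_measurable_T' abs_T'_le])

lemma L2_T'T: "L2 g \<Longrightarrow> L2 (T'T g)"
  by (simp add: T'T_eq L2_T L2_T')

lemma continuous_on_T'T: "L2 g \<Longrightarrow> continuous_on {a..b} (T'T g)"
  by (simp add: T'T_eq L2_T continuous_on_Tadj)

lemma nrm_T_le: "L2 g \<Longrightarrow> nrm (T g) \<le> kernel_bound * sqrt (b - a) * nrm g"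
  using L2norm_bounded[OF less_imp_le[OF a_less_b] abs_T_le borel_measurable_T, of g]
  by (simp add: mult_ac)

lemma abs_T'T_le_nrm_T: "L2 g \<Longrightarrow> \<bar>T'T g z\<bar> \<le> kernel_bound * nrm (T g)"
  by (simp add: T'T_eq L2_T abs_T'_le)

lemma abs_T'T_le: "L2 g \<Longrightarrow> \<bar>T'T g z\<bar> \<le> kernel_bound * (kernel_bound * sqrt (b - a)) * nrm g"
  using abs_T'T_le_nrm_T[of g z] mult_left_mono[OF nrm_T_le kernel_bound_nonneg, of g]
  by (simp add: mult_ac)

lemma integrable_bilinear_kernel:
  assumes g: "L2 g" and p: "L2 p"
  shows "integrable (lborel_Icc a b \<Otimes>\<^sub>M lborel_Icc a b) (\<lambda>(y, z). g z * f (y - z) * p y)"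
proof (rule Bochner_Integration.integrable_bound)
  interpret finite_measure "lborel_Icc a b" by (rule finite_measure_lborel_Icc)
  interpret pair_sigma_finite "lborel_Icc a b" "lborel_Icc a b" ..
  note [measurable] = L2fun_borel[OF g] L2fun_borel[OF p]
  show "integrable (lborel_Icc a b \<Otimes>\<^sub>M lborel_Icc a b) (\<lambda>(y, z). M * (\<bar>p y\<bar> * \<bar>g z\<bar>))"
    by (rule Fubini_integrable[OF borel_measurable_pair_lborel_Icc(2)])
       (use L2fun_integrable[OF g] L2fun_integrable[OF p] in \<open>auto simp: abs_mult\<close>)
  show "(\<lambda>(y, z). g z * f (y - z) * p y) \<in> borel_measurable (lborel_Icc a b \<Otimes>\<^sub>M lborel_Icc a b)"
    by (rule borel_measurable_pair_lborel_Icc(2)) simp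
  have "\<bar>g z * f (y - z) * p y\<bar> \<le> \<bar>M * (\<bar>p y\<bar> * \<bar>g z\<bar>)\<bar>" for y z
  proof -
    have "\<bar>g z * f (y - z) * p y\<bar> = \<bar>f (y - z)\<bar> * (\<bar>p y\<bar> * \<bar>g z\<bar>)" by (simp add: abs_mult mult_ac)
    also have "\<dots> \<le> M * (\<bar>p y\<bar> * \<bar>g z\<bar>)" by (intro mult_right_mono abs_f_le) simp
    finally show ?thesis by linarith
  qed
  then show "AE x in lborel_Icc a b \<Otimes>\<^sub>M lborel_Icc a b.
      norm (case x of (y, z) \<Rightarrow> g z * f (y - z) * p y) \<le> norm (case x of (y, z) \<Rightarrow> M * (\<bar>p y\<bar> * \<bar>g z\<bar>))"
    by (intro AE_I2) (auto split: prod.split)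
qed

lemma ip_T_left:
  assumes "L2 g" "L2 p"
  shows "ip (T g) p = ip g (T' p)"
proof -
  interpret finite_measure "lborel_Icc a b" by (rule finite_measure_lborel_Icc)
  interpret pair_sigma_finite "lborel_Icc a b" "lborel_Icc a b" ..
  have "ip (T g) p = (\<integral>y. (\<integral>z. g z * f (y - z) * p y \<partial>lborel_Icc a b) \<partial>lborel_Icc a b)"
    by (simp add: L2inner_eq Top_eq)
  also have "\<dots> = (\<integral>z. (\<integral>y. g z * f (y - z) * p y \<partial>lborel_Icc a b) \<partial>lborel_Icc a b)"
    by (rule Fubini_integral[OF integrable_bilinear_kernel[OF assms], symmetric])
  also have "\<dots> = (\<integral>z. g z * T' p z \<partial>lborel_Icc a b)"
    by (simp add: Tadj_eq mult.assoc mult.commute[of "f _"])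
  finally show ?thesis by (simp add: L2inner_eq)
qed

lemma ip_T'T_left: "L2 g \<Longrightarrow> L2 h \<Longrightarrow> ip (T'T g) h = ip (T g) (T h)"
  by (metis T'T_eq L2_T L2inner_commute ip_T_left)

lemma T_diff: "L2 g \<Longrightarrow> L2 h \<Longrightarrow> T (\<lambda>x. g x - h x) = (\<lambda>y. T g y - T h y)"
  by (rule ext) (simp add: T_eq_ip L2inner_diff_left L2_slice)

lemma T_scale: "T (\<lambda>x. c * g x) = (\<lambda>y. c * T g y)"
  by (rule ext) (simp add: T_eq_ip L2inner_scale_left)

lemma T_sum: "(\<And>i. i \<in> I \<Longrightarrow> L2 (g i)) \<Longrightarrow> T (\<lambda>x. \<Sum>i\<in>I. g i x) = (\<lambda>y. \<Sum>i\<in>I. T (g i) y)"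
  by (rule ext) (simp add: T_eq_ip L2inner_sum_left L2_slice)

lemma T'_diff: "L2 g \<Longrightarrow> L2 h \<Longrightarrow> T' (\<lambda>x. g x - h x) = (\<lambda>z. T' g z - T' h z)"
  by (rule ext) (simp add: T'_eq_ip L2inner_diff_left L2_slice)

lemma T'_scale: "T' (\<lambda>x. c * g x) = (\<lambda>z. c * T' g z)"
  by (rule ext) (simp add: T'_eq_ip L2inner_scale_left)

lemma T'_sum: "(\<And>i. i \<in> I \<Longrightarrow> L2 (g i)) \<Longrightarrow> T' (\<lambda>x. \<Sum>i\<in>I. g i x) = (\<lambda>z. \<Sum>i\<in>I. T' (g i) z)"
  by (rule ext) (simp add: T'_eq_ip L2inner_sum_left L2_slice)

lemma T'T_diff: "L2 g \<Longrightarrow> L2 h \<Longrightarrow> T'T (\<lambda>x. g x - h x) = (\<lambda>z. T'T g z - T'T h z)"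
  by (simp add: T'T_eq T_diff T'_diff L2_T)

lemma T'T_scale: "T'T (\<lambda>x. c * g x) = (\<lambda>z. c * T'T g z)"
  by (simp add: T'T_eq T_scale T'_scale)

lemma T'T_sum: "(\<And>i. i \<in> I \<Longrightarrow> L2 (g i)) \<Longrightarrow> T'T (\<lambda>x. \<Sum>i\<in>I. g i x) = (\<lambda>z. \<Sum>i\<in>I. T'T (g i) z)"
  by (simp add: T'T_eq T_sum T'_sum L2_T)

lemma T'T_cong_AE:
  assumes "AE x in lborel_Icc a b. g x = h x" "L2 g" "L2 h"
  shows "T'T g = T'T h"
proof -
  have "T g = T h" unfolding T_eq_ip[abs_def] using L2inner_cong_AE[OF assms L2_slice(1)] by auto
  then show ?thesis by (simp add: T'T_eq)
qed

section \<open>Tikhonov regularization\<close>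

definition tikhonov_solution :: "real \<Rightarrow> (real \<Rightarrow> real) \<Rightarrow> (real \<Rightarrow> real) \<Rightarrow> bool" where
  "tikhonov_solution \<alpha> h g \<longleftrightarrow>
     L2 g \<and> (\<forall>z. z \<notin> {a..b} \<longrightarrow> g z = 0) \<and> (\<forall>z\<in>{a..b}. \<alpha> * g z + T'T g z = h z)"

lemma tikhonov_energy_AE:
  assumes g: "L2 g" and h: "L2 h" and eq: "AE z in lborel_Icc a b. \<alpha> * g z + T'T g z = h z"
  shows "\<alpha> * (nrm g)\<^sup>2 + (nrm (T g))\<^sup>2 = ip h g"
proof -
  have "ip h g = ip (\<lambda>z. \<alpha> * g z + T'T g z) g"
    using eq by (intro L2inner_cong_AE h g L2fun_intros L2_T'T) auto
  also have "\<dots> = \<alpha> * (nrm g)\<^sup>2 + (nrm (T g))\<^sup>2"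
    using g by (simp add: L2inner_add_left L2fun_scale L2_T'T L2inner_scale_left ip_T'T_left L2norm_sq)
  finally show ?thesis by simp
qed

lemma tikhonov_energy:
  "tikhonov_solution \<alpha> h g \<Longrightarrow> L2 h \<Longrightarrow> \<alpha> * (nrm g)\<^sup>2 + (nrm (T g))\<^sup>2 = ip h g"
  by (intro tikhonov_energy_AE) (auto simp: tikhonov_solution_def)

lemma tikhonov_solution_diff:
  assumes "tikhonov_solution \<alpha> h g" "tikhonov_solution \<alpha> h' g'"
  shows "tikhonov_solution \<alpha> (\<lambda>z. h z - h' z) (\<lambda>z. g z - g' z)"
proof -
  have "\<alpha> * (g z - g' z) + T'T (\<lambda>z. g z - g' z) z = h z - h' z" if "z \<in> {a..b}" for z
  proof -
    have "\<alpha> * g z + T'T g z = h z" "\<alpha> * g' z + T'T g' z = h' z" "L2 g" "L2 g'"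
      using assms that by (auto simp: tikhonov_solution_def)
    then show ?thesis by (simp add: T'T_diff algebra_simps)
  qed
  then show ?thesis using assms by (auto simp: tikhonov_solution_def L2fun_diff)
qed

lemma tikhonov_solution_zero:
  assumes "\<alpha> > 0" and g: "tikhonov_solution \<alpha> (\<lambda>z. 0) g"
  shows "g z = 0"
proof (cases "z \<in> {a..b}")
  case True
  have L2: "L2 g" using g by (simp add: tikhonov_solution_def)
  have "\<alpha> * (nrm g)\<^sup>2 + (nrm (T g))\<^sup>2 = 0"
    using tikhonov_energy[OF g L2fun_const] by (simp add: L2inner_eq)
  then have "\<alpha> * (nrm g)\<^sup>2 = 0"
    using \<open>\<alpha> > 0\<close> by (metis add_nonneg_eq_0_iff less_imp_le mult_nonneg_nonneg zero_le_power2)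
  then have "nrm g = 0" using \<open>\<alpha> > 0\<close> by simp
  then have "T'T g z = 0" using abs_T'T_le[OF L2, of z] by simp
  moreover have "\<alpha> * g z + T'T g z = 0" using g True unfolding tikhonov_solution_def by blast
  ultimately show ?thesis using \<open>\<alpha> > 0\<close> by simp
qed (use g in \<open>simp add: tikhonov_solution_def\<close>)

lemma tikhonov_solution_unique:
  assumes "\<alpha> > 0" "tikhonov_solution \<alpha> h g" "tikhonov_solution \<alpha> h g'"
  shows "g = g'"
  using tikhonov_solution_zero[OF assms(1), of "\<lambda>z. g z - g' z"] tikhonov_solution_diff[OF assms(2,3)]
  by (intro ext) simp

lemma resolvent_eqI:
  assumes "\<alpha> > 0" "tikhonov_solution \<alpha> h g"
  shows "resolvent a b f \<alpha> h = g"
  unfolding resolvent_def tikhonov_solution_def[symmetric]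
  using assms tikhonov_solution_unique by (intro the_equality) auto

lemma le_add_of_square_le:
  fixes x c w :: real
  assumes "x\<^sup>2 \<le> w * x + c\<^sup>2" "0 \<le> w" "0 \<le> c"
  shows "x \<le> w + c"
proof (rule ccontr)
  assume "\<not> x \<le> w + c"
  then have "c < x - w" "c < x" "0 < x" using assms by linarith+
  then have "c * c < x * (x - w)" using assms by (intro mult_strict_mono') auto
  then show False using assms(1) by (simp add: power2_eq_square algebra_simps)
qed

text \<open>The component \<open>T' w\<close> of the data is damped without any factor in \<open>\<alpha>\<close>; only the remainder
  pays \<open>1 / (2 \<surd>\<alpha>)\<close>.\<close>

lemma tikhonov_solution_nrm_T_le:
  assumes "\<alpha> > 0" and sol: "tikhonov_solution \<alpha> h g" and h: "L2 h" and w: "L2 w" and r: "L2 r"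
    and split: "\<And>z. z \<in> {a..b} \<Longrightarrow> h z = T' w z + r z"
  shows "nrm (T g) \<le> nrm w + nrm r / (2 * sqrt \<alpha>)"
proof (rule le_add_of_square_le)
  have g: "L2 g" using sol by (simp add: tikhonov_solution_def)
  have "ip h g = ip (\<lambda>z. T' w z + r z) g"
    unfolding L2inner_eq by (intro Bochner_Integration.integral_cong) (auto simp: split)
  also have "\<dots> = ip w (T g) + ip r g"
    using g w r by (simp add: L2inner_add_left L2_T' L2inner_commute[of a b "T' w"]
        L2inner_commute[of a b w] ip_T_left)
  finally have energy: "\<alpha> * (nrm g)\<^sup>2 + (nrm (T g))\<^sup>2 = ip w (T g) + ip r g"
    using tikhonov_energy[OF sol h] by simp
  have "ip r g \<le> nrm r * nrm g" using L2inner_Cauchy_Schwarz[OF r g] by simp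
  also have "\<dots> = 2 * (sqrt \<alpha> * nrm g) * (nrm r / (2 * sqrt \<alpha>))" using \<open>\<alpha> > 0\<close> by simp
  also have "\<dots> \<le> (sqrt \<alpha> * nrm g)\<^sup>2 + (nrm r / (2 * sqrt \<alpha>))\<^sup>2" by (rule sum_squares_bound)
  also have "\<dots> = \<alpha> * (nrm g)\<^sup>2 + (nrm r / (2 * sqrt \<alpha>))\<^sup>2" using \<open>\<alpha> > 0\<close> by (simp add: power_mult_distrib)
  finally have "ip r g \<le> \<alpha> * (nrm g)\<^sup>2 + (nrm r / (2 * sqrt \<alpha>))\<^sup>2" .
  moreover have "ip w (T g) \<le> nrm w * nrm (T g)" using L2inner_Cauchy_Schwarz[OF w L2_T[OF g]] by simp
  ultimately show "(nrm (T g))\<^sup>2 \<le> nrm w * nrm (T g) + (nrm r / (2 * sqrt \<alpha>))\<^sup>2" using energy by simp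
qed (use \<open>\<alpha> > 0\<close> in auto)

lemma abs_tikhonov_solution_le:
  assumes "\<alpha> > 0" "tikhonov_solution \<alpha> h g" "z \<in> {a..b}"
  shows "\<bar>g z\<bar> \<le> (\<bar>h z\<bar> + kernel_bound * nrm (T g)) / \<alpha>"
proof -
  have "L2 g" "\<alpha> * g z = h z - T'T g z" using assms(2,3) by (auto simp: tikhonov_solution_def algebra_simps)
  then have "\<alpha> * \<bar>g z\<bar> = \<bar>h z - T'T g z\<bar>" using \<open>\<alpha> > 0\<close> by (metis abs_mult abs_of_pos)
  also have "\<dots> \<le> \<bar>h z\<bar> + kernel_bound * nrm (T g)" using abs_T'T_le_nrm_T[OF \<open>L2 g\<close>, of z] by linarith
  finally show ?thesis using \<open>\<alpha> > 0\<close> by (simp add: field_simps)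
qed

end

section \<open>Spectral representation of the resolvent\<close>

definition spectral_source ::
    "real \<Rightarrow> real \<Rightarrow> (real \<Rightarrow> real) \<Rightarrow> (nat \<Rightarrow> real) \<Rightarrow> (nat \<Rightarrow> real \<Rightarrow> real) \<Rightarrow> real \<Rightarrow>
      (real \<Rightarrow> real) \<Rightarrow> (real \<Rightarrow> real) \<Rightarrow> bool" where
  "spectral_source a b f lam e \<beta> \<phi> \<psi> \<longleftrightarrow>
     (\<lambda>N. L2norm a b (\<lambda>z. \<phi> z - (\<Sum>j<N. lam j powr \<beta> * L2inner a b (Tadj a b f \<psi>) (e j) * e j z))) \<longlonglongrightarrow> 0"

locale spectral_convolution = convolution_operator +
  fixes lam :: "nat \<Rightarrow> real" and e :: "nat \<Rightarrow> real \<Rightarrow> real"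
  assumes spectral: "spectral_system a b f lam e"
begin

lemma e_L2: "L2 (e j)"
  and ip_e: "ip (e i) (e j) = (if i = j then 1 else 0)"
  and lam_pos: "lam j > 0"
  and T'T_expansion_L2: "L2 h \<Longrightarrow> (\<lambda>N. nrm (\<lambda>z. T'T h z - (\<Sum>j<N. lam j * ip h (e j) * e j z))) \<longlonglongrightarrow> 0"
  using spectral unfolding spectral_system_def by auto

lemma T'T_e_AE: "AE z in lborel_Icc a b. T'T (e i) z = lam i * e i z"
proof -
  have "eventually (\<lambda>N. nrm (\<lambda>z. T'T (e i) z - (\<Sum>j<N. lam j * ip (e i) (e j) * e j z))
      = nrm (\<lambda>z. T'T (e i) z - lam i * e i z)) sequentially"
    using eventually_gt_at_top[of i]
  proof eventually_elim
    case (elim N)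
    have "(\<Sum>j<N. lam j * ip (e i) (e j) * e j z) = (\<Sum>j<N. if j = i then lam i * e i z else 0)" for z
      by (intro sum.cong) (auto simp: ip_e)
    then show ?case using elim by simp
  qed
  with T'T_expansion_L2[OF e_L2[of i]] have "(\<lambda>N. nrm (\<lambda>z. T'T (e i) z - lam i * e i z)) \<longlonglongrightarrow> 0"
    using tendsto_cong by fast
  then have "nrm (\<lambda>z. T'T (e i) z - lam i * e i z) = 0" by (simp add: LIMSEQ_const_iff)
  then have "AE z in lborel_Icc a b. T'T (e i) z - lam i * e i z = 0"
    by (intro L2norm_zero_AE L2fun_intros L2_T'T e_L2)
  then show ?thesis by simp
qed

lemma T'T_e_lessThan_AE: "AE z in lborel_Icc a b. \<forall>j<N. T'T (e j) z = lam j * e j z"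
proof -
  have "AE z in lborel_Icc a b. \<forall>j\<in>{..<N}. T'T (e j) z = lam j * e j z"
    by (rule AE_finite_allI) (auto simp: T'T_e_AE)
  then show ?thesis by (simp only: Ball_def lessThan_iff)
qed

lemma T'T_T'T_e: "T'T (T'T (e i)) = (\<lambda>z. lam i * T'T (e i) z)"
  using T'T_cong_AE[OF T'T_e_AE L2_T'T[OF e_L2] L2fun_scale[OF e_L2]] by (simp add: T'T_scale)

lemma ip_T_e: "ip (T (e i)) (T (e j)) = (if i = j then lam i else 0)"
proof -
  have "ip (T (e i)) (T (e j)) = ip (T'T (e i)) (e j)" using e_L2 by (simp add: ip_T'T_left)
  also have "\<dots> = ip (\<lambda>z. lam i * e i z) (e j)"
    by (rule L2inner_cong_AE[OF T'T_e_AE L2_T'T[OF e_L2] L2fun_scale[OF e_L2] e_L2])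
  finally show ?thesis by (simp add: L2inner_scale_left ip_e)
qed

lemma nrm_e: "nrm (e j) = 1"
  using L2norm_sq[of a b "e j"] L2norm_nonneg[of a b "e j"] by (simp add: ip_e power2_eq_1_iff)

lemma lam_le: "lam j \<le> (kernel_bound * sqrt (b - a))\<^sup>2"
proof -
  have "lam j = (nrm (T (e j)))\<^sup>2" by (simp add: L2norm_sq ip_T_e)
  also have "\<dots> \<le> (kernel_bound * sqrt (b - a))\<^sup>2"
    using nrm_T_le[OF e_L2[of j]] by (intro power_mono) (auto simp: nrm_e)
  finally show ?thesis .
qed

lemma nrm_T_sum_e_sq:
  assumes "finite J"
  shows "(nrm (T (\<lambda>z. \<Sum>j\<in>J. c j * e j z)))\<^sup>2 = (\<Sum>j\<in>J. (c j)\<^sup>2 * lam j)"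
  using L2norm_orthogonal_sum[of a b "\<lambda>j. T (e j)" J c] assms
  by (simp add: T_sum T_scale L2fun_scale e_L2 L2_T ip_T_e)

lemma summable_coeff_sq: "L2 h \<Longrightarrow> summable (\<lambda>j. (ip h (e j))\<^sup>2)"
  using Bessel_inequality_L2[of a b e h, OF e_L2 _ _ ip_e] by (intro summableI_nonneg_bounded) auto

lemma projection_residual:
  fixes N :: nat
  assumes h: "L2 h"
  defines "p \<equiv> \<lambda>z. \<Sum>j<N. ip h (e j) * e j z"
  shows "L2 (\<lambda>z. h z - p z)" and "nrm (\<lambda>z. h z - p z) \<le> nrm h"
    and "nrm (T'T (\<lambda>z. h z - p z)) = nrm (\<lambda>z. T'T h z - (\<Sum>j<N. lam j * ip h (e j) * e j z))"
    and "T'T (\<lambda>z. h z - p z) z = T'T h z - (\<Sum>j<N. ip h (e j) * T'T (e j) z)"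
proof -
  have p: "L2 p" unfolding p_def by (intro L2fun_intros e_L2)
  show hp: "L2 (\<lambda>z. h z - p z)" by (intro L2fun_diff h p)
  have "(nrm (\<lambda>z. h z - p z))\<^sup>2 \<le> (nrm h)\<^sup>2"
    unfolding p_def L2norm_projection_residual_sq[OF e_L2 h finite_lessThan ip_e]
    by (simp add: sum_nonneg)
  then show "nrm (\<lambda>z. h z - p z) \<le> nrm h" by (rule power2_le_imp_le) simp
  have T'T_p: "T'T p = (\<lambda>z. \<Sum>j<N. ip h (e j) * T'T (e j) z)"
    unfolding p_def by (simp add: T'T_sum T'T_scale L2fun_scale e_L2)
  then show "T'T (\<lambda>z. h z - p z) z = T'T h z - (\<Sum>j<N. ip h (e j) * T'T (e j) z)"
    using h p by (simp add: T'T_diff)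
  show "nrm (T'T (\<lambda>z. h z - p z)) = nrm (\<lambda>z. T'T h z - (\<Sum>j<N. lam j * ip h (e j) * e j z))"
  proof (rule L2norm_cong_AE)
    show "AE z in lborel_Icc a b. T'T (\<lambda>z. h z - p z) z = T'T h z - (\<Sum>j<N. lam j * ip h (e j) * e j z)"
      using T'T_e_lessThan_AE[of N]
    proof eventually_elim
      case (elim z)
      then have "(\<Sum>j<N. ip h (e j) * T'T (e j) z) = (\<Sum>j<N. lam j * ip h (e j) * e j z)"
        by (intro sum.cong) auto
      then show ?case using h p by (simp add: T'T_diff T'T_p)
    qed
    show "L2 (T'T (\<lambda>z. h z - p z))" by (rule L2_T'T[OF hp])
    show "L2 (\<lambda>z. T'T h z - (\<Sum>j<N. lam j * ip h (e j) * e j z))"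
      by (intro L2fun_diff L2_T'T[OF h] L2fun_sum L2fun_scale e_L2)
  qed
qed

lemma T'T_expansion:
  assumes h: "L2 h"
  shows "(\<lambda>N. \<Sum>j<N. ip h (e j) * T'T (e j) z) \<longlonglongrightarrow> T'T h z"
proof -
  define r where "r N z = h z - (\<Sum>j<N. ip h (e j) * e j z)" for N z
  have r: "L2 (r N)" "nrm (r N) \<le> nrm h" for N
    unfolding r_def using projection_residual(1,2)[OF h] by auto
  define D where "D N = nrm (\<lambda>z. T'T h z - (\<Sum>j<N. lam j * ip h (e j) * e j z))" for N
  have bound: "\<bar>T'T (r N) z\<bar> \<le> kernel_bound * sqrt (D N * nrm h)" for N
  proof -
    have "(nrm (T (r N)))\<^sup>2 = ip (T'T (r N)) (r N)" using r by (simp add: L2norm_sq ip_T'T_left)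
    also have "\<dots> \<le> nrm (T'T (r N)) * nrm (r N)"
      using L2inner_Cauchy_Schwarz[OF L2_T'T[OF r(1)] r(1), of N N] by simp
    also have "\<dots> \<le> D N * nrm h"
      unfolding D_def r_def[abs_def] projection_residual(3)[OF h]
      using r(2)[of N] by (intro mult_left_mono) (auto simp: r_def[abs_def])
    finally have "nrm (T (r N)) \<le> sqrt (D N * nrm h)" by (rule real_le_rsqrt)
    then show ?thesis
      using abs_T'T_le_nrm_T[OF r(1), of N z] kernel_bound_nonneg by (meson mult_left_mono order_trans)
  qed
  have "(\<lambda>N. kernel_bound * sqrt (D N * nrm h)) \<longlonglongrightarrow> kernel_bound * sqrt (0 * nrm h)"
    unfolding D_def by (intro tendsto_intros T'T_expansion_L2 h)
  then have "(\<lambda>N. T'T (r N) z) \<longlonglongrightarrow> 0"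
    using bound
    by (intro Lim_null_comparison[of "\<lambda>N. T'T (r N) z" "\<lambda>N. kernel_bound * sqrt (D N * nrm h)"]) auto
  then have "(\<lambda>N. T'T h z - T'T (r N) z) \<longlonglongrightarrow> T'T h z - 0" by (intro tendsto_intros)
  then show ?thesis unfolding r_def[abs_def] projection_residual(4)[OF h] by simp
qed

text \<open>The expansion of \<open>T'T (\<alpha> + T'T)\<^sup>-\<^sup>1 h\<close> runs over the continuous functions \<open>T'T (e j)\<close> instead of the
  \<open>e j\<close>, so that it converges uniformly and everywhere, not only in \<open>L2\<close>.\<close>

definition smoothed_partial :: "real \<Rightarrow> (real \<Rightarrow> real) \<Rightarrow> nat \<Rightarrow> real \<Rightarrow> real" where
  "smoothed_partial \<alpha> h N z = (\<Sum>j<N. ip h (e j) / (\<alpha> + lam j) * T'T (e j) z)"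

definition smoothed :: "real \<Rightarrow> (real \<Rightarrow> real) \<Rightarrow> real \<Rightarrow> real" where
  "smoothed \<alpha> h z = lim (\<lambda>N. smoothed_partial \<alpha> h N z)"

lemma L2_smoothed_partial: "L2 (smoothed_partial \<alpha> h N)"
  unfolding smoothed_partial_def[abs_def] by (intro L2fun_intros L2_T'T e_L2)

lemma continuous_on_smoothed_partial: "continuous_on {a..b} (smoothed_partial \<alpha> h N)"
  unfolding smoothed_partial_def[abs_def] by (intro continuous_intros continuous_on_T'T e_L2)

lemma smoothed_partial_diff_le:
  assumes "\<alpha> > 0" and "K \<le> N"
  shows "\<bar>smoothed_partial \<alpha> h N z - smoothed_partial \<alpha> h K z\<bar>
    \<le> kernel_bound * sqrt ((\<Sum>j\<in>{K..<N}. (ip h (e j))\<^sup>2) / \<alpha>)"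
proof -
  define c where "c j = ip h (e j) / (\<alpha> + lam j)" for j
  define p where "p z = (\<Sum>j\<in>{K..<N}. c j * e j z)" for z
  have p: "L2 p" unfolding p_def by (intro L2fun_intros e_L2)
  have "smoothed_partial \<alpha> h N z - smoothed_partial \<alpha> h K z = (\<Sum>j\<in>{K..<N}. c j * T'T (e j) z)"
    using sum_diff_nat_ivl[of 0 K N "\<lambda>j. c j * T'T (e j) z"] \<open>K \<le> N\<close>
    by (simp add: smoothed_partial_def c_def atLeast0LessThan)
  also have "\<dots> = T'T p z" unfolding p_def by (simp add: T'T_sum T'T_scale L2fun_scale e_L2)
  finally have "\<bar>smoothed_partial \<alpha> h N z - smoothed_partial \<alpha> h K z\<bar> \<le> kernel_bound * nrm (T p)"
    using abs_T'T_le_nrm_T[OF p] by simp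
  moreover have "nrm (T p) \<le> sqrt ((\<Sum>j\<in>{K..<N}. (ip h (e j))\<^sup>2) / \<alpha>)"
  proof (rule real_le_rsqrt)
    have "(nrm (T p))\<^sup>2 = (\<Sum>j\<in>{K..<N}. (c j)\<^sup>2 * lam j)" unfolding p_def by (rule nrm_T_sum_e_sq) simp
    also have "\<dots> \<le> (\<Sum>j\<in>{K..<N}. (ip h (e j))\<^sup>2 / \<alpha>)"
    proof (rule sum_mono)
      fix j
      have "\<alpha> * lam j \<le> (\<alpha> + lam j)\<^sup>2"
        using \<open>\<alpha> > 0\<close> lam_pos[of j] by (simp add: power2_eq_square algebra_simps)
      then have "lam j / (\<alpha> + lam j)\<^sup>2 \<le> 1 / \<alpha>" using \<open>\<alpha> > 0\<close> lam_pos[of j] by (simp add: field_simps)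
      from mult_left_mono[OF this zero_le_power2[of "ip h (e j)"]]
      show "(c j)\<^sup>2 * lam j \<le> (ip h (e j))\<^sup>2 / \<alpha>" by (simp add: c_def power_divide)
    qed
    finally show "(nrm (T p))\<^sup>2 \<le> (\<Sum>j\<in>{K..<N}. (ip h (e j))\<^sup>2) / \<alpha>" by (simp add: sum_divide_distrib)
  qed
  ultimately show ?thesis using kernel_bound_nonneg by (meson mult_left_mono order_trans)
qed

lemma smoothed_partial_uniform_limit:
  assumes "\<alpha> > 0" and h: "L2 h"
  shows "uniform_limit UNIV (smoothed_partial \<alpha> h) (smoothed \<alpha> h) sequentially"
proof -
  have "uniformly_Cauchy_on UNIV (smoothed_partial \<alpha> h)"
  proof (rule uniformly_Cauchy_onI')
    fix \<epsilon> :: real assume "\<epsilon> > 0"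
    define d where "d = \<alpha> * (\<epsilon> / (kernel_bound + 1))\<^sup>2"
    have "d > 0" using \<open>\<alpha> > 0\<close> \<open>\<epsilon> > 0\<close> kernel_bound_nonneg by (simp add: d_def)
    then obtain N0 where tail: "\<And>m n. m \<ge> N0 \<Longrightarrow> norm (\<Sum>j\<in>{m..<n}. (ip h (e j))\<^sup>2) < d"
      using summable_coeff_sq[OF h] unfolding summable_Cauchy by meson
    have "dist (smoothed_partial \<alpha> h m z) (smoothed_partial \<alpha> h n z) < \<epsilon>" if "m \<ge> N0" "n > m" for z m n
    proof -
      have "\<bar>smoothed_partial \<alpha> h n z - smoothed_partial \<alpha> h m z\<bar>
          \<le> kernel_bound * sqrt ((\<Sum>j\<in>{m..<n}. (ip h (e j))\<^sup>2) / \<alpha>)"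
        using that by (intro smoothed_partial_diff_le \<open>\<alpha> > 0\<close>) auto
      also have "\<dots> \<le> kernel_bound * sqrt (d / \<alpha>)"
        using tail[OF that(1), of n] \<open>\<alpha> > 0\<close> kernel_bound_nonneg
        by (intro mult_left_mono real_sqrt_le_mono divide_right_mono) (auto dest: less_imp_le abs_le_D1)
      also have "sqrt (d / \<alpha>) = \<epsilon> / (kernel_bound + 1)"
        using \<open>\<alpha> > 0\<close> \<open>\<epsilon> > 0\<close> kernel_bound_nonneg by (simp add: d_def real_sqrt_abs)
      also have "kernel_bound * (\<epsilon> / (kernel_bound + 1)) < \<epsilon>"
        using \<open>\<epsilon> > 0\<close> kernel_bound_nonneg by (simp add: field_simps)
      finally show ?thesis by (simp add: dist_real_def abs_minus_commute)
    qed
    then show "\<exists>N0. \<forall>z\<in>UNIV. \<forall>m\<ge>N0. \<forall>n>m. dist (smoothed_partial \<alpha> h m z) (smoothed_partial \<alpha> h n z) < \<epsilon>"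
      by blast
  qed
  then have "uniformly_convergent_on UNIV (smoothed_partial \<alpha> h)" by (rule Cauchy_uniformly_convergent)
  then show ?thesis
    unfolding smoothed_def[abs_def] by (rule uniformly_convergent_uniform_limit_iff[THEN iffD1])
qed

lemma smoothed_partial_tendsto:
  "\<alpha> > 0 \<Longrightarrow> L2 h \<Longrightarrow> (\<lambda>N. smoothed_partial \<alpha> h N z) \<longlonglongrightarrow> smoothed \<alpha> h z"
  using tendsto_uniform_limitI[OF smoothed_partial_uniform_limit] by simp

lemma continuous_on_smoothed:
  assumes "\<alpha> > 0" "L2 h"
  shows "continuous_on {a..b} (smoothed \<alpha> h)"
proof (rule uniform_limit_theorem)
  show "uniform_limit {a..b} (smoothed_partial \<alpha> h) (smoothed \<alpha> h) sequentially"
    by (rule uniform_limit_on_subset[OF smoothed_partial_uniform_limit[OF assms]]) simp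
qed (auto simp: continuous_on_smoothed_partial)

lemma L2_smoothed:
  assumes "\<alpha> > 0" "L2 h"
  shows "L2 (smoothed \<alpha> h)"
proof -
  have "smoothed \<alpha> h \<in> borel_measurable borel"
    by (rule borel_measurable_LIMSEQ_real[OF smoothed_partial_tendsto[OF assms]])
       (use L2fun_borel[OF L2_smoothed_partial] in auto)
  moreover obtain C where "\<forall>x\<in>{a..b}. \<bar>smoothed \<alpha> h x\<bar> \<le> C"
    using compact_imp_bounded[OF compact_continuous_image[OF continuous_on_smoothed[OF assms]]]
    by (auto simp: bounded_iff)
  then have "\<And>x. x \<in> {a..b} \<Longrightarrow> \<bar>smoothed \<alpha> h x\<bar> \<le> C" by blast
  ultimately show ?thesis by (rule L2fun_bounded)
qed

lemma nrm_tendsto_0_of_uniform_limit: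
  assumes lim: "uniform_limit {a..b} u v sequentially" and u: "\<And>N. L2 (u N)" and v: "L2 v"
  shows "(\<lambda>N. nrm (\<lambda>z. u N z - v z)) \<longlonglongrightarrow> 0"
proof (rule LIMSEQ_I)
  fix r :: real assume "r > 0"
  define d where "d = r / (2 * sqrt (b - a))"
  have "d > 0" using \<open>r > 0\<close> a_less_b by (simp add: d_def)
  from uniform_limitD[OF lim this] obtain n0 where
    close: "\<And>n x. n \<ge> n0 \<Longrightarrow> x \<in> {a..b} \<Longrightarrow> dist (u n x) (v x) < d"
    unfolding eventually_sequentially by blast
  have "nrm (\<lambda>z. u n z - v z) < r" if "n \<ge> n0" for n
  proof -
    have "nrm (\<lambda>z. u n z - v z) \<le> d * sqrt (b - a)"
      using a_less_b close[OF that] L2fun_borel[OF L2fun_diff[OF u v]]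
      by (intro L2norm_bounded) (auto simp: dist_real_def dest: less_imp_le)
    also have "\<dots> = r / 2" using a_less_b by (simp add: d_def)
    finally show ?thesis using \<open>r > 0\<close> by simp
  qed
  then show "\<exists>no. \<forall>n\<ge>no. norm (nrm (\<lambda>z. u n z - v z) - 0) < r" by auto
qed

lemma T'T_smoothed_partial:
  assumes "\<alpha> > 0"
  shows "T'T (smoothed_partial \<alpha> h N) z + \<alpha> * smoothed_partial \<alpha> h N z = (\<Sum>j<N. ip h (e j) * T'T (e j) z)"
proof -
  have "T'T (smoothed_partial \<alpha> h N) z = (\<Sum>j<N. ip h (e j) / (\<alpha> + lam j) * (lam j * T'T (e j) z))"
    unfolding smoothed_partial_def[abs_def]
    by (subst T'T_sum) (intro L2fun_scale L2_T'T e_L2, simp only: T'T_scale T'T_T'T_e)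
  then have "T'T (smoothed_partial \<alpha> h N) z + \<alpha> * smoothed_partial \<alpha> h N z
      = (\<Sum>j<N. ip h (e j) / (\<alpha> + lam j) * (lam j + \<alpha>) * T'T (e j) z)"
    by (simp add: smoothed_partial_def sum_distrib_left flip: sum.distrib)
       (simp add: algebra_simps add_divide_distrib)
  also have "\<dots> = (\<Sum>j<N. ip h (e j) * T'T (e j) z)"
  proof (rule sum.cong[OF refl])
    fix j
    have "\<alpha> + lam j \<noteq> 0" using \<open>\<alpha> > 0\<close> lam_pos[of j] by linarith
    then show "ip h (e j) / (\<alpha> + lam j) * (lam j + \<alpha>) * T'T (e j) z = ip h (e j) * T'T (e j) z"
      by (simp add: add.commute)
  qed
  finally show ?thesis .
qed

lemma T'T_smoothed:
  assumes "\<alpha> > 0" and h: "L2 h"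
  shows "T'T (smoothed \<alpha> h) z + \<alpha> * smoothed \<alpha> h z = T'T h z"
proof (rule LIMSEQ_unique)
  let ?S = "smoothed \<alpha> h" and ?SN = "smoothed_partial \<alpha> h"
  define c where "c = kernel_bound * (kernel_bound * sqrt (b - a))"
  note S = L2_smoothed[OF assms] and SN = L2_smoothed_partial
  have "\<bar>T'T (?SN N) z - T'T ?S z\<bar> \<le> c * nrm (\<lambda>z. ?SN N z - ?S z)" for N
    using abs_T'T_le[OF L2fun_diff[OF SN S], of \<alpha> h N z] T'T_diff[OF SN S, of \<alpha> h N] by (simp add: c_def)
  moreover have "(\<lambda>N. nrm (\<lambda>z. ?SN N z - ?S z)) \<longlonglongrightarrow> 0"
    by (rule nrm_tendsto_0_of_uniform_limit
          [OF uniform_limit_on_subset[OF smoothed_partial_uniform_limit[OF assms]]])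
       (auto simp: S SN)
  ultimately have "(\<lambda>N. T'T (?SN N) z - T'T ?S z) \<longlonglongrightarrow> 0"
    by (intro Lim_null_comparison[of "\<lambda>N. T'T (?SN N) z - T'T ?S z" "\<lambda>N. c * nrm (\<lambda>z. ?SN N z - ?S z)"]
        tendsto_mult_right_zero) auto
  then have "(\<lambda>N. T'T (?SN N) z) \<longlonglongrightarrow> T'T ?S z" by (simp add: LIM_zero_iff)
  then show "(\<lambda>N. T'T (?SN N) z + \<alpha> * ?SN N z) \<longlonglongrightarrow> T'T ?S z + \<alpha> * ?S z"
    by (intro tendsto_intros smoothed_partial_tendsto assms)
  show "(\<lambda>N. T'T (?SN N) z + \<alpha> * ?SN N z) \<longlonglongrightarrow> T'T h z"
    unfolding T'T_smoothed_partial[OF \<open>\<alpha> > 0\<close>] by (rule T'T_expansion[OF h])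
qed

lemma
  assumes "\<alpha> > 0" and h: "L2 h"
  shows tikhonov_solution_resolvent: "tikhonov_solution \<alpha> h (resolvent a b f \<alpha> h)"
    and resolvent_eq: "z \<in> {a..b} \<Longrightarrow> resolvent a b f \<alpha> h z = (h z - smoothed \<alpha> h z) / \<alpha>"
proof -
  define g0 where "g0 z = (1 / \<alpha>) * (h z - smoothed \<alpha> h z)" for z
  define g where "g z = indicator {a..b} z * g0 z" for z
  note S = L2_smoothed[OF assms]
  have g0: "L2 g0" unfolding g0_def by (intro L2fun_intros h S)
  have g: "L2 g"
    using L2fun_borel[OF g0] by (intro L2fun_dominated[OF g0]) (auto simp: g_def[abs_def])
  have "T'T g = T'T g0" by (rule T'T_cong_AE) (auto simp: g g0 g_def intro!: AE_I2)
  then have T'T_g: "T'T g z = (1 / \<alpha>) * (T'T h z - T'T (smoothed \<alpha> h) z)" for z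
    unfolding g0_def using h S by (simp only: T'T_scale T'T_diff)
  have sol: "tikhonov_solution \<alpha> h g"
    unfolding tikhonov_solution_def
  proof (intro conjI g allI ballI impI)
    fix z assume "z \<in> {a..b}"
    then have "\<alpha> * g z = h z - smoothed \<alpha> h z" using \<open>\<alpha> > 0\<close> by (simp add: g_def g0_def)
    moreover have "T'T g z = smoothed \<alpha> h z"
      using T'T_smoothed[OF assms, of z] \<open>\<alpha> > 0\<close> by (simp add: T'T_g field_simps)
    ultimately show "\<alpha> * g z + T'T g z = h z" by simp
  qed (simp add: g_def)
  show "tikhonov_solution \<alpha> h (resolvent a b f \<alpha> h)"
    using resolvent_eqI[OF \<open>\<alpha> > 0\<close> sol] sol by simp
  show "z \<in> {a..b} \<Longrightarrow> resolvent a b f \<alpha> h z = (h z - smoothed \<alpha> h z) / \<alpha>"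
    using resolvent_eqI[OF \<open>\<alpha> > 0\<close> sol] by (simp add: g_def g0_def)
qed

lemma L2_resolvent: "\<alpha> > 0 \<Longrightarrow> L2 h \<Longrightarrow> L2 (resolvent a b f \<alpha> h)"
  using tikhonov_solution_resolvent by (simp add: tikhonov_solution_def)

lemma abs_resolvent_le:
  assumes "\<alpha> > 0" and h: "L2 h" and w: "L2 w" and r: "L2 r"
    and split: "\<And>z. z \<in> {a..b} \<Longrightarrow> h z = T' w z + r z" and z: "z \<in> {a..b}"
  shows "\<bar>resolvent a b f \<alpha> h z\<bar> \<le> (\<bar>h z\<bar> + kernel_bound * (nrm w + nrm r / (2 * sqrt \<alpha>))) / \<alpha>"
proof -
  note sol = tikhonov_solution_resolvent[OF \<open>\<alpha> > 0\<close> h]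
  have "\<bar>resolvent a b f \<alpha> h z\<bar> \<le> (\<bar>h z\<bar> + kernel_bound * nrm (T (resolvent a b f \<alpha> h))) / \<alpha>"
    by (rule abs_tikhonov_solution_le[OF \<open>\<alpha> > 0\<close> sol z])
  also have "\<dots> \<le> (\<bar>h z\<bar> + kernel_bound * (nrm w + nrm r / (2 * sqrt \<alpha>))) / \<alpha>"
    using \<open>\<alpha> > 0\<close> kernel_bound_nonneg tikhonov_solution_nrm_T_le[OF \<open>\<alpha> > 0\<close> sol h w r split]
    by (intro divide_right_mono add_left_mono mult_left_mono) auto
  finally show ?thesis .
qed

lemma error_decomposition:
  assumes "\<alpha> > 0" and h: "L2 h" and \<phi>: "L2 \<phi>" "\<And>z. z \<notin> {a..b} \<Longrightarrow> \<phi> z = 0"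
  shows "\<phi> z - resolvent a b f \<alpha> h z =
    resolvent a b f \<alpha> (\<lambda>z. \<alpha> * \<phi> z) z - resolvent a b f \<alpha> (\<lambda>z. h z - T'T \<phi> z) z"
proof -
  let ?bias = "resolvent a b f \<alpha> (\<lambda>z. \<alpha> * \<phi> z)" and ?noise = "resolvent a b f \<alpha> (\<lambda>z. h z - T'T \<phi> z)"
  have "tikhonov_solution \<alpha> (\<lambda>z. \<alpha> * \<phi> z + T'T \<phi> z) \<phi>" using \<phi> by (simp add: tikhonov_solution_def)
  from tikhonov_solution_diff[OF this tikhonov_solution_diff[OF
      tikhonov_solution_resolvent[OF \<open>\<alpha> > 0\<close> L2fun_scale[OF \<phi>(1), of \<alpha>]]
      tikhonov_solution_resolvent[OF \<open>\<alpha> > 0\<close> L2fun_diff[OF h L2_T'T[OF \<phi>(1)]]]]]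
  have "tikhonov_solution \<alpha> h (\<lambda>z. \<phi> z - (?bias z - ?noise z))" by simp
  from resolvent_eqI[OF \<open>\<alpha> > 0\<close> this] show ?thesis by simp
qed

end

section \<open>The regularization bias\<close>

lemma powr_interpolation_le:
  fixes \<alpha> l \<beta> :: real
  assumes "\<alpha> > 0" "l > 0" "0 \<le> \<beta>" "\<beta> \<le> 1"
  shows "\<alpha> powr (1 - \<beta>) * l powr \<beta> \<le> \<alpha> + l"
proof (cases "l \<le> \<alpha>")
  case True
  have "\<alpha> powr (1 - \<beta>) * l powr \<beta> \<le> \<alpha> powr (1 - \<beta>) * \<alpha> powr \<beta>"
    using True assms by (intro mult_left_mono powr_mono2) auto
  also have "\<dots> = \<alpha>" using \<open>\<alpha> > 0\<close> by (simp add: powr_add[symmetric])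
  finally show ?thesis using \<open>l > 0\<close> by simp
next
  case False
  have "\<alpha> powr (1 - \<beta>) * l powr \<beta> \<le> l powr (1 - \<beta>) * l powr \<beta>"
    using False assms by (intro mult_right_mono powr_mono2) auto
  also have "\<dots> = l" using \<open>l > 0\<close> by (simp add: powr_add[symmetric])
  finally show ?thesis using \<open>\<alpha> > 0\<close> by simp
qed

lemma Tikhonov_qualification:
  fixes \<alpha> \<beta> l L :: real
  assumes "\<alpha> > 0" "l > 0" "l \<le> L" "\<beta> \<ge> 0"
  shows "\<alpha> * l powr \<beta> / (\<alpha> + l) \<le> \<alpha> powr (min \<beta> 1) * (max 1 L) powr \<beta>"
proof (cases "\<beta> \<le> 1")
  case True
  have "\<alpha> * l powr \<beta> = \<alpha> powr \<beta> * (\<alpha> powr (1 - \<beta>) * l powr \<beta>)"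
    using \<open>\<alpha> > 0\<close> by (simp add: mult.assoc[symmetric] powr_add[symmetric])
  also have "\<dots> \<le> \<alpha> powr \<beta> * (\<alpha> + l)"
    using powr_interpolation_le[of \<alpha> l \<beta>] assms True by (intro mult_left_mono) auto
  finally have "\<alpha> * l powr \<beta> / (\<alpha> + l) \<le> \<alpha> powr \<beta>" using assms by (simp add: pos_divide_le_eq)
  also have "\<dots> \<le> \<alpha> powr \<beta> * (max 1 L) powr \<beta>"
    using mult_left_mono[OF ge_one_powr_ge_zero[of "max 1 L" \<beta>], of "\<alpha> powr \<beta>"] assms by simp
  finally show ?thesis using True by simp
next
  case False
  have "\<alpha> * l powr \<beta> / (\<alpha> + l) = \<alpha> * l powr (\<beta> - 1) * (l / (\<alpha> + l))"
    using \<open>l > 0\<close> by (simp add: powr_mult_base[symmetric] powr_diff)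
  also have "\<dots> \<le> \<alpha> * l powr (\<beta> - 1) * 1" using assms by (intro mult_left_mono) (auto simp: field_simps)
  also have "\<dots> \<le> \<alpha> * (max 1 L) powr (\<beta> - 1)" using assms False by (simp, intro powr_mono2) auto
  also have "\<dots> \<le> \<alpha> * (max 1 L) powr \<beta>" using \<open>\<alpha> > 0\<close> by (intro mult_left_mono powr_mono) auto
  finally show ?thesis using False \<open>\<alpha> > 0\<close> by simp
qed

context spectral_convolution
begin

definition qualification_const :: "real \<Rightarrow> real" where
  "qualification_const \<beta> = (max 1 ((kernel_bound * sqrt (b - a))\<^sup>2)) powr \<beta>"

definition bias_coeff :: "real \<Rightarrow> real \<Rightarrow> (real \<Rightarrow> real) \<Rightarrow> nat \<Rightarrow> real" where
  "bias_coeff \<alpha> \<beta> \<psi> j = \<alpha> * lam j powr \<beta> / (\<alpha> + lam j) * ip \<psi> (T (e j)) / lam j"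

definition bias_preimage :: "real \<Rightarrow> real \<Rightarrow> (real \<Rightarrow> real) \<Rightarrow> nat \<Rightarrow> real \<Rightarrow> real" where
  "bias_preimage \<alpha> \<beta> \<psi> N y = (\<Sum>j<N. bias_coeff \<alpha> \<beta> \<psi> j * T (e j) y)"

lemma L2_bias_preimage: "L2 (bias_preimage \<alpha> \<beta> \<psi> N)"
  unfolding bias_preimage_def[abs_def] by (intro L2fun_intros L2_T e_L2)

lemma T'_bias_preimage: "T' (bias_preimage \<alpha> \<beta> \<psi> N) = (\<lambda>z. \<Sum>j<N. bias_coeff \<alpha> \<beta> \<psi> j * T'T (e j) z)"
  unfolding bias_preimage_def[abs_def] by (simp add: T'_sum T'_scale T'T_eq L2fun_scale L2_T e_L2)

lemma nrm_bias_preimage_le: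
  assumes "\<alpha> > 0" "\<beta> \<ge> 0" and \<psi>: "L2 \<psi>"
  shows "nrm (bias_preimage \<alpha> \<beta> \<psi> N) \<le> \<alpha> powr (min \<beta> 1) * qualification_const \<beta> * nrm \<psi>"
proof (rule power2_le_imp_le)
  define Q where "Q = \<alpha> powr (min \<beta> 1) * qualification_const \<beta>"
  define u where "u j y = (1 / sqrt (lam j)) * T (e j) y" for j y
  have u: "L2 (u j)" for j unfolding u_def by (intro L2fun_scale L2_T e_L2)
  have u_orthonormal: "ip (u i) (u j) = (if i = j then 1 else 0)" for i j
    unfolding u_def L2inner_scale_left L2inner_scale_right ip_T_e using lam_pos[of i] by auto
  have coeff: "(bias_coeff \<alpha> \<beta> \<psi> j)\<^sup>2 * lam j \<le> Q\<^sup>2 * (ip \<psi> (u j))\<^sup>2" for j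
  proof -
    define q where "q = \<alpha> * lam j powr \<beta> / (\<alpha> + lam j)"
    have "0 \<le> q" "q \<le> Q"
      unfolding q_def Q_def qualification_const_def
      using assms lam_pos[of j] Tikhonov_qualification[OF \<open>\<alpha> > 0\<close> lam_pos lam_le \<open>\<beta> \<ge> 0\<close>] by auto
    then have "q\<^sup>2 * (ip \<psi> (u j))\<^sup>2 \<le> Q\<^sup>2 * (ip \<psi> (u j))\<^sup>2" by (intro mult_right_mono power_mono) auto
    moreover have "(bias_coeff \<alpha> \<beta> \<psi> j)\<^sup>2 * lam j = q\<^sup>2 * (ip \<psi> (u j))\<^sup>2"
      unfolding bias_coeff_def q_def[symmetric] u_def L2inner_scale_right using lam_pos[of j]
      by (simp add: power_divide power_mult_distrib) (simp add: power2_eq_square)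
    ultimately show ?thesis by simp
  qed
  have "(nrm (bias_preimage \<alpha> \<beta> \<psi> N))\<^sup>2 = (\<Sum>j<N. (bias_coeff \<alpha> \<beta> \<psi> j)\<^sup>2 * ip (T (e j)) (T (e j)))"
    unfolding bias_preimage_def[abs_def] by (rule L2norm_orthogonal_sum) (auto simp: L2_T e_L2 ip_T_e)
  also have "\<dots> \<le> (\<Sum>j<N. Q\<^sup>2 * (ip \<psi> (u j))\<^sup>2)" using coeff by (auto simp: ip_T_e intro: sum_mono)
  also have "\<dots> \<le> Q\<^sup>2 * (nrm \<psi>)\<^sup>2"
    unfolding sum_distrib_left[symmetric]
    by (intro mult_left_mono Bessel_inequality_L2 u u_orthonormal \<psi>) auto
  finally show "(nrm (bias_preimage \<alpha> \<beta> \<psi> N))\<^sup>2 \<le> (\<alpha> powr (min \<beta> 1) * qualification_const \<beta> * nrm \<psi>)\<^sup>2"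
    by (simp add: Q_def power_mult_distrib)
qed (simp add: qualification_const_def)

lemma bias_preimage_solves_AE:
  assumes "\<alpha> > 0" and \<psi>: "L2 \<psi>"
  shows "AE z in lborel_Icc a b. \<alpha> * T' (bias_preimage \<alpha> \<beta> \<psi> N) z + T'T (T' (bias_preimage \<alpha> \<beta> \<psi> N)) z =
    \<alpha> * (\<Sum>j<N. lam j powr \<beta> * ip (T' \<psi>) (e j) * e j z)"
  using T'T_e_lessThan_AE[of N]
proof eventually_elim
  case (elim z)
  define c where "c = bias_coeff \<alpha> \<beta> \<psi>"
  let ?g = "T' (bias_preimage \<alpha> \<beta> \<psi> N)"
  have "T'T ?g z = (\<Sum>j<N. c j * (lam j * T'T (e j) z))"
    unfolding T'_bias_preimage c_def
    by (subst T'T_sum) (intro L2fun_scale L2_T'T e_L2, simp only: T'T_scale T'T_T'T_e)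
  moreover have "?g z = (\<Sum>j<N. c j * T'T (e j) z)" by (simp add: T'_bias_preimage c_def)
  ultimately have "\<alpha> * ?g z + T'T ?g z = (\<Sum>j<N. c j * (\<alpha> + lam j) * T'T (e j) z)"
    by (simp add: sum_distrib_left flip: sum.distrib) (simp add: algebra_simps)
  also have "\<dots> = (\<Sum>j<N. \<alpha> * (lam j powr \<beta> * ip (T' \<psi>) (e j) * e j z))"
  proof (rule sum.cong[OF refl])
    fix j assume "j \<in> {..<N}"
    then have "T'T (e j) z = lam j * e j z" using elim by auto
    moreover have "c j * (\<alpha> + lam j) * lam j = \<alpha> * lam j powr \<beta> * ip \<psi> (T (e j))"
      using \<open>\<alpha> > 0\<close> lam_pos[of j] by (simp add: c_def bias_coeff_def)
    moreover have "ip (T' \<psi>) (e j) = ip \<psi> (T (e j))"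
      using ip_T_left[OF e_L2 \<psi>, of j] by (simp add: L2inner_commute)
    ultimately show "c j * (\<alpha> + lam j) * T'T (e j) z = \<alpha> * (lam j powr \<beta> * ip (T' \<psi>) (e j) * e j z)"
      by algebra
  qed
  finally show ?case by (simp add: sum_distrib_left)
qed

lemma nrm_tikhonov_AE_le:
  assumes "\<alpha> > 0" and x: "L2 x" and E: "L2 E"
    and eq: "AE z in lborel_Icc a b. \<alpha> * x z + T'T x z = \<alpha> * E z"
  shows "nrm x \<le> nrm E"
proof -
  have "\<alpha> * (nrm x)\<^sup>2 + (nrm (T x))\<^sup>2 = \<alpha> * ip E x"
    using tikhonov_energy_AE[OF x L2fun_scale[OF E] eq] by (simp only: L2inner_scale_left)
  then have "\<alpha> * (nrm x)\<^sup>2 \<le> \<alpha> * ip E x" using zero_le_power2[of "nrm (T x)"] by linarith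
  then have "nrm x * nrm x \<le> nrm E * nrm x"
    using \<open>\<alpha> > 0\<close> L2inner_Cauchy_Schwarz[OF E x] by (simp add: power2_eq_square)
  then show ?thesis
    using L2norm_nonneg[of a b x] L2norm_nonneg[of a b E] by (cases "nrm x = 0") auto
qed

lemma continuous_on_resolvent:
  assumes "\<alpha> > 0" "L2 h" "continuous_on {a..b} h"
  shows "continuous_on {a..b} (resolvent a b f \<alpha> h)"
proof -
  have "continuous_on {a..b} (\<lambda>z. (h z - smoothed \<alpha> h z) / \<alpha>)"
    using assms by (intro continuous_intros continuous_on_smoothed) auto
  then show ?thesis by (subst continuous_on_cong[OF refl resolvent_eq[OF assms(1,2)]])
qed

lemma bias_bound:
  assumes "\<alpha> > 0" "\<beta> \<ge> 0" and \<phi>: "L2 \<phi>" "continuous_on {a..b} \<phi>" and \<psi>: "L2 \<psi>"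
    and source: "spectral_source a b f lam e \<beta> \<phi> \<psi>" and z: "z \<in> {a..b}"
  shows "\<bar>resolvent a b f \<alpha> (\<lambda>z. \<alpha> * \<phi> z) z\<bar> \<le>
    kernel_bound * (\<alpha> powr (min \<beta> 1) * qualification_const \<beta> * nrm \<psi>)"
proof (rule continuous_on_Icc_abs_le_L2_limit[OF a_less_b _ _ _ _ _ z])
  let ?d = "resolvent a b f \<alpha> (\<lambda>z. \<alpha> * \<phi> z)" and ?g = "\<lambda>N. T' (bias_preimage \<alpha> \<beta> \<psi> N)"
  define E where "E N z = \<phi> z - (\<Sum>j<N. lam j powr \<beta> * ip (T' \<psi>) (e j) * e j z)" for N z
  have \<alpha>\<phi>: "L2 (\<lambda>z. \<alpha> * \<phi> z)" by (rule L2fun_scale[OF \<phi>(1)])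
  show d: "L2 ?d" by (rule L2_resolvent[OF \<open>\<alpha> > 0\<close> \<alpha>\<phi>])
  show g: "L2 (?g N)" for N by (intro L2_T' L2_bias_preimage)
  show "continuous_on {a..b} ?d"
    using \<phi>(2) by (intro continuous_on_resolvent \<open>\<alpha> > 0\<close> \<alpha>\<phi> continuous_intros)
  show "\<bar>?g N z\<bar> \<le> kernel_bound * (\<alpha> powr (min \<beta> 1) * qualification_const \<beta> * nrm \<psi>)" for N z
    using abs_T'_le[OF L2_bias_preimage, of \<alpha> \<beta> \<psi> N z]
      mult_left_mono[OF nrm_bias_preimage_le[OF \<open>\<alpha> > 0\<close> \<open>\<beta> \<ge> 0\<close> \<psi>, of N] kernel_bound_nonneg] by linarith
  have "nrm (\<lambda>z. ?d z - ?g N z) \<le> nrm (E N)" for N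
  proof (rule nrm_tikhonov_AE_le[OF \<open>\<alpha> > 0\<close> L2fun_diff[OF d g]])
    show "L2 (E N)" unfolding E_def by (intro L2fun_intros \<phi> e_L2)
    have "AE z in lborel_Icc a b. \<alpha> * ?d z + T'T ?d z = \<alpha> * \<phi> z"
      using tikhonov_solution_resolvent[OF \<open>\<alpha> > 0\<close> \<alpha>\<phi>] by (intro AE_I2) (simp add: tikhonov_solution_def)
    with bias_preimage_solves_AE[OF \<open>\<alpha> > 0\<close> \<psi>, of \<beta> N]
    show "AE z in lborel_Icc a b. \<alpha> * (?d z - ?g N z) + T'T (\<lambda>z. ?d z - ?g N z) z = \<alpha> * E N z"
    proof eventually_elim
      case (elim z)
      then show ?case unfolding T'T_diff[OF d g] E_def right_diff_distrib by linarith
    qed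
  qed
  moreover have "(\<lambda>N. nrm (E N)) \<longlonglongrightarrow> 0" using source unfolding spectral_source_def E_def .
  ultimately show "(\<lambda>N. nrm (\<lambda>z. ?d z - ?g N z)) \<longlonglongrightarrow> 0"
    by (intro Lim_null_comparison[of "\<lambda>N. nrm (\<lambda>z. ?d z - ?g N z)" "\<lambda>N. nrm (E N)"]) auto
qed

end

section \<open>Measurability of the coverage events\<close>

lemma isCont_off_endpoints:
  fixes f :: "real \<Rightarrow> real"
  assumes cont: "continuous_on {a..b} f" and zero: "\<And>x. x \<notin> {a..b} \<Longrightarrow> f x = 0" and "x \<noteq> a" "x \<noteq> b"
  shows "isCont f x"
proof (cases "x \<in> {a..b}")
  case True
  then show ?thesis using cont \<open>x \<noteq> a\<close> \<open>x \<noteq> b\<close> by (intro continuous_on_interior[of "{a..b}"]) auto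
next
  case False
  then have "eventually (\<lambda>x'. x' \<in> - {a..b}) (nhds x)" by (intro eventually_nhds_in_open) auto
  then have "eventually (\<lambda>x'. f x' = 0) (nhds x)" by eventually_elim (auto simp: zero)
  then show ?thesis by (simp add: isCont_cong)
qed

lemma continuous_within_Icc_le_rational:
  fixes g :: "real \<Rightarrow> real"
  assumes "a < b" and z: "z \<in> {a..b}" and cont: "continuous (at z within {a..b}) g"
    and le: "\<And>x. x \<in> \<rat> \<inter> {a..b} \<Longrightarrow> \<bar>g x\<bar> \<le> q"
  shows "\<bar>g z\<bar> \<le> q"
proof (rule ccontr)
  assume gt: "\<not> \<bar>g z\<bar> \<le> q"
  have "((\<lambda>x. \<bar>g x\<bar>) \<longlongrightarrow> \<bar>g z\<bar>) (at z within {a..b})"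
    using cont by (intro tendsto_rabs) (simp add: continuous_within)
  then have "eventually (\<lambda>x. q < \<bar>g x\<bar>) (at z within {a..b})" using gt by (intro order_tendstoD(1)) auto
  then obtain d where "d > 0" and
    near: "\<And>x. x \<in> {a..b} \<Longrightarrow> x \<noteq> z \<Longrightarrow> dist x z < d \<Longrightarrow> q < \<bar>g x\<bar>"
    unfolding eventually_at by auto
  have "max a (z - d) < min b (z + d)" using \<open>d > 0\<close> z \<open>a < b\<close> by auto
  then obtain x where x: "x \<in> \<rat>" "max a (z - d) < x" "x < min b (z + d)" using Rats_dense_in_real by blast
  then have "q < \<bar>g x\<bar>" using near[of x] gt by (cases "x = z") (auto simp: dist_real_def)
  moreover have "x \<in> \<rat> \<inter> {a..b}" using x by auto
  ultimately show False using le by fastforce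
qed

lemma sets_Collect_Ball_Icc_abs_le:
  fixes N :: "'w measure" and F :: "'w \<Rightarrow> real \<Rightarrow> real" and \<zeta> :: "'i \<Rightarrow> 'w \<Rightarrow> real"
  assumes "a < b" and J: "countable J" "\<And>j. j \<in> J \<Longrightarrow> \<zeta> j \<in> borel_measurable N"
    and F: "\<And>u. u \<in> borel_measurable N \<Longrightarrow> (\<lambda>\<omega>. F \<omega> (u \<omega>)) \<in> borel_measurable N"
    and cont: "\<And>\<omega> z. z \<in> {a..b} \<Longrightarrow> (\<And>j. j \<in> J \<Longrightarrow> z \<noteq> \<zeta> j \<omega>) \<Longrightarrow> continuous (at z within {a..b}) (F \<omega>)"
    and [measurable]: "q \<in> borel_measurable N"
  shows "{\<omega> \<in> space N. \<forall>z\<in>{a..b}. \<bar>F \<omega> z\<bar> \<le> q \<omega>} \<in> sets N"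
proof -
  have "(\<forall>z\<in>{a..b}. \<bar>F \<omega> z\<bar> \<le> q \<omega>) \<longleftrightarrow>
     (\<forall>z\<in>\<rat> \<inter> {a..b}. \<bar>F \<omega> z\<bar> \<le> q \<omega>) \<and> (\<forall>j\<in>J. \<zeta> j \<omega> \<in> {a..b} \<longrightarrow> \<bar>F \<omega> (\<zeta> j \<omega>)\<bar> \<le> q \<omega>)" for \<omega>
  proof (intro iffI conjI ballI)
    fix z
    assume le: "(\<forall>z\<in>\<rat> \<inter> {a..b}. \<bar>F \<omega> z\<bar> \<le> q \<omega>) \<and> (\<forall>j\<in>J. \<zeta> j \<omega> \<in> {a..b} \<longrightarrow> \<bar>F \<omega> (\<zeta> j \<omega>)\<bar> \<le> q \<omega>)"
      and z: "z \<in> {a..b}"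
    show "\<bar>F \<omega> z\<bar> \<le> q \<omega>"
    proof (cases "\<exists>j\<in>J. z = \<zeta> j \<omega>")
      case False
      then have "continuous (at z within {a..b}) (F \<omega>)" using cont[OF z] by blast
      then show ?thesis using continuous_within_Icc_le_rational[OF \<open>a < b\<close> z] le by blast
    qed (use le z in blast)
  qed auto
  moreover have "{\<omega> \<in> space N. \<forall>z\<in>\<rat> \<inter> {a..b}. \<bar>F \<omega> z\<bar> \<le> q \<omega>} \<in> sets N"
  proof (rule sets.sets_Collect_countable_All')
    show "{\<omega> \<in> space N. \<bar>F \<omega> z\<bar> \<le> q \<omega>} \<in> sets N" for z
    proof -
      have [measurable]: "(\<lambda>\<omega>. F \<omega> z) \<in> borel_measurable N" by (rule F) simp
      show ?thesis by measurable
    qed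
    show "countable (\<rat> \<inter> {a..b})" by (simp add: countable_rat)
  qed
  moreover have "{\<omega> \<in> space N. \<forall>j\<in>J. \<zeta> j \<omega> \<in> {a..b} \<longrightarrow> \<bar>F \<omega> (\<zeta> j \<omega>)\<bar> \<le> q \<omega>} \<in> sets N"
  proof (rule sets.sets_Collect_countable_All'[OF _ J(1)])
    fix j assume "j \<in> J"
    then have [measurable]: "\<zeta> j \<in> borel_measurable N" "(\<lambda>\<omega>. F \<omega> (\<zeta> j \<omega>)) \<in> borel_measurable N"
      using J(2) F by auto
    show "{\<omega> \<in> space N. \<zeta> j \<omega> \<in> {a..b} \<longrightarrow> \<bar>F \<omega> (\<zeta> j \<omega>)\<bar> \<le> q \<omega>} \<in> sets N" by measurable
  qed
  ultimately show ?thesis by (simp add: sets.sets_Collect_conj)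
qed

definition kernel_mean :: "(real \<Rightarrow> real) \<Rightarrow> nat \<Rightarrow> (nat \<Rightarrow> real) \<Rightarrow> (nat \<Rightarrow> real) \<Rightarrow> real \<Rightarrow> real" where
  "kernel_mean f n v y z = (\<Sum>i<n. v i * f (y i - z)) / real n"

lemma kernel_mean_eq_sum: "kernel_mean f n v y = (\<lambda>z. \<Sum>i<n. (v i / real n) * f (y i - z))"
  by (rule ext) (simp add: kernel_mean_def sum_divide_distrib)

lemma phihat_eq: "phihat a b f \<alpha> n y = resolvent a b f \<alpha> (kernel_mean f n (\<lambda>_. 1) y)"
  by (simp add: phihat_def kernel_mean_def[abs_def])

lemma nu_eps_eq: "nu_eps a b f \<alpha> n y \<epsilon> = resolvent a b f \<alpha> (kernel_mean f n \<epsilon> y)"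
  by (simp add: nu_eps_def kernel_mean_def[abs_def])

context spectral_convolution
begin

lemma L2_kernel_mean: "L2 (kernel_mean f n v y)"
  unfolding kernel_mean_eq_sum by (intro L2fun_intros L2_slice)

lemma ip_kernel_mean_e: "ip (kernel_mean f n v y) (e j) = (\<Sum>i<n. (v i / real n) * T (e j) (y i))"
  unfolding kernel_mean_eq_sum T_eq_ip L2inner_commute[of a b "e j"]
  by (subst L2inner_sum_left) (intro L2fun_scale L2_slice e_L2, rule e_L2, simp only: L2inner_scale_left)

lemma borel_measurable_smoothed_kernel_mean:
  fixes N :: "'w measure" and y v :: "nat \<Rightarrow> 'w \<Rightarrow> real" and u :: "'w \<Rightarrow> real"
  assumes "\<alpha> > 0"
    and [measurable]: "\<And>i. i < n \<Longrightarrow> y i \<in> borel_measurable N" "\<And>i. i < n \<Longrightarrow> v i \<in> borel_measurable N"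
      "u \<in> borel_measurable N"
  shows "(\<lambda>\<omega>. smoothed \<alpha> (kernel_mean f n (\<lambda>i. v i \<omega>) (\<lambda>i. y i \<omega>)) (u \<omega>)) \<in> borel_measurable N"
proof (rule borel_measurable_LIMSEQ_real)
  show "(\<lambda>K. smoothed_partial \<alpha> (kernel_mean f n (\<lambda>i. v i \<omega>) (\<lambda>i. y i \<omega>)) K (u \<omega>))
      \<longlonglongrightarrow> smoothed \<alpha> (kernel_mean f n (\<lambda>i. v i \<omega>) (\<lambda>i. y i \<omega>)) (u \<omega>)" for \<omega>
    by (rule smoothed_partial_tendsto[OF \<open>\<alpha> > 0\<close> L2_kernel_mean])
  have [measurable]: "T (e j) \<in> borel_measurable borel" "T'T (e j) \<in> borel_measurable borel" for j
    using L2fun_borel[OF L2_T[OF e_L2]] L2fun_borel[OF L2_T'T[OF e_L2]] by auto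
  show "(\<lambda>\<omega>. smoothed_partial \<alpha> (kernel_mean f n (\<lambda>i. v i \<omega>) (\<lambda>i. y i \<omega>)) K (u \<omega>)) \<in> borel_measurable N" for K
    unfolding smoothed_partial_def ip_kernel_mean_e by measurable
qed

lemma continuous_kernel_mean:
  assumes f_cont: "\<And>x. x \<noteq> a \<Longrightarrow> x \<noteq> b \<Longrightarrow> isCont f x"
    and off: "\<And>i. i < n \<Longrightarrow> y i - z \<noteq> a \<and> y i - z \<noteq> b"
  shows "isCont (kernel_mean f n v y) z"
  unfolding kernel_mean_eq_sum
proof (intro continuous_sum continuous_mult continuous_const)
  fix i assume "i \<in> {..<n}"
  then have "isCont f (y i - z)" using f_cont off by simp
  moreover have "isCont (\<lambda>z. y i - z) z" by (intro continuous_intros)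
  ultimately show "isCont (\<lambda>z. f (y i - z)) z" by (rule isCont_o2[rotated])
qed

text \<open>Since \<open>f\<close> may jump at \<open>a\<close> and \<open>b\<close>, no fixed countable set of points \<open>z\<close> determines the supremum; the
  points \<open>y i - a\<close> and \<open>y i - b\<close>, which depend measurably on the data, have to be added.\<close>

lemma sets_Collect_resolvent_band:
  fixes N :: "'w measure" and y v :: "nat \<Rightarrow> 'w \<Rightarrow> real"
  assumes "\<alpha> > 0" and f_cont: "\<And>x. x \<noteq> a \<Longrightarrow> x \<noteq> b \<Longrightarrow> isCont f x"
    and \<phi>_cont: "continuous_on {a..b} \<phi>" and \<phi>_measurable [measurable]: "\<phi> \<in> borel_measurable borel"
    and y [measurable]: "\<And>i. i < n \<Longrightarrow> y i \<in> borel_measurable N"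
    and v [measurable]: "\<And>i. i < n \<Longrightarrow> v i \<in> borel_measurable N"
    and q: "q \<in> borel_measurable N"
  shows "{\<omega> \<in> space N. \<forall>z\<in>{a..b}.
      \<bar>resolvent a b f \<alpha> (kernel_mean f n (\<lambda>i. v i \<omega>) (\<lambda>i. y i \<omega>)) z - \<phi> z\<bar> \<le> q \<omega>} \<in> sets N"
proof -
  define h where "h \<omega> = kernel_mean f n (\<lambda>i. v i \<omega>) (\<lambda>i. y i \<omega>)" for \<omega>
  define F where "F \<omega> z = (h \<omega> z - smoothed \<alpha> (h \<omega>) z) / \<alpha> - \<phi> z" for \<omega> z
  have "{\<omega> \<in> space N. \<forall>z\<in>{a..b}. \<bar>F \<omega> z\<bar> \<le> q \<omega>} \<in> sets N"
  proof (rule sets_Collect_Ball_Icc_abs_le[where J="{..<n} \<times> {a, b}" and \<zeta>="\<lambda>(i, x) \<omega>. y i \<omega> - x"])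
    show "(\<lambda>\<omega>. F \<omega> (u \<omega>)) \<in> borel_measurable N" if [measurable]: "u \<in> borel_measurable N" for u
    proof -
      have [measurable]: "(\<lambda>\<omega>. smoothed \<alpha> (h \<omega>) (u \<omega>)) \<in> borel_measurable N"
        unfolding h_def by (rule borel_measurable_smoothed_kernel_mean[OF \<open>\<alpha> > 0\<close> y v that])
      have [measurable]: "(\<lambda>\<omega>. h \<omega> (u \<omega>)) \<in> borel_measurable N" unfolding h_def kernel_mean_def by measurable
      show ?thesis unfolding F_def by measurable
    qed
    show "continuous (at z within {a..b}) (F \<omega>)"
      if z: "z \<in> {a..b}" and off: "\<And>j. j \<in> {..<n} \<times> {a, b} \<Longrightarrow> z \<noteq> (case j of (i, x) \<Rightarrow> \<lambda>\<omega>. y i \<omega> - x) \<omega>" for z \<omega>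
    proof -
      have "y i \<omega> - z \<noteq> a \<and> y i \<omega> - z \<noteq> b" if "i < n" for i
        using off[of "(i, a)"] off[of "(i, b)"] that by auto
      with f_cont have "isCont (h \<omega>) z" unfolding h_def by (intro continuous_kernel_mean) auto
      then have "continuous (at z within {a..b}) (h \<omega>)" by (rule continuous_at_imp_continuous_at_within)
      moreover have "continuous (at z within {a..b}) (smoothed \<alpha> (h \<omega>))" "continuous (at z within {a..b}) \<phi>"
        using continuous_on_smoothed[OF \<open>\<alpha> > 0\<close> L2_kernel_mean] \<phi>_cont z
        by (auto simp: h_def continuous_on_eq_continuous_within)
      ultimately have "continuous (at z within {a..b}) (\<lambda>z. (1 / \<alpha>) * (h \<omega> z - smoothed \<alpha> (h \<omega>) z) - \<phi> z)"
        by (intro continuous_diff continuous_mult continuous_const)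
      then show ?thesis by (simp add: F_def[abs_def])
    qed
  qed (use a_less_b q in auto)
  moreover have "resolvent a b f \<alpha> (h \<omega>) z - \<phi> z = F \<omega> z" if "z \<in> {a..b}" for \<omega> z
    using resolvent_eq[OF \<open>\<alpha> > 0\<close> L2_kernel_mean that] by (simp add: F_def h_def)
  ultimately show ?thesis by (simp add: h_def cong: conj_cong)
qed

end

section \<open>Events of probability close to one\<close>

definition holds_up_to_prob :: "'a measure \<Rightarrow> real \<Rightarrow> ('a \<Rightarrow> bool) \<Rightarrow> bool" where
  "holds_up_to_prob N \<delta> Q \<longleftrightarrow> (\<exists>E\<in>sets N. measure N E \<le> \<delta> \<and> (\<forall>\<omega>\<in>space N - E. Q \<omega>))"

lemma holds_up_to_probI:
  "E \<in> sets N \<Longrightarrow> measure N E \<le> \<delta> \<Longrightarrow> (\<And>\<omega>. \<omega> \<in> space N \<Longrightarrow> \<omega> \<notin> E \<Longrightarrow> Q \<omega>) \<Longrightarrow> holds_up_to_prob N \<delta> Q"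
  unfolding holds_up_to_prob_def by blast

lemma holds_up_to_prob_mono:
  assumes "holds_up_to_prob N \<delta> Q" "\<delta> \<le> \<delta>'" "\<And>\<omega>. \<omega> \<in> space N \<Longrightarrow> Q \<omega> \<Longrightarrow> Q' \<omega>"
  shows "holds_up_to_prob N \<delta>' Q'"
  using assms unfolding holds_up_to_prob_def by (meson DiffD1 order_trans)

lemma holds_up_to_prob_conj:
  assumes "holds_up_to_prob N \<delta> Q" "holds_up_to_prob N \<delta>' Q'"
  shows "holds_up_to_prob N (\<delta> + \<delta>') (\<lambda>\<omega>. Q \<omega> \<and> Q' \<omega>)"
proof -
  obtain E E' where E: "E \<in> sets N" "measure N E \<le> \<delta>" "\<forall>\<omega>\<in>space N - E. Q \<omega>"
    and E': "E' \<in> sets N" "measure N E' \<le> \<delta>'" "\<forall>\<omega>\<in>space N - E'. Q' \<omega>"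
    using assms unfolding holds_up_to_prob_def by blast
  have "measure N (E \<union> E') \<le> \<delta> + \<delta>'" using measure_Un_le[OF E(1) E'(1)] E(2) E'(2) by linarith
  then show ?thesis using E E' by (intro holds_up_to_probI[of "E \<union> E'"]) auto
qed

lemma holds_up_to_prob_fst:
  assumes "prob_space R" and "holds_up_to_prob N \<delta> Q"
  shows "holds_up_to_prob (N \<Otimes>\<^sub>M R) \<delta> (\<lambda>p. Q (fst p))"
proof -
  interpret R: prob_space R by fact
  obtain E where E: "E \<in> sets N" "measure N E \<le> \<delta>" "\<forall>\<omega>\<in>space N - E. Q \<omega>"
    using assms(2) by (auto simp: holds_up_to_prob_def)
  have "emeasure (N \<Otimes>\<^sub>M R) (E \<times> space R) = emeasure N E"
    using E(1) by (subst R.emeasure_pair_measure_Times) (auto simp: R.emeasure_space_1)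
  then show ?thesis
    using E by (intro holds_up_to_probI[of "E \<times> space R"]) (auto simp: measure_def space_pair_measure)
qed

lemma (in prob_space) prob_ge_of_holds_up_to_prob:
  assumes "holds_up_to_prob M \<delta> Q" and Q: "{\<omega> \<in> space M. Q \<omega>} \<in> sets M"
  shows "1 - \<delta> \<le> prob {\<omega> \<in> space M. Q \<omega>}"
proof -
  obtain E where E: "E \<in> sets M" "prob E \<le> \<delta>" "\<forall>\<omega>\<in>space M - E. Q \<omega>"
    using assms(1) unfolding holds_up_to_prob_def by blast
  have "1 - \<delta> \<le> prob (space M - E)" using E prob_compl[OF E(1)] by simp
  also have "\<dots> \<le> prob {\<omega> \<in> space M. Q \<omega>}" using E Q by (intro finite_measure_mono) auto
  finally show ?thesis .
qed

section \<open>Empirical processes\<close>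

lemma indep_vars_PiM_coordinates:
  assumes "\<And>i. prob_space (N i)" and I: "I \<noteq> {}"
  shows "prob_space.indep_vars (PiM I N) N (\<lambda>i \<omega>. \<omega> i) I"
proof -
  interpret product_prob_space N I by (intro product_prob_spaceI assms)
  have "distr (PiM I N) (PiM I N) (\<lambda>x. \<lambda>i\<in>I. x i) = distr (PiM I N) (PiM I N) (\<lambda>x. x)"
    by (rule distr_cong) (auto simp: space_PiM)
  moreover have "(\<Pi>\<^sub>M i\<in>I. distr (PiM I N) (N i) (\<lambda>\<omega>. \<omega> i)) = PiM I N"
    by (rule PiM_cong) (auto simp: PiM_component)
  ultimately show ?thesis
    by (subst P.indep_vars_iff_distr_eq_PiM'[OF I]) (auto simp: distr_id)
qed

context prob_space
begin

lemma integrable_of_square: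
  fixes X :: "'a \<Rightarrow> real"
  assumes "random_variable borel X" "integrable M (\<lambda>\<omega>. (X \<omega>)\<^sup>2)"
  shows "integrable M X"
  using integrable_mult_of_squares[OF assms(1) _ assms(2), of "\<lambda>_. 1"] by simp

lemma expectation_square_sum_indep_vars:
  fixes X :: "'i \<Rightarrow> 'a \<Rightarrow> real"
  assumes "finite I" and indep: "indep_vars (\<lambda>_. borel) X I"
    and sq: "\<And>i. i \<in> I \<Longrightarrow> integrable M (\<lambda>\<omega>. (X i \<omega>)\<^sup>2)" and centred: "\<And>i. i \<in> I \<Longrightarrow> expectation (X i) = 0"
  shows "integrable M (\<lambda>\<omega>. (\<Sum>i\<in>I. X i \<omega>)\<^sup>2)"
    and "expectation (\<lambda>\<omega>. (\<Sum>i\<in>I. X i \<omega>)\<^sup>2) = (\<Sum>i\<in>I. expectation (\<lambda>\<omega>. (X i \<omega>)\<^sup>2))"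
proof -
  have rv: "random_variable borel (X i)" if "i \<in> I" for i using indep that by (simp add: indep_vars_def)
  have prod_int: "integrable M (\<lambda>\<omega>. X i \<omega> * X j \<omega>)" if "i \<in> I" "j \<in> I" for i j
    using that by (intro integrable_mult_of_squares rv sq)
  have off_diagonal: "expectation (\<lambda>\<omega>. X i \<omega> * X j \<omega>) = 0" if "i \<in> I" "j \<in> I" "i \<noteq> j" for i j
  proof -
    have "indep_vars (\<lambda>_. borel) X {i, j}" by (rule indep_vars_subset[OF indep]) (use that in auto)
    moreover have "integrable M (X k)" if "k \<in> {i, j}" for k
      using that \<open>i \<in> I\<close> \<open>j \<in> I\<close> integrable_of_square[OF rv sq] by auto
    ultimately have "expectation (\<lambda>\<omega>. \<Prod>k\<in>{i, j}. X k \<omega>) = (\<Prod>k\<in>{i, j}. expectation (X k))"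
      by (intro indep_vars_lebesgue_integral) auto
    then show ?thesis using that centred by simp
  qed
  have expand: "(\<Sum>i\<in>I. X i \<omega>)\<^sup>2 = (\<Sum>i\<in>I. \<Sum>j\<in>I. X i \<omega> * X j \<omega>)" for \<omega>
    by (simp add: power2_eq_square sum_product)
  show "integrable M (\<lambda>\<omega>. (\<Sum>i\<in>I. X i \<omega>)\<^sup>2)"
    unfolding expand by (intro Bochner_Integration.integrable_sum prod_int)
  have "expectation (\<lambda>\<omega>. (\<Sum>i\<in>I. X i \<omega>)\<^sup>2) = (\<Sum>i\<in>I. expectation (\<lambda>\<omega>. \<Sum>j\<in>I. X i \<omega> * X j \<omega>))"
    unfolding expand
    by (rule Bochner_Integration.integral_sum) (intro Bochner_Integration.integrable_sum prod_int)
  also have "\<dots> = (\<Sum>i\<in>I. \<Sum>j\<in>I. expectation (\<lambda>\<omega>. X i \<omega> * X j \<omega>))"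
    by (intro sum.cong refl Bochner_Integration.integral_sum prod_int)
  also have "\<dots> = (\<Sum>i\<in>I. \<Sum>j\<in>I. if j = i then expectation (\<lambda>\<omega>. (X i \<omega>)\<^sup>2) else 0)"
    by (intro sum.cong refl) (auto simp: off_diagonal power2_eq_square)
  also have "\<dots> = (\<Sum>i\<in>I. expectation (\<lambda>\<omega>. (X i \<omega>)\<^sup>2))" using \<open>finite I\<close> by simp
  finally show "expectation (\<lambda>\<omega>. (\<Sum>i\<in>I. X i \<omega>)\<^sup>2) = (\<Sum>i\<in>I. expectation (\<lambda>\<omega>. (X i \<omega>)\<^sup>2))" .
qed

abbreviation sample :: "nat \<Rightarrow> (nat \<Rightarrow> 'a) measure" where
  "sample n \<equiv> \<Pi>\<^sub>M i\<in>{..<n}. M"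

definition empirical_process :: "nat \<Rightarrow> (nat \<Rightarrow> 'a) \<Rightarrow> ('a \<Rightarrow> real) \<Rightarrow> real" where
  "empirical_process n \<omega> u = (\<Sum>i<n. u (\<omega> i)) / real n - expectation u"

lemma prob_space_sample: "prob_space (sample n)"
  by (intro prob_space_PiM prob_space_axioms)

lemma borel_measurable_coordinate [measurable (raw)]:
  fixes u :: "'a \<Rightarrow> 'b :: topological_space"
  assumes "i < n" "u \<in> borel_measurable M"
  shows "(\<lambda>\<omega>. u (\<omega> i)) \<in> borel_measurable (sample n)"
  using assms by (intro measurable_compose[OF measurable_component_singleton]) auto

lemma distr_coordinate: "i < n \<Longrightarrow> distr (sample n) M (\<lambda>\<omega>. \<omega> i) = M"
  by (intro distr_PiM_component prob_space_axioms) auto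

lemma
  fixes u :: "'a \<Rightarrow> real"
  assumes "i < n" and u: "u \<in> borel_measurable M"
  shows integral_coordinate: "(\<integral>\<omega>. u (\<omega> i) \<partial>sample n) = expectation u"
    and integrable_coordinate: "integrable M u \<Longrightarrow> integrable (sample n) (\<lambda>\<omega>. u (\<omega> i))"
proof -
  have m: "(\<lambda>\<omega>. \<omega> i) \<in> sample n \<rightarrow>\<^sub>M M" using \<open>i < n\<close> by (intro measurable_component_singleton) auto
  show "(\<integral>\<omega>. u (\<omega> i) \<partial>sample n) = expectation u"
    using integral_distr[OF m u] distr_coordinate[OF \<open>i < n\<close>] by simp
  show "integrable M u \<Longrightarrow> integrable (sample n) (\<lambda>\<omega>. u (\<omega> i))"
    using integrable_distr_eq[OF m u] distr_coordinate[OF \<open>i < n\<close>] by simp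
qed

lemma indep_vars_coordinates:
  fixes u :: "'a \<Rightarrow> real"
  assumes "n > 0" "u \<in> borel_measurable M"
  shows "prob_space.indep_vars (sample n) (\<lambda>_. borel) (\<lambda>i \<omega>. u (\<omega> i)) {..<n}"
proof -
  interpret Sn: prob_space "sample n" by (rule prob_space_sample)
  have "Sn.indep_vars (\<lambda>_. M) (\<lambda>i \<omega>. \<omega> i) {..<n}"
    using \<open>n > 0\<close> by (intro indep_vars_PiM_coordinates prob_space_axioms) auto
  from Sn.indep_vars_compose2[OF this, of "\<lambda>_. u" "\<lambda>_. borel"] show ?thesis using assms(2) by simp
qed

lemma borel_measurable_empirical_process [measurable (raw)]:
  "u \<in> borel_measurable M \<Longrightarrow> (\<lambda>\<omega>. empirical_process n \<omega> u) \<in> borel_measurable (sample n)"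
  unfolding empirical_process_def
  by (intro borel_measurable_diff borel_measurable_divide borel_measurable_sum) auto

lemma empirical_process_diff:
  assumes "integrable M u" "integrable M v"
  shows "empirical_process n \<omega> (\<lambda>y. u y - v y) = empirical_process n \<omega> u - empirical_process n \<omega> v"
  using assms by (simp add: empirical_process_def sum_subtractf diff_divide_distrib)

lemma empirical_process_scale:
  "empirical_process n \<omega> (\<lambda>y. c * u y) = c * empirical_process n \<omega> u"
  by (simp add: empirical_process_def right_diff_distrib flip: sum_distrib_left)

lemma empirical_process_sum:
  assumes "\<And>k. k \<in> K \<Longrightarrow> integrable M (u k)"
  shows "empirical_process n \<omega> (\<lambda>y. \<Sum>k\<in>K. u k y) = (\<Sum>k\<in>K. empirical_process n \<omega> (u k))"
proof -
  have "(\<Sum>i<n. \<Sum>k\<in>K. u k (\<omega> i)) / real n = (\<Sum>k\<in>K. (\<Sum>i<n. u k (\<omega> i)) / real n)"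
    by (subst sum.swap) (simp add: sum_divide_distrib)
  then show ?thesis
    using assms by (simp add: empirical_process_def sum_subtractf Bochner_Integration.integral_sum)
qed

lemma abs_expectation_le:
  fixes u :: "'a \<Rightarrow> real"
  assumes "u \<in> borel_measurable M" "\<And>y. \<bar>u y\<bar> \<le> c"
  shows "\<bar>expectation u\<bar> \<le> c"
proof -
  have "integrable M u" using assms by (intro integrable_const_bound[where B=c]) auto
  then have "\<bar>expectation u\<bar> \<le> expectation (\<lambda>_. c)"
    by (intro order_trans[OF integral_abs_bound integral_mono]) (use assms(2) in auto)
  then show ?thesis by (simp add: prob_space)
qed

lemma abs_empirical_process_le:
  assumes "u \<in> borel_measurable M" and bound: "\<And>y. \<bar>u y\<bar> \<le> c"
  shows "\<bar>empirical_process n \<omega> u\<bar> \<le> 2 * c"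
proof -
  have "\<bar>\<Sum>i<n. u (\<omega> i)\<bar> \<le> (\<Sum>i<n. c)" by (rule order_trans[OF sum_abs sum_mono]) (rule bound)
  then have "\<bar>(\<Sum>i<n. u (\<omega> i)) / real n\<bar> \<le> c"
    using order_trans[OF abs_ge_zero bound] by (cases "n = 0") (auto simp: pos_divide_le_eq mult.commute)
  then show ?thesis unfolding empirical_process_def using abs_expectation_le[OF assms] by linarith
qed

lemma abs_empirical_process_diff_le:
  assumes "integrable M u" "integrable M v" "integrable M w" and le: "\<And>y. \<bar>u y - v y\<bar> \<le> w y"
  shows "\<bar>empirical_process n \<omega> u - empirical_process n \<omega> v\<bar> \<le> empirical_process n \<omega> w + 2 * expectation w"
proof -
  have "\<bar>(\<Sum>i<n. u (\<omega> i) - v (\<omega> i)) / real n\<bar> \<le> (\<Sum>i<n. w (\<omega> i)) / real n"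
    by (simp add: abs_divide divide_right_mono order_trans[OF sum_abs sum_mono[OF le]])
  moreover have "\<bar>expectation (\<lambda>y. u y - v y)\<bar> \<le> expectation w"
    by (rule order_trans[OF integral_abs_bound integral_mono]) (use assms in auto)
  ultimately show ?thesis
    unfolding empirical_process_diff[OF assms(1,2), symmetric] unfolding empirical_process_def by linarith
qed

lemma empirical_process_second_moment_le:
  assumes "n > 0" and u: "u \<in> borel_measurable M" and sq: "integrable M (\<lambda>y. (u y)\<^sup>2)"
  shows "integrable (sample n) (\<lambda>\<omega>. (empirical_process n \<omega> u)\<^sup>2)"
    and "(\<integral>\<omega>. (empirical_process n \<omega> u)\<^sup>2 \<partial>sample n) \<le> expectation (\<lambda>y. (u y)\<^sup>2) / real n"
proof -
  interpret Sn: prob_space "sample n" by (rule prob_space_sample)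
  define U where "U y = u y - expectation u" for y
  have u_int: "integrable M u" by (rule integrable_of_square[OF u sq])
  have U [measurable]: "U \<in> borel_measurable M" unfolding U_def[abs_def] using u by measurable
  have U_sq: "integrable M (\<lambda>y. (U y)\<^sup>2)" unfolding U_def power2_diff using u_int sq by simp
  have "expectation U = 0" unfolding U_def using u_int by (simp add: prob_space)
  then have centred: "Sn.expectation (\<lambda>\<omega>. U (\<omega> i)) = 0" if "i \<in> {..<n}" for i
    using integral_coordinate[OF _ U] that by simp
  have eq: "(empirical_process n \<omega> u)\<^sup>2 = (\<Sum>i<n. U (\<omega> i))\<^sup>2 / (real n)\<^sup>2" for \<omega>
  proof -
    have "empirical_process n \<omega> u = (\<Sum>i<n. U (\<omega> i)) / real n"
      using \<open>n > 0\<close> by (simp add: empirical_process_def U_def sum_subtractf field_simps)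
    then show ?thesis by (simp add: power_divide)
  qed
  have "integrable (sample n) (\<lambda>\<omega>. (U (\<omega> i))\<^sup>2)" if "i \<in> {..<n}" for i
    using that U_sq by (intro integrable_coordinate[of i n "\<lambda>y. (U y)\<^sup>2"]) auto
  note sum_sq = Sn.expectation_square_sum_indep_vars[OF finite_lessThan
      indep_vars_coordinates[OF \<open>n > 0\<close> U] this centred]
  show "integrable (sample n) (\<lambda>\<omega>. (empirical_process n \<omega> u)\<^sup>2)"
    unfolding eq using sum_sq(1) by simp
  have "(\<integral>\<omega>. (empirical_process n \<omega> u)\<^sup>2 \<partial>sample n) = (\<Sum>i<n. Sn.expectation (\<lambda>\<omega>. (U (\<omega> i))\<^sup>2)) / (real n)\<^sup>2"
    unfolding eq using sum_sq(2) by simp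
  also have "\<dots> = expectation (\<lambda>y. (U y)\<^sup>2) / real n"
    using integral_coordinate[of _ n "\<lambda>y. (U y)\<^sup>2"] by (simp add: power2_eq_square[of "real n"])
  also have "expectation (\<lambda>y. (U y)\<^sup>2) \<le> expectation (\<lambda>y. (u y)\<^sup>2)"
    unfolding U_def using variance_eq[OF u_int sq] by simp
  finally show "(\<integral>\<omega>. (empirical_process n \<omega> u)\<^sup>2 \<partial>sample n) \<le> expectation (\<lambda>y. (u y)\<^sup>2) / real n"
    by (simp add: divide_right_mono)
qed

lemma empirical_process_Hoeffding:
  assumes "n > 0" and u: "u \<in> borel_measurable M" and bound: "\<And>y. 0 \<le> u y" "\<And>y. u y \<le> c"
    and "c > 0" "t \<ge> 0"
  shows "measure (sample n) {\<omega> \<in> space (sample n). \<bar>empirical_process n \<omega> u\<bar> \<ge> t / sqrt (real n)}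
    \<le> 2 * exp (- 2 * t\<^sup>2 / c\<^sup>2)"
proof -
  interpret Sn: prob_space "sample n" by (rule prob_space_sample)
  have law: "distr (sample n) borel (\<lambda>\<omega>. u (\<omega> i)) = distr M borel u" if "i < n" for i
  proof -
    have "distr (distr (sample n) M (\<lambda>\<omega>. \<omega> i)) borel u = distr (sample n) borel (u \<circ> (\<lambda>\<omega>. \<omega> i))"
      using that u by (intro distr_distr) auto
    then show ?thesis by (simp add: distr_coordinate[OF that] comp_def)
  qed
  interpret Hoeffding_ineq_iid "sample n" "{..<n}" "\<lambda>i \<omega>. u (\<omega> i)" "\<lambda>\<omega>. u (\<omega> 0)" 0 c "\<integral>\<omega>. u (\<omega> 0) \<partial>sample n"
  proof unfold_locales
    show "Sn.indep_vars (\<lambda>_. borel) (\<lambda>i \<omega>. u (\<omega> i)) {..<n}" by (rule indep_vars_coordinates[OF \<open>n > 0\<close> u])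
    show "distr (sample n) borel (\<lambda>\<omega>. u (\<omega> i)) = distr (sample n) borel (\<lambda>\<omega>. u (\<omega> 0))" if "i \<in> {..<n}" for i
      using that by (simp only: law[OF \<open>n > 0\<close>] law lessThan_iff)
    show "(\<lambda>\<omega>. u (\<omega> 0)) \<in> borel_measurable (sample n)" using \<open>n > 0\<close> u by measurable
    show "AE \<omega> in sample n. u (\<omega> 0) \<in> {0..c}" using bound by simp
    show "(\<integral>\<omega>. u (\<omega> 0) \<partial>sample n) \<equiv> (\<integral>\<omega>. u (\<omega> 0) \<partial>sample n)" by simp
  qed simp
  have "measure (sample n) {\<omega> \<in> space (sample n).
        \<bar>(\<Sum>i<n. u (\<omega> i)) / real (card {..<n}) - (\<integral>\<omega>. u (\<omega> 0) \<partial>sample n)\<bar> \<ge> t / sqrt (real n)}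
      \<le> 2 * exp (- 2 * real (card {..<n}) * (t / sqrt (real n))\<^sup>2 / (c - 0)\<^sup>2)"
    by (rule Hoeffding_ineq_abs_ge') (use assms in auto)
  also have "- 2 * real (card {..<n}) * (t / sqrt (real n))\<^sup>2 / (c - 0)\<^sup>2 = - 2 * t\<^sup>2 / c\<^sup>2"
    using \<open>n > 0\<close> by (simp add: power_divide)
  finally show ?thesis using integral_coordinate[OF \<open>n > 0\<close> u] by (simp add: empirical_process_def)
qed

lemma borel_measurable_empirical_process_pair:
  assumes k: "(\<lambda>(z, y). k z y) \<in> borel_measurable (borel \<Otimes>\<^sub>M M)"
  shows "(\<lambda>(\<omega>, z). empirical_process n \<omega> (k z)) \<in> borel_measurable (sample n \<Otimes>\<^sub>M borel)"
proof -
  have "(\<lambda>z. expectation (k z)) \<in> borel_measurable borel"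
    by (rule borel_measurable_lebesgue_integral) (use k in simp)
  then have "(\<lambda>p. expectation (k (snd p))) \<in> borel_measurable (sample n \<Otimes>\<^sub>M borel)"
    by (rule measurable_compose[OF measurable_snd])
  moreover have "(\<lambda>p. k (snd p) (fst p i)) \<in> borel_measurable (sample n \<Otimes>\<^sub>M borel)" if "i \<in> {..<n}" for i
  proof -
    have "(\<lambda>p. (snd p, fst p i)) \<in> (sample n \<Otimes>\<^sub>M borel) \<rightarrow>\<^sub>M (borel \<Otimes>\<^sub>M M)"
      using that by (intro measurable_Pair measurable_snd
          measurable_compose[OF measurable_fst measurable_component_singleton])
    from measurable_compose[OF this k] show ?thesis by simp
  qed
  ultimately show ?thesis
    unfolding empirical_process_def case_prod_beta'
    by (intro borel_measurable_diff borel_measurable_divide borel_measurable_sum borel_measurable_const)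
qed

lemma L2fun_empirical_process:
  assumes k: "(\<lambda>(z, y). k z y) \<in> borel_measurable (borel \<Otimes>\<^sub>M M)" and bound: "\<And>z y. \<bar>k z y\<bar> \<le> c"
    and \<omega>: "\<omega> \<in> space (sample n)"
  shows "L2fun a b (\<lambda>z. empirical_process n \<omega> (k z))"
proof (rule L2fun_bounded)
  show "(\<lambda>z. empirical_process n \<omega> (k z)) \<in> borel_measurable borel"
    using measurable_Pair2[OF borel_measurable_empirical_process_pair[OF k] \<omega>] by simp
  have "k z \<in> borel_measurable M" for z using measurable_Pair2[OF k, of z] by simp
  then show "\<bar>empirical_process n \<omega> (k z)\<bar> \<le> 2 * c" for z by (rule abs_empirical_process_le[OF _ bound])
qed

lemma L2norm_empirical_process_sq:
  assumes "(\<lambda>(z, y). k z y) \<in> borel_measurable (borel \<Otimes>\<^sub>M M)" "\<And>z y. \<bar>k z y\<bar> \<le> c" "\<omega> \<in> space (sample n)"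
  shows "ennreal ((L2norm a b (\<lambda>z. empirical_process n \<omega> (k z)))\<^sup>2)
    = (\<integral>\<^sup>+z. ennreal ((empirical_process n \<omega> (k z))\<^sup>2) \<partial>lborel_Icc a b)"
  using L2fun_empirical_process[OF assms, of a b]
  by (subst nn_integral_eq_integral) (auto simp: L2fun_iff L2norm_eq)

lemma borel_measurable_empirical_process_sq_pair:
  assumes "(\<lambda>(z, y). k z y) \<in> borel_measurable (borel \<Otimes>\<^sub>M M)"
  shows "(\<lambda>(\<omega>, z). ennreal ((empirical_process n \<omega> (k z))\<^sup>2))
    \<in> borel_measurable (sample n \<Otimes>\<^sub>M lborel_Icc a b)"
proof -
  have "(\<lambda>p. (fst p, snd p)) \<in> (sample n \<Otimes>\<^sub>M lborel_Icc a b) \<rightarrow>\<^sub>M (sample n \<Otimes>\<^sub>M borel)"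
    by (intro measurable_Pair measurable_fst measurable_compose[OF measurable_snd measurable_ident_lborel_Icc])
  from measurable_compose[OF this borel_measurable_empirical_process_pair[OF assms]]
  have "(\<lambda>p. empirical_process n (fst p) (k (snd p))) \<in> borel_measurable (sample n \<Otimes>\<^sub>M lborel_Icc a b)"
    by simp
  then show ?thesis by (simp add: case_prod_beta')
qed

lemma borel_measurable_L2norm_empirical_process:
  assumes k: "(\<lambda>(z, y). k z y) \<in> borel_measurable (borel \<Otimes>\<^sub>M M)" and bound: "\<And>z y. \<bar>k z y\<bar> \<le> c"
  shows "(\<lambda>\<omega>. L2norm a b (\<lambda>z. empirical_process n \<omega> (k z))) \<in> borel_measurable (sample n)"
proof -
  interpret Icc: finite_measure "lborel_Icc a b" by (rule finite_measure_lborel_Icc)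
  let ?N = "\<lambda>\<omega>. L2norm a b (\<lambda>z. empirical_process n \<omega> (k z))"
  have "(\<lambda>\<omega>. ennreal ((?N \<omega>)\<^sup>2)) \<in> borel_measurable (sample n)"
    using Icc.borel_measurable_nn_integral[OF borel_measurable_empirical_process_sq_pair[OF k]]
    by (simp add: L2norm_empirical_process_sq[OF k bound] cong: measurable_cong)
  from borel_measurable_enn2real[OF this] have "(\<lambda>\<omega>. (?N \<omega>)\<^sup>2) \<in> borel_measurable (sample n)" by simp
  then have "(\<lambda>\<omega>. sqrt ((?N \<omega>)\<^sup>2)) \<in> borel_measurable (sample n)" by measurable
  then show ?thesis by simp
qed

lemma nn_integral_empirical_process_sq_le:
  assumes "n > 0" and u: "u \<in> borel_measurable M" and bound: "\<And>y. \<bar>u y\<bar> \<le> c"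
    and second_moment: "expectation (\<lambda>y. (u y)\<^sup>2) \<le> v"
  shows "(\<integral>\<^sup>+\<omega>. ennreal ((empirical_process n \<omega> u)\<^sup>2) \<partial>sample n) \<le> ennreal (v / real n)"
proof -
  have "norm ((u y)\<^sup>2) \<le> c\<^sup>2" for y using power_mono[OF bound[of y], of 2] by simp
  then have "integrable M (\<lambda>y. (u y)\<^sup>2)" using u by (intro integrable_const_bound[where B="c\<^sup>2"]) auto
  note moment = empirical_process_second_moment_le[OF \<open>n > 0\<close> u this]
  have "(\<integral>\<^sup>+\<omega>. ennreal ((empirical_process n \<omega> u)\<^sup>2) \<partial>sample n)
      = ennreal (\<integral>\<omega>. (empirical_process n \<omega> u)\<^sup>2 \<partial>sample n)"
    using moment(1) by (intro nn_integral_eq_integral) auto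
  also have "\<dots> \<le> ennreal (v / real n)"
    by (intro ennreal_leI order_trans[OF moment(2)] divide_right_mono second_moment) simp
  finally show ?thesis .
qed

lemma nn_integral_L2norm_empirical_process_sq_le:
  assumes "n > 0" "a \<le> b" and k: "(\<lambda>(z, y). k z y) \<in> borel_measurable (borel \<Otimes>\<^sub>M M)"
    and bound: "\<And>z y. \<bar>k z y\<bar> \<le> c"
    and second_moment: "\<And>z. z \<in> {a..b} \<Longrightarrow> expectation (\<lambda>y. (k z y)\<^sup>2) \<le> v"
  shows "(\<integral>\<^sup>+\<omega>. ennreal ((L2norm a b (\<lambda>z. empirical_process n \<omega> (k z)))\<^sup>2) \<partial>sample n)
    \<le> ennreal ((b - a) * v / real n)"
proof -
  interpret Sn: prob_space "sample n" by (rule prob_space_sample)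
  interpret Icc: finite_measure "lborel_Icc a b" by (rule finite_measure_lborel_Icc)
  interpret pair_sigma_finite "sample n" "lborel_Icc a b" ..
  let ?E = "\<lambda>\<omega> z. empirical_process n \<omega> (k z)"
  have k_z: "k z \<in> borel_measurable M" for z using measurable_Pair2[OF k, of z] by simp
  have "(\<integral>\<^sup>+\<omega>. ennreal ((L2norm a b (?E \<omega>))\<^sup>2) \<partial>sample n)
      = (\<integral>\<^sup>+z. (\<integral>\<^sup>+\<omega>. ennreal ((?E \<omega> z)\<^sup>2) \<partial>sample n) \<partial>lborel_Icc a b)"
    using Fubini'[OF borel_measurable_empirical_process_sq_pair[OF k]]
    by (simp add: L2norm_empirical_process_sq[OF k bound] cong: nn_integral_cong)
  also have "\<dots> \<le> (\<integral>\<^sup>+z. ennreal (v / real n) \<partial>lborel_Icc a b)"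
    using second_moment
    by (intro nn_integral_mono nn_integral_empirical_process_sq_le[OF \<open>n > 0\<close> k_z bound]) simp
  also have "\<dots> = ennreal (v / real n) * ennreal (b - a)"
    using \<open>a \<le> b\<close> by (simp add: emeasure_restrict_space)
  also have "\<dots> = ennreal ((b - a) * v / real n)"
    using \<open>a \<le> b\<close> by (subst ennreal_mult''[symmetric]) (auto simp: mult.commute)
  finally show ?thesis .
qed

lemma L2norm_empirical_process_le:
  assumes "n > 0" "a \<le> b" and k: "(\<lambda>(z, y). k z y) \<in> borel_measurable (borel \<Otimes>\<^sub>M M)"
    and bound: "\<And>z y. \<bar>k z y\<bar> \<le> c"
    and second_moment: "\<And>z. z \<in> {a..b} \<Longrightarrow> expectation (\<lambda>y. (k z y)\<^sup>2) \<le> v" and "\<tau> > 0"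
  shows "holds_up_to_prob (sample n) ((b - a) * v / (real n * \<tau>\<^sup>2))
    (\<lambda>\<omega>. L2norm a b (\<lambda>z. empirical_process n \<omega> (k z)) \<le> \<tau>)"
proof (rule holds_up_to_probI)
  interpret Sn: prob_space "sample n" by (rule prob_space_sample)
  let ?X = "\<lambda>\<omega>. L2norm a b (\<lambda>z. empirical_process n \<omega> (k z))"
  note [measurable] = borel_measurable_L2norm_empirical_process[OF k bound]
  have "0 \<le> expectation (\<lambda>y. (k a y)\<^sup>2)" by (intro integral_nonneg_AE) simp
  also have "\<dots> \<le> v" using second_moment[of a] \<open>a \<le> b\<close> by simp
  finally have "0 \<le> v" .
  show "{\<omega> \<in> space (sample n). \<tau> < ?X \<omega>} \<in> sets (sample n)" by measurable
  have "emeasure (sample n) {\<omega> \<in> space (sample n). \<tau> < ?X \<omega>}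
      \<le> emeasure (sample n) {\<omega> \<in> space (sample n). 1 \<le> ennreal (1 / \<tau>\<^sup>2) * ennreal ((?X \<omega>)\<^sup>2)}"
  proof (rule emeasure_mono)
    have "1 \<le> ennreal (1 / \<tau>\<^sup>2) * ennreal ((?X \<omega>)\<^sup>2)" if "\<tau> < ?X \<omega>" for \<omega>
    proof -
      have "\<tau>\<^sup>2 \<le> (?X \<omega>)\<^sup>2" using that \<open>\<tau> > 0\<close> by (intro power_mono) auto
      then have "1 \<le> 1 / \<tau>\<^sup>2 * (?X \<omega>)\<^sup>2" using \<open>\<tau> > 0\<close> by (simp add: field_simps)
      then show ?thesis using \<open>\<tau> > 0\<close> by (simp flip: ennreal_mult' add: ennreal_1[symmetric] del: ennreal_1)
    qed
    then show "{\<omega> \<in> space (sample n). \<tau> < ?X \<omega>}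
        \<subseteq> {\<omega> \<in> space (sample n). 1 \<le> ennreal (1 / \<tau>\<^sup>2) * ennreal ((?X \<omega>)\<^sup>2)}" by auto
  qed measurable
  also have "\<dots> \<le> ennreal (1 / \<tau>\<^sup>2) * (\<integral>\<^sup>+\<omega>. ennreal ((?X \<omega>)\<^sup>2) \<partial>sample n)"
    using nn_integral_Markov_inequality
        [of "\<lambda>\<omega>. ennreal ((?X \<omega>)\<^sup>2)" "space (sample n)" "sample n" "ennreal (1 / \<tau>\<^sup>2)"]
    by (simp add: indicator_times_eq_if cong: nn_integral_cong)
  also have "\<dots> \<le> ennreal (1 / \<tau>\<^sup>2) * ennreal ((b - a) * v / real n)"
    by (rule mult_left_mono[OF nn_integral_L2norm_empirical_process_sq_le[OF assms(1-5)] zero_le])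
  also have "\<dots> = ennreal ((b - a) * v / (real n * \<tau>\<^sup>2))" by (simp add: mult.commute flip: ennreal_mult')
  finally show "measure (sample n) {\<omega> \<in> space (sample n). \<tau> < ?X \<omega>} \<le> (b - a) * v / (real n * \<tau>\<^sup>2)"
    using \<open>0 \<le> v\<close> \<open>a \<le> b\<close> unfolding Sn.emeasure_eq_measure by (subst (asm) ennreal_le_iff) auto
qed auto

end

section \<open>The deconvolution model\<close>

locale deconvolution_model = spectral_convolution +
  fixes s :: real and \<phi> :: "real \<Rightarrow> real"
  assumes s: "0 < s" "s \<le> 1"
    and f_nonneg: "\<And>x. f x \<ge> 0" and integral_f: "integral\<^sup>L lborel f = 1"
    and continuous_on_f: "continuous_on {a..b} f" and f_zero: "\<And>x. x \<notin> {a..b} \<Longrightarrow> f x = 0"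
    and f_Hoelder: "\<And>x x'. x \<in> {a..b} \<Longrightarrow> x' \<in> {a..b} \<Longrightarrow> \<bar>f x - f x'\<bar> \<le> M * \<bar>x - x'\<bar> powr s"
    and \<phi>_nonneg: "\<And>x. \<phi> x \<ge> 0" and \<phi>_measurable [measurable]: "\<phi> \<in> borel_measurable borel"
    and integral_\<phi>: "integral\<^sup>L lborel \<phi> = 1" and continuous_on_\<phi>: "continuous_on {a..b} \<phi>"
    and \<phi>_zero: "\<And>x. x \<notin> {a..b} \<Longrightarrow> \<phi> x = 0" and abs_\<phi>_le: "\<And>x. x \<in> {a..b} \<Longrightarrow> \<bar>\<phi> x\<bar> \<le> M"
    and r_zero: "\<And>x. x \<notin> {a..b} \<Longrightarrow> Top a b f \<phi> x = 0"
begin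

abbreviation "r \<equiv> Top a b f \<phi>"
abbreviation "P \<equiv> Ymeasure a b f \<phi>"

lemma L2_\<phi>: "L2 \<phi>"
  by (rule L2fun_bounded[OF \<phi>_measurable abs_\<phi>_le])

lemma integral_\<phi>_Icc: "(\<integral>z. \<phi> z \<partial>lborel_Icc a b) = 1"
  using integral_lborel_Icc_eq_lborel[OF \<phi>_zero] integral_\<phi> by simp

lemma r_measurable [measurable]: "r \<in> borel_measurable borel"
  by (rule borel_measurable_T[OF L2_\<phi>])

lemma M_pos: "M > 0"
proof (rule ccontr)
  assume "\<not> M > 0"
  then have "f = (\<lambda>_. 0)" using abs_f_le by (intro ext) (metis abs_le_zero_iff linorder_not_le order_trans)
  then show False using integral_f by simp
qed

lemma f_le: "f x \<le> M"
  using abs_f_le[of x] by simp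

lemma abs_f_diff_le: "\<bar>f x - f x'\<bar> \<le> M"
  using f_nonneg[of x] f_nonneg[of x'] f_le[of x] f_le[of x'] by linarith

lemma r_nonneg: "r y \<ge> 0"
  unfolding Top_eq using \<phi>_nonneg f_nonneg by (intro integral_nonneg_AE) auto

lemma r_le: "r y \<le> M"
proof -
  have "r y \<le> (\<integral>z. \<phi> z * M \<partial>lborel_Icc a b)"
    unfolding Top_eq
    using f_le \<phi>_nonneg L2fun_integrable[OF L2_\<phi>] L2fun_integrable_mult[OF L2_\<phi> L2_slice(1)]
    by (intro integral_mono mult_left_mono) auto
  then show ?thesis by (simp add: integral_\<phi>_Icc)
qed

lemma nn_integral_f_shift: "(\<integral>\<^sup>+ y. ennreal (f (y - z)) \<partial>lborel) = 1"
proof -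
  have "integrable lborel f" using not_integrable_integral_eq[of lborel f] integral_f by force
  then have "(\<integral>\<^sup>+ y. ennreal (f y) \<partial>lborel) = 1"
    using nn_integral_eq_integral[of lborel f] f_nonneg integral_f by simp
  then show ?thesis using nn_integral_real_affine[of "\<lambda>y. ennreal (f y)" 1 "- z"] by simp
qed

lemma nn_integral_r: "(\<integral>\<^sup>+ y. ennreal (r y) \<partial>lborel) = 1"
proof -
  interpret finite_measure "lborel_Icc a b" by (rule finite_measure_lborel_Icc)
  interpret pair_sigma_finite lborel "lborel_Icc a b" ..
  have joint: "(\<lambda>(y, z). ennreal (\<phi> z * f (y - z))) \<in> borel_measurable (lborel \<Otimes>\<^sub>M lborel_Icc a b)"
  proof -
    have "(\<lambda>p. \<phi> (snd p) * f (fst p - snd p)) \<in> borel_measurable (borel \<Otimes>\<^sub>M lborel_Icc a b)"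
      by (rule borel_measurable_pair_lborel_Icc(1)) measurable
    then have "(\<lambda>p. \<phi> (snd p) * f (fst p - snd p)) \<in> borel_measurable (lborel \<Otimes>\<^sub>M lborel_Icc a b)"
      by (simp cong: measurable_cong_sets add: sets_pair_measure_cong[OF sets_lborel refl])
    then show ?thesis by (simp add: case_prod_beta')
  qed
  have "ennreal (r y) = (\<integral>\<^sup>+ z. ennreal (\<phi> z * f (y - z)) \<partial>lborel_Icc a b)" for y
    unfolding Top_eq using \<phi>_nonneg f_nonneg L2fun_integrable_mult[OF L2_\<phi> L2_slice(1)]
    by (intro nn_integral_eq_integral[symmetric]) auto
  then have "(\<integral>\<^sup>+ y. ennreal (r y) \<partial>lborel)
      = (\<integral>\<^sup>+ z. (\<integral>\<^sup>+ y. ennreal (\<phi> z * f (y - z)) \<partial>lborel) \<partial>lborel_Icc a b)"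
    by (simp add: Fubini'[OF joint])
  also have "\<dots> = (\<integral>\<^sup>+ z. ennreal (\<phi> z) \<partial>lborel_Icc a b)"
    using \<phi>_nonneg f_nonneg nn_integral_f_shift by (simp add: ennreal_mult nn_integral_cmult)
  also have "\<dots> = 1"
    using \<phi>_nonneg L2fun_integrable[OF L2_\<phi>] by (simp add: nn_integral_eq_integral integral_\<phi>_Icc)
  finally show ?thesis .
qed

sublocale Y: prob_space P
proof (rule prob_spaceI)
  show "emeasure P (space P) = 1"
    unfolding Ymeasure_def using nn_integral_r by (subst emeasure_density) auto
qed

lemma sets_P [measurable_cong]: "sets P = sets borel"
  by (simp add: Ymeasure_def)

lemma borel_measurable_P [measurable (raw)]: "u \<in> borel_measurable borel \<Longrightarrow> u \<in> borel_measurable P"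
  by (simp add: measurable_cong_sets[OF sets_P refl])

lemma integrable_P_bounded:
  fixes u :: "real \<Rightarrow> real"
  assumes "u \<in> borel_measurable borel" "\<And>y. \<bar>u y\<bar> \<le> c"
  shows "integrable P u"
  using assms by (intro Y.integrable_const_bound[where B=c]) auto

lemma
  assumes [measurable]: "u \<in> borel_measurable borel"
  shows integral_P_lborel: "(\<integral>y. u y \<partial>P) = (\<integral>y. r y * u y \<partial>lborel :: real)"
    and integral_P_Icc: "(\<integral>y. u y \<partial>P) = (\<integral>y. r y * u y \<partial>lborel_Icc a b)"
proof -
  show eq: "(\<integral>y. u y \<partial>P) = (\<integral>y. r y * u y \<partial>lborel)"
    unfolding Ymeasure_def using r_nonneg by (subst integral_density) auto
  show "(\<integral>y. u y \<partial>P) = (\<integral>y. r y * u y \<partial>lborel_Icc a b)"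
    unfolding eq using r_zero by (intro integral_lborel_Icc_eq_lborel[symmetric]) auto
qed

lemma T'T_\<phi>: "T'T \<phi> z = (\<integral>y. f (y - z) \<partial>P)"
  by (simp add: T'T_eq Tadj_eq integral_P_Icc)

lemma AE_P: "AE y in P. y \<in> {a..<b}"
proof -
  have "AE y in lborel. y \<noteq> b" by (rule AE_lborel_singleton)
  then have "AE y in lborel. ennreal (r y) > 0 \<longrightarrow> y \<in> {a..<b}"
  proof eventually_elim
    case (elim y)
    then show ?case using r_zero[of y] by (cases "y \<in> {a..b}") auto
  qed
  then show ?thesis unfolding Ymeasure_def by (subst AE_density) auto
qed

lemma prob_P_le:
  assumes "A \<in> sets borel" "emeasure lborel A \<le> ennreal l" "l \<ge> 0"
  shows "Y.prob A \<le> M * l"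
proof -
  have "emeasure P A = (\<integral>\<^sup>+ y. ennreal (r y) * indicator A y \<partial>lborel)"
    unfolding Ymeasure_def using assms by (subst emeasure_density) auto
  also have "\<dots> \<le> (\<integral>\<^sup>+ y. ennreal M * indicator A y \<partial>lborel)"
    using r_le by (intro nn_integral_mono mult_right_mono ennreal_leI) auto
  also have "\<dots> = ennreal M * emeasure lborel A" using assms by (subst nn_integral_cmult_indicator) auto
  also have "\<dots> \<le> ennreal M * ennreal l" using assms by (intro mult_left_mono) auto
  also have "\<dots> = ennreal (M * l)" using M_pos assms by (simp add: ennreal_mult)
  finally show ?thesis
    unfolding Y.emeasure_eq_measure using M_pos assms by (subst (asm) ennreal_le_iff) auto
qed

definition jump_strip :: "real \<Rightarrow> real \<Rightarrow> real set" where
  "jump_strip d z = {y. \<bar>y - z - a\<bar> \<le> d \<or> \<bar>y - z - b\<bar> \<le> d}"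

lemma jump_strip_eq: "jump_strip d z = {z + a - d..z + a + d} \<union> {z + b - d..z + b + d}"
  by (auto simp: jump_strip_def abs_le_iff)

lemma sets_jump_strip [measurable]: "jump_strip d z \<in> sets borel"
  by (simp add: jump_strip_eq)

lemma prob_jump_strip_le:
  assumes "d \<ge> 0"
  shows "Y.prob (jump_strip d z) \<le> 4 * M * d"
proof -
  have "emeasure lborel (jump_strip d z)
      \<le> emeasure lborel {z + a - d..z + a + d} + emeasure lborel {z + b - d..z + b + d}"
    unfolding jump_strip_eq by (rule emeasure_subadditive) auto
  also have "\<dots> = ennreal (4 * d)" using assms by (simp flip: ennreal_plus)
  finally have "Y.prob (jump_strip d z) \<le> M * (4 * d)" using assms by (intro prob_P_le) auto
  then show ?thesis by (simp add: mult_ac)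
qed

lemma expectation_indicator_P: "A \<in> sets borel \<Longrightarrow> Y.expectation (indicator A) = Y.prob A"
  by (simp add: Ymeasure_def)

lemma f_modulus:
  assumes "\<bar>x - x'\<bar> \<le> d" "\<not> \<bar>x - a\<bar> \<le> d" "\<not> \<bar>x - b\<bar> \<le> d"
  shows "\<bar>f x - f x'\<bar> \<le> M * d powr s"
proof (cases "x \<in> {a..b}")
  case True
  then have "x' \<in> {a..b}" using assms by auto
  with True have "\<bar>f x - f x'\<bar> \<le> M * \<bar>x - x'\<bar> powr s" by (intro f_Hoelder)
  also have "\<dots> \<le> M * d powr s" using assms s M_pos by (intro mult_left_mono powr_mono2) auto
  finally show ?thesis .
next
  case False
  then have "x' \<notin> {a..b}" using assms by auto
  with False show ?thesis using f_zero M_pos by simp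
qed

lemma f_modulus_jump_strip:
  assumes "\<bar>y - z - x'\<bar> \<le> d"
  shows "\<bar>f (y - z) - f x'\<bar> \<le> M * d powr s + M * indicator (jump_strip d z) y"
proof (cases "y \<in> jump_strip d z")
  case True
  then show ?thesis using abs_f_diff_le[of "y - z" x'] M_pos by (simp add: add_increasing)
next
  case False
  then show ?thesis using f_modulus[of "y - z" x' d] assms by (simp add: jump_strip_def)
qed

definition sq_modulus :: "real \<Rightarrow> real" where
  "sq_modulus d = M\<^sup>2 * (2 * (d powr s)\<^sup>2 + 8 * M * d)"

lemma second_moment_le_sq_modulus:
  assumes u [measurable]: "u \<in> borel_measurable borel" and bound: "\<And>y. \<bar>u y\<bar> \<le> M" and "d \<ge> 0"
    and modulus: "AE y in P. \<bar>u y\<bar> \<le> M * d powr s + M * indicator (jump_strip d z) y"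
  shows "(\<integral>y. (u y)\<^sup>2 \<partial>P) \<le> sq_modulus d"
proof -
  let ?J = "indicator (jump_strip d z) :: real \<Rightarrow> real"
  have J: "integrable P ?J" by (rule integrable_P_bounded[where c=1]) (auto simp: indicator_def)
  have "(\<integral>y. (u y)\<^sup>2 \<partial>P) \<le> (\<integral>y. 2 * (M * d powr s)\<^sup>2 + 2 * M\<^sup>2 * ?J y \<partial>P)"
  proof (rule integral_mono_AE)
    have "\<bar>(u y)\<^sup>2\<bar> \<le> M\<^sup>2" for y using power_mono[OF bound[of y], of 2] by simp
    then show "integrable P (\<lambda>y. (u y)\<^sup>2)" by (intro integrable_P_bounded) auto
    show "integrable P (\<lambda>y. 2 * (M * d powr s)\<^sup>2 + 2 * M\<^sup>2 * ?J y)" using J by auto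
    show "AE y in P. (u y)\<^sup>2 \<le> 2 * (M * d powr s)\<^sup>2 + 2 * M\<^sup>2 * ?J y"
      using modulus
    proof eventually_elim
      case (elim y)
      have "(u y)\<^sup>2 \<le> (M * d powr s + M * ?J y)\<^sup>2" using power_mono[OF elim, of 2] by simp
      also have "\<dots> \<le> 2 * (M * d powr s)\<^sup>2 + 2 * (M * ?J y)\<^sup>2"
        using sum_squares_bound[of "M * d powr s" "M * ?J y"] by (simp add: power2_sum)
      also have "(M * ?J y)\<^sup>2 = M\<^sup>2 * ?J y" by (simp add: indicator_def power_mult_distrib)
      finally show ?case by simp
    qed
  qed
  also have "\<dots> = 2 * (M * d powr s)\<^sup>2 + 2 * M\<^sup>2 * Y.prob (jump_strip d z)"
    using J by (simp add: Y.prob_space expectation_indicator_P)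
  also have "\<dots> \<le> 2 * (M * d powr s)\<^sup>2 + 2 * M\<^sup>2 * (4 * M * d)"
    using prob_jump_strip_le[OF \<open>d \<ge> 0\<close>, of z] by (intro add_left_mono mult_left_mono) auto
  finally show ?thesis by (simp add: sq_modulus_def power_mult_distrib algebra_simps)
qed

section \<open>The noise in the supremum norm\<close>

definition noise :: "nat \<Rightarrow> (nat \<Rightarrow> real) \<Rightarrow> real \<Rightarrow> real" where
  "noise n \<omega> z = Y.empirical_process n \<omega> (\<lambda>y. f (y - z))"

lemma noise_eq: "noise n \<omega> z = kernel_mean f n (\<lambda>_. 1) \<omega> z - T'T \<phi> z"
  by (simp add: noise_def Y.empirical_process_def kernel_mean_def T'T_\<phi>)

definition cell_width :: "nat \<Rightarrow> real" where
  "cell_width N = (b - a) / real N"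

definition cell :: "nat \<Rightarrow> nat \<Rightarrow> real set" where
  "cell N k = {a + real k * cell_width N..<a + real (Suc k) * cell_width N}"

lemma cell_width_pos: "N > 0 \<Longrightarrow> cell_width N > 0"
  using a_less_b by (simp add: cell_width_def)

lemma cell_width_nonneg: "cell_width N \<ge> 0"
  using a_less_b by (simp add: cell_width_def)

lemma cell_cover:
  assumes "N > 0" "y \<in> {a..<b}"
  obtains k where "k < N" "y \<in> cell N k"
proof -
  define k where "k = nat \<lfloor>(y - a) / cell_width N\<rfloor>"
  have "(y - a) / cell_width N \<ge> 0" using assms cell_width_pos[OF \<open>N > 0\<close>] by auto
  then have k: "real k \<le> (y - a) / cell_width N" "(y - a) / cell_width N < real k + 1"
    unfolding k_def by (auto simp: of_nat_nat)
  have "(y - a) / cell_width N < real N" using assms a_less_b by (simp add: cell_width_def field_simps)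
  then have "k < N" using k by linarith
  moreover have "y \<in> cell N k"
    using k cell_width_pos[OF \<open>N > 0\<close>] by (auto simp: cell_def field_simps)
  ultimately show ?thesis by (rule that)
qed

lemma grid_point_near:
  assumes "K > 0" "z \<in> {a..b}"
  obtains k where "k < K" "\<bar>z - (a + real k * cell_width K)\<bar> \<le> cell_width K"
proof (cases "z = b")
  case True
  have "a + real (K - 1) * cell_width K + cell_width K = b"
    using \<open>K > 0\<close> by (simp add: cell_width_def of_nat_diff field_simps)
  then show ?thesis
    using True cell_width_pos[OF \<open>K > 0\<close>] \<open>K > 0\<close> by (intro that[of "K - 1"]) auto
next
  case False
  then obtain k where "k < K" "z \<in> cell K k" using cell_cover[OF \<open>K > 0\<close>, of z] assms by auto
  then show ?thesis by (intro that[of k]) (auto simp: cell_def algebra_simps)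
qed

lemma abs_noise_le_grid:
  assumes "n > 0" "d \<ge> 0" and near: "\<bar>z - z'\<bar> \<le> d"
    and noise: "\<bar>noise n \<omega> z'\<bar> \<le> \<tau>" and strip: "\<bar>Y.empirical_process n \<omega> (indicator (jump_strip d z'))\<bar> \<le> \<tau>"
  shows "\<bar>noise n \<omega> z\<bar> \<le> (1 + M) * \<tau> + 2 * M * d powr s + 8 * M\<^sup>2 * d"
proof -
  let ?J = "indicator (jump_strip d z') :: real \<Rightarrow> real"
  define w where "w y = M * d powr s + M * ?J y" for y
  have J: "integrable P ?J" by (rule integrable_P_bounded[where c=1]) (auto simp: indicator_def)
  have shift: "integrable P (\<lambda>y. f (y - z))" for z
    by (rule integrable_P_bounded[where c=M]) (auto simp: abs_f_le)
  have "\<bar>f (y - z) - f (y - z')\<bar> \<le> w y" for y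
    using f_modulus_jump_strip[of y z' "y - z" d] near by (simp add: w_def abs_minus_commute)
  then have "\<bar>noise n \<omega> z - noise n \<omega> z'\<bar> \<le> Y.empirical_process n \<omega> w + 2 * Y.expectation w"
    unfolding noise_def using J by (intro Y.abs_empirical_process_diff_le shift) (auto simp: w_def[abs_def])
  moreover have w_mean: "Y.expectation w = M * d powr s + M * Y.prob (jump_strip d z')"
    using J by (simp add: w_def[abs_def] Y.prob_space expectation_indicator_P)
  moreover have "Y.empirical_process n \<omega> w = M * Y.empirical_process n \<omega> ?J"
    using \<open>n > 0\<close> w_mean unfolding Y.empirical_process_def expectation_indicator_P[OF sets_jump_strip]
    by (simp add: w_def sum.distrib field_simps flip: sum_distrib_left)
  moreover have "M * Y.empirical_process n \<omega> ?J \<le> M * \<tau>" using strip M_pos by (intro mult_left_mono) auto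
  moreover have "M * Y.prob (jump_strip d z') \<le> M * (4 * M * d)"
    using prob_jump_strip_le[OF \<open>d \<ge> 0\<close>, of z'] M_pos by (intro mult_left_mono) auto
  ultimately show ?thesis using noise by (simp add: power2_eq_square algebra_simps)
qed

lemma noise_grid_tail:
  assumes "n > 0" "t \<ge> 0"
  shows "holds_up_to_prob (Y.sample n) (real K * (2 * exp (- 2 * t\<^sup>2 / M\<^sup>2) + 2 * exp (- 2 * t\<^sup>2)))
    (\<lambda>\<omega>. \<forall>k<K. \<bar>noise n \<omega> (z k)\<bar> \<le> t / sqrt (real n) \<and>
      \<bar>Y.empirical_process n \<omega> (indicator (jump_strip d (z k)))\<bar> \<le> t / sqrt (real n))"
proof (rule holds_up_to_probI)
  interpret Sn: prob_space "Y.sample n" by (rule Y.prob_space_sample)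
  define bad_f where "bad_f k = {\<omega> \<in> space (Y.sample n). \<bar>noise n \<omega> (z k)\<bar> \<ge> t / sqrt (real n)}" for k
  define bad_J where "bad_J k = {\<omega> \<in> space (Y.sample n).
      \<bar>Y.empirical_process n \<omega> (indicator (jump_strip d (z k)))\<bar> \<ge> t / sqrt (real n)}" for k
  have [measurable]: "bad_f k \<in> sets (Y.sample n)" "bad_J k \<in> sets (Y.sample n)" for k
    unfolding bad_f_def bad_J_def noise_def by measurable
  show "(\<Union>k<K. bad_f k \<union> bad_J k) \<in> sets (Y.sample n)" by measurable
  have "measure (Y.sample n) (bad_f k) \<le> 2 * exp (- 2 * t\<^sup>2 / M\<^sup>2)" for k
    unfolding bad_f_def noise_def using f_nonneg f_le M_pos
    by (intro Y.empirical_process_Hoeffding assms) auto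
  moreover have "measure (Y.sample n) (bad_J k) \<le> 2 * exp (- 2 * t\<^sup>2 / 1\<^sup>2)" for k
    unfolding bad_J_def by (intro Y.empirical_process_Hoeffding assms) (auto simp: indicator_def)
  ultimately have "measure (Y.sample n) (bad_f k \<union> bad_J k)
      \<le> 2 * exp (- 2 * t\<^sup>2 / M\<^sup>2) + 2 * exp (- 2 * t\<^sup>2)" for k
    by (intro order_trans[OF measure_Un_le] add_mono) auto
  then have "(\<Sum>k<K. measure (Y.sample n) (bad_f k \<union> bad_J k))
      \<le> (\<Sum>k<K. 2 * exp (- 2 * t\<^sup>2 / M\<^sup>2) + 2 * exp (- 2 * t\<^sup>2))" by (intro sum_mono)
  moreover have "measure (Y.sample n) (\<Union>k<K. bad_f k \<union> bad_J k)
      \<le> (\<Sum>k<K. measure (Y.sample n) (bad_f k \<union> bad_J k))"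
    by (intro Sn.finite_measure_subadditive_finite) auto
  ultimately show "measure (Y.sample n) (\<Union>k<K. bad_f k \<union> bad_J k)
      \<le> real K * (2 * exp (- 2 * t\<^sup>2 / M\<^sup>2) + 2 * exp (- 2 * t\<^sup>2))" by simp
  show "\<forall>k<K. \<bar>noise n \<omega> (z k)\<bar> \<le> t / sqrt (real n) \<and>
      \<bar>Y.empirical_process n \<omega> (indicator (jump_strip d (z k)))\<bar> \<le> t / sqrt (real n)"
    if "\<omega> \<in> space (Y.sample n)" "\<omega> \<notin> (\<Union>k<K. bad_f k \<union> bad_J k)" for \<omega>
    using that by (force simp: bad_f_def bad_J_def not_le)
qed

definition sup_noise_const :: real where
  "sup_noise_const = 1 + M + 2 * M * (b - a) powr s + 8 * M\<^sup>2 * (b - a)"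

lemma cell_width_le:
  assumes "n > 0" and K: "real n powr (1 / (2 * s)) \<le> real K"
  shows "cell_width K powr s \<le> (b - a) powr s / sqrt (real n)" and "cell_width K \<le> (b - a) / sqrt (real n)"
proof -
  have grid_ge_1: "1 \<le> real n powr (1 / (2 * s))" using assms s by (intro ge_one_powr_ge_zero) auto
  have "cell_width K \<le> (b - a) / real n powr (1 / (2 * s))"
    unfolding cell_width_def using a_less_b K grid_ge_1 \<open>n > 0\<close>
    by (intro divide_left_mono mult_pos_pos) auto
  moreover have "0 \<le> cell_width K" using a_less_b by (simp add: cell_width_def)
  ultimately have "cell_width K powr s \<le> ((b - a) / real n powr (1 / (2 * s))) powr s"
    using s by (intro powr_mono2) auto
  also have "\<dots> = (b - a) powr s / sqrt (real n)"
    using s a_less_b \<open>n > 0\<close> by (simp add: powr_divide powr_powr powr_half_sqrt)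
  finally show "cell_width K powr s \<le> (b - a) powr s / sqrt (real n)" .
  have "sqrt (real n) = real n powr (1/2)" using \<open>n > 0\<close> by (simp add: powr_half_sqrt)
  also have "\<dots> \<le> real n powr (1 / (2 * s))" using \<open>n > 0\<close> s by (intro powr_mono) (auto simp: field_simps)
  also have "\<dots> \<le> real K" by (rule K)
  finally show "cell_width K \<le> (b - a) / sqrt (real n)"
    unfolding cell_width_def using a_less_b \<open>n > 0\<close> K grid_ge_1
    by (intro divide_left_mono mult_pos_pos) (linarith | simp)+
qed

lemma discretization_error_le:
  assumes "n > 0" "t \<ge> 1" and K: "real n powr (1 / (2 * s)) \<le> real K"
  shows "(1 + M) * (t / sqrt (real n)) + 2 * M * cell_width K powr s + 8 * M\<^sup>2 * cell_width K
    \<le> sup_noise_const * t / sqrt (real n)"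
proof -
  have "2 * M * cell_width K powr s + 8 * M\<^sup>2 * cell_width K
      \<le> 2 * M * ((b - a) powr s / sqrt (real n)) + 8 * M\<^sup>2 * ((b - a) / sqrt (real n))"
    using cell_width_le[OF \<open>n > 0\<close> K] M_pos by (intro add_mono mult_left_mono) auto
  also have "\<dots> = (2 * M * (b - a) powr s + 8 * M\<^sup>2 * (b - a)) * 1 / sqrt (real n)"
    by (simp add: add_divide_distrib)
  also have "\<dots> \<le> (2 * M * (b - a) powr s + 8 * M\<^sup>2 * (b - a)) * t / sqrt (real n)"
    using \<open>t \<ge> 1\<close> M_pos a_less_b by (intro divide_right_mono mult_left_mono) auto
  finally have "(1 + M) * (t / sqrt (real n)) + 2 * M * cell_width K powr s + 8 * M\<^sup>2 * cell_width K
      \<le> (1 + M) * (t / sqrt (real n)) + (2 * M * (b - a) powr s + 8 * M\<^sup>2 * (b - a)) * t / sqrt (real n)"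
    by linarith
  also have "\<dots> = sup_noise_const * t / sqrt (real n)"
    by (simp add: sup_noise_const_def add_divide_distrib[symmetric]) (simp add: algebra_simps)
  finally show ?thesis .
qed

lemma sup_noise_tail:
  assumes "n > 0" "t \<ge> 1"
  shows "holds_up_to_prob (Y.sample n)
    ((real n powr (1 / (2 * s)) + 1) * (2 * exp (- 2 * t\<^sup>2 / M\<^sup>2) + 2 * exp (- 2 * t\<^sup>2)))
    (\<lambda>\<omega>. \<forall>z\<in>{a..b}. \<bar>noise n \<omega> z\<bar> \<le> sup_noise_const * t / sqrt (real n))"
proof -
  define K where "K = nat \<lceil>real n powr (1 / (2 * s))\<rceil>"
  define d where "d = cell_width K"
  have K: "real n powr (1 / (2 * s)) \<le> real K" "real K \<le> real n powr (1 / (2 * s)) + 1"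
    unfolding K_def by (auto simp: real_nat_ceiling_ge)
  have "K > 0" using K(1) \<open>n > 0\<close> by (cases K) auto
  have "0 \<le> d" unfolding d_def by (rule cell_width_nonneg)
  have "holds_up_to_prob (Y.sample n) (real K * (2 * exp (- 2 * t\<^sup>2 / M\<^sup>2) + 2 * exp (- 2 * t\<^sup>2)))
      (\<lambda>\<omega>. \<forall>k<K. \<bar>noise n \<omega> (a + real k * d)\<bar> \<le> t / sqrt (real n) \<and>
        \<bar>Y.empirical_process n \<omega> (indicator (jump_strip d (a + real k * d)))\<bar> \<le> t / sqrt (real n))"
    using \<open>n > 0\<close> \<open>t \<ge> 1\<close> by (intro noise_grid_tail) auto
  then show ?thesis
  proof (rule holds_up_to_prob_mono, safe)
    show "real K * (2 * exp (- 2 * t\<^sup>2 / M\<^sup>2) + 2 * exp (- 2 * t\<^sup>2))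
        \<le> (real n powr (1 / (2 * s)) + 1) * (2 * exp (- 2 * t\<^sup>2 / M\<^sup>2) + 2 * exp (- 2 * t\<^sup>2))"
      using K(2) by (intro mult_right_mono) auto
    fix \<omega> z
    assume grid: "\<forall>k<K. \<bar>noise n \<omega> (a + real k * d)\<bar> \<le> t / sqrt (real n) \<and>
        \<bar>Y.empirical_process n \<omega> (indicator (jump_strip d (a + real k * d)))\<bar> \<le> t / sqrt (real n)"
    assume "z \<in> {a..b}"
    then obtain k where "k < K" "\<bar>z - (a + real k * d)\<bar> \<le> d"
      unfolding d_def by (rule grid_point_near[OF \<open>K > 0\<close>])
    then have "\<bar>noise n \<omega> z\<bar> \<le> (1 + M) * (t / sqrt (real n)) + 2 * M * d powr s + 8 * M\<^sup>2 * d"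
      using grid by (intro abs_noise_le_grid[OF \<open>n > 0\<close> \<open>0 \<le> d\<close>]) auto
    also have "\<dots> \<le> sup_noise_const * t / sqrt (real n)"
      unfolding d_def by (rule discretization_error_le[OF assms K(1)])
    finally show "\<bar>noise n \<omega> z\<bar> \<le> sup_noise_const * t / sqrt (real n)" .
  qed
qed

section \<open>Splitting the noise at a finite resolution\<close>

definition cell_kernel :: "nat \<Rightarrow> real \<Rightarrow> real \<Rightarrow> real" where
  "cell_kernel N y y' = (\<Sum>k<N. indicator (cell N k) y / cell_width N * indicator (cell N k) y')"

definition cell_average :: "nat \<Rightarrow> nat \<Rightarrow> real \<Rightarrow> real" where
  "cell_average N k z = T' (indicator (cell N k)) z / cell_width N"

definition cell_remainder :: "nat \<Rightarrow> real \<Rightarrow> real \<Rightarrow> real" where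
  "cell_remainder N z y = f (y - z) - (\<Sum>k<N. cell_average N k z * indicator (cell N k) y)"

definition noise_weight :: "nat \<Rightarrow> nat \<Rightarrow> (nat \<Rightarrow> real) \<Rightarrow> real \<Rightarrow> real" where
  "noise_weight N n \<omega> y = Y.empirical_process n \<omega> (cell_kernel N y)"

definition noise_remainder :: "nat \<Rightarrow> nat \<Rightarrow> (nat \<Rightarrow> real) \<Rightarrow> real \<Rightarrow> real" where
  "noise_remainder N n \<omega> z = Y.empirical_process n \<omega> (cell_remainder N z)"

lemma sets_cell [measurable]: "cell N k \<in> sets borel"
  by (simp add: cell_def)

lemma cell_subset:
  assumes "k < N"
  shows "cell N k \<subseteq> {a..b}"
proof
  fix y assume y: "y \<in> cell N k"
  have w: "cell_width N > 0" using assms by (intro cell_width_pos) auto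
  have "real (Suc k) * cell_width N \<le> real N * cell_width N" using assms w by (intro mult_right_mono) auto
  also have "\<dots> = b - a" using assms by (simp add: cell_width_def)
  finally have "a + real (Suc k) * cell_width N \<le> b" by simp
  moreover have "0 \<le> real k * cell_width N" using w by simp
  ultimately show "y \<in> {a..b}" using y by (auto simp: cell_def)
qed

lemma cell_disjoint:
  assumes "i \<noteq> j"
  shows "cell N i \<inter> cell N j = {}"
proof -
  have disjoint_less: "cell N i \<inter> cell N j = {}" if "i < j" for i j
  proof -
    have "real (Suc i) * cell_width N \<le> real j * cell_width N"
      using that cell_width_nonneg by (intro mult_right_mono) auto
    then show ?thesis by (auto simp: cell_def)
  qed
  show ?thesis
    using disjoint_less[of i j] disjoint_less[of j i] assms by (metis Int_commute linorder_neqE_nat)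
qed

lemma emeasure_cell: "emeasure lborel (cell N k) = ennreal (cell_width N)"
  using cell_width_nonneg[of N] by (simp add: cell_def distrib_right)

lemma integral_cell_Icc:
  assumes "k < N"
  shows "(\<integral>y. indicator (cell N k) y \<partial>lborel_Icc a b) = cell_width N"
proof -
  have "(\<integral>y. indicator (cell N k) y \<partial>lborel_Icc a b) = (\<integral>y. indicator (cell N k) y \<partial>lborel :: real)"
    by (rule integral_lborel_Icc_eq_lborel) (use cell_subset[OF assms] in \<open>auto simp: indicator_def\<close>)
  also have "\<dots> = cell_width N"
    using emeasure_cell[of N k] cell_width_nonneg[of N] by (simp add: measure_def)
  finally show ?thesis .
qed

lemma L2_indicator_cell: "L2 (indicator (cell N k))"
  by (rule L2fun_bounded[where B=1]) auto

lemma sum_cell_eq: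
  fixes c :: "nat \<Rightarrow> real"
  assumes "k < N" "y \<in> cell N k"
  shows "(\<Sum>j<N. c j * indicator (cell N j) y) = c k"
proof -
  have "(\<Sum>j<N. c j * indicator (cell N j) y) = (\<Sum>j<N. if j = k then c k else 0)"
    using assms(2) cell_disjoint[of _ k N] by (intro sum.cong) (auto simp: indicator_def)
  then show ?thesis using assms(1) by simp
qed

lemma sum_cell_outside:
  fixes c :: "nat \<Rightarrow> real"
  assumes "\<And>k. k < N \<Longrightarrow> y \<notin> cell N k"
  shows "(\<Sum>j<N. c j * indicator (cell N j) y) = 0"
  using assms by simp

lemma cell_kernel_eq:
  assumes "k < N" "y \<in> cell N k"
  shows "cell_kernel N y y' = indicator (cell N k) y' / cell_width N"
  using sum_cell_eq[OF assms, of "\<lambda>j. indicator (cell N j) y' / cell_width N"]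
  by (simp add: cell_kernel_def mult.commute)

lemma cell_kernel_outside: "(\<And>k. k < N \<Longrightarrow> y \<notin> cell N k) \<Longrightarrow> cell_kernel N y y' = 0"
  by (simp add: cell_kernel_def)

lemma abs_cell_kernel_le: "\<bar>cell_kernel N y y'\<bar> \<le> 1 / cell_width N"
proof (cases "\<exists>k<N. y \<in> cell N k")
  case True
  then show ?thesis using a_less_b by (auto simp: cell_kernel_eq indicator_def cell_width_def)
next
  case False
  then show ?thesis using a_less_b by (simp add: cell_kernel_outside cell_width_def)
qed

lemma borel_measurable_cell_kernel [measurable]:
  "(\<lambda>(y, y'). cell_kernel N y y') \<in> borel_measurable (borel \<Otimes>\<^sub>M P)"
  unfolding cell_kernel_def by measurable

lemma cell_kernel_second_moment_le:
  assumes "N > 0"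
  shows "(\<integral>y'. (cell_kernel N y y')\<^sup>2 \<partial>P) \<le> M / cell_width N"
proof (cases "\<exists>k<N. y \<in> cell N k")
  case True
  then obtain k where k: "k < N" "y \<in> cell N k" by blast
  note w = cell_width_pos[OF \<open>N > 0\<close>]
  have "(\<integral>y'. (cell_kernel N y y')\<^sup>2 \<partial>P) = (\<integral>y'. indicator (cell N k) y' / (cell_width N)\<^sup>2 \<partial>P)"
    by (rule Bochner_Integration.integral_cong) (auto simp: cell_kernel_eq[OF k] indicator_def power_divide)
  also have "\<dots> = Y.prob (cell N k) / (cell_width N)\<^sup>2" by (simp add: expectation_indicator_P)
  also have "\<dots> \<le> M * cell_width N / (cell_width N)\<^sup>2"
    using w by (intro divide_right_mono prob_P_le) (auto simp: emeasure_cell)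
  finally show ?thesis using w by (simp add: power2_eq_square)
next
  case False
  then show ?thesis using M_pos cell_width_pos[OF \<open>N > 0\<close>] by (simp add: cell_kernel_outside)
qed

lemma noise_weight_tail:
  assumes "n > 0" "N > 0" "\<tau> > 0"
  shows "holds_up_to_prob (Y.sample n) (M * real N / (real n * \<tau>\<^sup>2)) (\<lambda>\<omega>. nrm (noise_weight N n \<omega>) \<le> \<tau>)"
proof -
  have "(b - a) * (M / cell_width N) / (real n * \<tau>\<^sup>2) = M * real N / (real n * \<tau>\<^sup>2)"
    using a_less_b by (simp add: cell_width_def)
  then show ?thesis
    using Y.L2norm_empirical_process_le[OF \<open>n > 0\<close> less_imp_le[OF a_less_b] borel_measurable_cell_kernel
        abs_cell_kernel_le cell_kernel_second_moment_le[OF \<open>N > 0\<close>] \<open>\<tau> > 0\<close>]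
    unfolding noise_weight_def by simp
qed

lemma cell_average_bounds:
  assumes "k < N"
  shows "0 \<le> cell_average N k z" "cell_average N k z \<le> M"
proof -
  have w: "cell_width N > 0" using assms by (intro cell_width_pos) auto
  have int: "integrable (lborel_Icc a b) (\<lambda>y. indicator (cell N k) y * f (y - z))"
    by (rule L2fun_integrable_mult[OF L2_indicator_cell L2_slice(2)])
  show "0 \<le> cell_average N k z"
    unfolding cell_average_def Tadj_eq using w f_nonneg
    by (intro divide_nonneg_pos integral_nonneg_AE) auto
  have "T' (indicator (cell N k)) z \<le> (\<integral>y. indicator (cell N k) y * M \<partial>lborel_Icc a b)"
    unfolding Tadj_eq using L2fun_integrable[OF L2_indicator_cell] f_le int
    by (intro integral_mono mult_left_mono) auto
  also have "\<dots> = cell_width N * M" by (simp only: integral_mult_left_zero integral_cell_Icc[OF assms])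
  finally show "cell_average N k z \<le> M" using w by (simp add: cell_average_def pos_divide_le_eq mult.commute)
qed

lemma borel_measurable_cell_average [measurable]: "cell_average N k \<in> borel_measurable borel"
  using L2fun_borel[OF L2_T'[OF L2_indicator_cell]] unfolding cell_average_def[abs_def] by measurable

lemma borel_measurable_cell_remainder: "(\<lambda>(z, y). cell_remainder N z y) \<in> borel_measurable (borel \<Otimes>\<^sub>M P)"
  unfolding cell_remainder_def by measurable

lemma cell_remainder_eq:
  "k < N \<Longrightarrow> y \<in> cell N k \<Longrightarrow> cell_remainder N z y = f (y - z) - cell_average N k z"
  by (simp only: cell_remainder_def sum_cell_eq)

lemma abs_cell_remainder_le: "\<bar>cell_remainder N z y\<bar> \<le> M"
proof (cases "\<exists>k<N. y \<in> cell N k")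
  case True
  then obtain k where k: "k < N" "y \<in> cell N k" by blast
  then show ?thesis
    using cell_average_bounds[OF k(1), of z] f_nonneg[of "y - z"] f_le[of "y - z"]
    by (simp add: cell_remainder_eq)
next
  case False
  then show ?thesis using abs_f_le by (simp add: cell_remainder_def sum_cell_outside)
qed

lemma abs_f_minus_cell_average_le:
  assumes k: "k < N" "y \<in> cell N k" and regular: "y \<notin> jump_strip (cell_width N) z"
  shows "\<bar>f (y - z) - cell_average N k z\<bar> \<le> M * cell_width N powr s"
proof -
  define w c where "w = cell_width N" and "c = M * w powr s"
  let ?I = "indicator (cell N k) :: real \<Rightarrow> real"
  have w: "w > 0" unfolding w_def using k by (intro cell_width_pos) auto
  have I: "integrable (lborel_Icc a b) ?I" by (rule L2fun_integrable[OF L2_indicator_cell])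
  have If: "integrable (lborel_Icc a b) (\<lambda>x. ?I x * f (x - z))"
    by (rule L2fun_integrable_mult[OF L2_indicator_cell L2_slice(2)])
  define D where "D x = f (y - z) * ?I x - ?I x * f (x - z)" for x
  have D: "integrable (lborel_Icc a b) D" unfolding D_def using I If by auto
  have "\<bar>D x\<bar> \<le> c * ?I x" for x
  proof (cases "x \<in> cell N k")
    case True
    then have "\<bar>y - z - (x - z)\<bar> \<le> w" using k(2) by (auto simp: cell_def w_def abs_le_iff algebra_simps)
    from f_modulus_jump_strip[OF this] show ?thesis using True regular by (simp add: D_def c_def w_def)
  qed (simp add: D_def)
  then have "\<bar>\<integral>x. D x \<partial>lborel_Icc a b\<bar> \<le> (\<integral>x. c * ?I x \<partial>lborel_Icc a b)"
    using D I by (intro integral_abs_bound_integral) auto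
  also have "\<dots> = c * w" by (simp only: integral_mult_right_zero integral_cell_Icc[OF k(1)] w_def)
  finally have "\<bar>\<integral>x. D x \<partial>lborel_Icc a b\<bar> \<le> c * w" .
  moreover have "(\<integral>x. D x \<partial>lborel_Icc a b) = (f (y - z) - cell_average N k z) * w"
  proof -
    have "(\<integral>x. D x \<partial>lborel_Icc a b) = f (y - z) * (\<integral>x. ?I x \<partial>lborel_Icc a b) - T' ?I z"
      unfolding D_def Tadj_eq using I If by (subst Bochner_Integration.integral_diff) auto
    then show ?thesis
      using w by (simp only: integral_cell_Icc[OF k(1)]) (simp add: cell_average_def w_def left_diff_distrib)
  qed
  ultimately show ?thesis using w by (simp add: abs_mult c_def w_def)
qed

lemma cell_remainder_second_moment_le:
  assumes "N > 0"
  shows "(\<integral>y. (cell_remainder N z y)\<^sup>2 \<partial>P) \<le> sq_modulus (cell_width N)"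
proof (rule second_moment_le_sq_modulus)
  show "AE y in P. \<bar>cell_remainder N z y\<bar>
      \<le> M * cell_width N powr s + M * indicator (jump_strip (cell_width N) z) y"
    using AE_P
  proof eventually_elim
    case (elim y)
    obtain k where k: "k < N" "y \<in> cell N k" using cell_cover[OF \<open>N > 0\<close> elim] .
    show ?case
    proof (cases "y \<in> jump_strip (cell_width N) z")
      case True
      then show ?thesis using abs_cell_remainder_le[of N z y] M_pos by (simp add: add_increasing)
    next
      case False
      then show ?thesis using abs_f_minus_cell_average_le[OF k] by (simp add: cell_remainder_eq[OF k])
    qed
  qed
  show "cell_remainder N z \<in> borel_measurable borel" unfolding cell_remainder_def[abs_def] by measurable
qed (use abs_cell_remainder_le less_imp_le[OF cell_width_pos[OF assms]] in auto)

lemma noise_remainder_tail: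
  assumes "n > 0" "N > 0" "\<tau> > 0"
  shows "holds_up_to_prob (Y.sample n) ((b - a) * sq_modulus (cell_width N) / (real n * \<tau>\<^sup>2))
    (\<lambda>\<omega>. nrm (noise_remainder N n \<omega>) \<le> \<tau>)"
  using Y.L2norm_empirical_process_le[OF \<open>n > 0\<close> less_imp_le[OF a_less_b] borel_measurable_cell_remainder
      abs_cell_remainder_le cell_remainder_second_moment_le[OF \<open>N > 0\<close>] \<open>\<tau> > 0\<close>]
  unfolding noise_remainder_def .

lemma L2_noise_weight: "\<omega> \<in> space (Y.sample n) \<Longrightarrow> L2 (noise_weight N n \<omega>)"
  unfolding noise_weight_def[abs_def]
  by (rule Y.L2fun_empirical_process[OF borel_measurable_cell_kernel abs_cell_kernel_le])

lemma L2_noise_remainder: "\<omega> \<in> space (Y.sample n) \<Longrightarrow> L2 (noise_remainder N n \<omega>)"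
  unfolding noise_remainder_def[abs_def]
  by (rule Y.L2fun_empirical_process[OF borel_measurable_cell_remainder abs_cell_remainder_le])

lemma integrable_P_indicator_cell: "integrable P (\<lambda>y. c * indicator (cell N k) y)" for c :: real
  by (rule integrable_P_bounded[where c="\<bar>c\<bar>"]) (auto simp: indicator_def)

lemma T'_noise_weight:
  "T' (noise_weight N n \<omega>) z = (\<Sum>k<N. cell_average N k z * Y.empirical_process n \<omega> (indicator (cell N k)))"
proof -
  have "noise_weight N n \<omega> =
      (\<lambda>y. \<Sum>k<N. Y.empirical_process n \<omega> (indicator (cell N k)) / cell_width N * indicator (cell N k) y)"
    unfolding noise_weight_def[abs_def] cell_kernel_def[abs_def]
    by (simp only: Y.empirical_process_sum integrable_P_indicator_cell Y.empirical_process_scale)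
       (simp add: mult.commute)
  then show ?thesis
    by (simp only: T'_sum L2fun_scale L2_indicator_cell T'_scale) (simp add: cell_average_def mult.commute)
qed

lemma noise_split: "noise n \<omega> z = T' (noise_weight N n \<omega>) z + noise_remainder N n \<omega> z"
proof -
  have f_int: "integrable P (\<lambda>y. f (y - z))"
    by (rule integrable_P_bounded[where c=M]) (auto simp: abs_f_le)
  have "noise_remainder N n \<omega> z = noise n \<omega> z
      - (\<Sum>k<N. Y.empirical_process n \<omega> (\<lambda>y. cell_average N k z * indicator (cell N k) y))"
    unfolding noise_remainder_def cell_remainder_def[abs_def] noise_def
    by (subst Y.empirical_process_diff[OF f_int])
       (intro Bochner_Integration.integrable_sum integrable_P_indicator_cell,
        simp only: Y.empirical_process_sum integrable_P_indicator_cell)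
  then show ?thesis by (simp add: T'_noise_weight Y.empirical_process_scale)
qed

definition resolvent_noise_bound :: "real \<Rightarrow> nat \<Rightarrow> nat \<Rightarrow> (nat \<Rightarrow> real) \<Rightarrow> real \<Rightarrow> real" where
  "resolvent_noise_bound \<alpha> N n \<omega> z = (\<bar>noise n \<omega> z\<bar>
     + kernel_bound * (nrm (noise_weight N n \<omega>) + nrm (noise_remainder N n \<omega>) / (2 * sqrt \<alpha>))) / \<alpha>"

lemma estimation_error_le:
  assumes "\<alpha> > 0" "\<beta> \<ge> 0" and \<psi>: "L2 \<psi>" and source: "spectral_source a b f lam e \<beta> \<phi> \<psi>"
    and \<omega>: "\<omega> \<in> space (Y.sample n)" and z: "z \<in> {a..b}"
  shows "\<bar>phihat a b f \<alpha> n \<omega> z - \<phi> z\<bar> \<le>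
    kernel_bound * (\<alpha> powr (min \<beta> 1) * qualification_const \<beta> * nrm \<psi>) + resolvent_noise_bound \<alpha> N n \<omega> z"
proof -
  have "L2 (\<lambda>z. kernel_mean f n (\<lambda>_. 1) \<omega> z - T'T \<phi> z)" by (intro L2fun_diff L2_kernel_mean L2_T'T L2_\<phi>)
  then have L2_noise: "L2 (noise n \<omega>)" by (simp add: noise_eq[abs_def])
  have "\<phi> z - phihat a b f \<alpha> n \<omega> z = resolvent a b f \<alpha> (\<lambda>z. \<alpha> * \<phi> z) z - resolvent a b f \<alpha> (noise n \<omega>) z"
    unfolding phihat_eq noise_eq[abs_def]
    by (rule error_decomposition[OF \<open>\<alpha> > 0\<close> L2_kernel_mean L2_\<phi> \<phi>_zero])
  moreover note bias_bound[OF \<open>\<alpha> > 0\<close> \<open>\<beta> \<ge> 0\<close> L2_\<phi> continuous_on_\<phi> \<psi> source z]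
  moreover have "\<bar>resolvent a b f \<alpha> (noise n \<omega>) z\<bar> \<le> resolvent_noise_bound \<alpha> N n \<omega> z"
    unfolding resolvent_noise_bound_def
    by (rule abs_resolvent_le[OF \<open>\<alpha> > 0\<close> L2_noise L2_noise_weight[OF \<omega>] L2_noise_remainder[OF \<omega>]
          noise_split z])
  ultimately show ?thesis by linarith
qed

end

section \<open>Joint laws are determined by linear combinations\<close>

lemma
  assumes "finite_borel_measure N" and mass: "emeasure N UNIV = ennreal m" and "m > 0"
  shows real_distribution_normalize: "real_distribution (density N (\<lambda>_. ennreal (1 / m)))"
    and char_normalize: "char (density N (\<lambda>_. ennreal (1 / m))) t = (1 / m) *\<^sub>R char N t"
proof -
  interpret finite_borel_measure N by fact
  show "real_distribution (density N (\<lambda>_. ennreal (1 / m)))"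
  proof (intro real_distribution.intro real_distribution_axioms.intro prob_spaceI)
    show "emeasure (density N (\<lambda>_. ennreal (1 / m))) (space (density N (\<lambda>_. ennreal (1 / m)))) = 1"
      using mass \<open>m > 0\<close> by (simp add: emeasure_density_const M_is_borel borel_UNIV flip: ennreal_mult')
  qed (simp_all add: M_is_borel borel_UNIV)
  show "char (density N (\<lambda>_. ennreal (1 / m))) t = (1 / m) *\<^sub>R char N t"
    unfolding char_def using \<open>m > 0\<close> M_is_borel
    by (subst integral_density) (auto cong: measurable_cong_sets)
qed

lemma Levy_uniqueness_finite:
  fixes M1 M2 :: "real measure"
  assumes fin: "finite_borel_measure M1" "finite_borel_measure M2" and char: "char M1 = char M2"
  shows "M1 = M2"
proof -
  interpret M1: finite_borel_measure M1 by fact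
  interpret M2: finite_borel_measure M2 by fact
  define m where "m = measure M1 UNIV"
  have "char N 0 = complex_of_real (measure N UNIV)" if "finite_borel_measure N" for N
    using finite_borel_measure.borel_UNIV[OF that] by (simp add: char_def scaleR_conv_of_real)
  with fin have "measure M2 UNIV = m" by (metis char m_def of_real_eq_iff)
  then have mass: "emeasure M1 UNIV = ennreal m" "emeasure M2 UNIV = ennreal m"
    by (simp_all add: m_def M1.emeasure_eq_measure M2.emeasure_eq_measure)
  show ?thesis
  proof (cases "m = 0")
    case True
    have "emeasure M1 A \<le> emeasure M1 UNIV" "emeasure M2 A \<le> emeasure M2 UNIV" for A
      by (auto intro!: emeasure_mono)
    then show ?thesis using True by (intro measure_eqI) (simp_all add: mass M1.M_is_borel M2.M_is_borel)
  next
    case False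
    then have "m > 0" by (simp add: m_def order_less_le)
    then have "density M1 (\<lambda>_. ennreal (1 / m)) = density M2 (\<lambda>_. ennreal (1 / m))"
      using fin mass
      by (intro Levy_uniqueness) (auto simp: real_distribution_normalize char_normalize char intro!: ext)
    then have "ennreal (1 / m) * emeasure M1 A = ennreal (1 / m) * emeasure M2 A" if "A \<in> sets borel" for A
      using emeasure_density_const that by (metis M1.M_is_borel M2.M_is_borel)
    then show ?thesis
      using \<open>m > 0\<close>
      by (intro measure_eqI) (auto simp: ennreal_mult_cancel_left M1.M_is_borel M2.M_is_borel)
  qed
qed

lemma
  fixes X w :: "'a \<Rightarrow> real"
  assumes "finite_measure N" and [measurable]: "X \<in> borel_measurable N" "w \<in> borel_measurable N"
    and w: "\<And>x. 0 \<le> w x" "\<And>x. w x \<le> C"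
  defines "law \<equiv> distr (density N (\<lambda>x. ennreal (w x))) borel X"
  shows finite_borel_measure_weighted_law: "finite_borel_measure law"
    and char_weighted_law: "char law t = (\<integral>x. w x *\<^sub>R iexp (t * X x) \<partial>N)"
    and measure_weighted_law: "D \<in> sets borel \<Longrightarrow> measure law D = (\<integral>x. w x * indicator D (X x) \<partial>N)"
proof -
  interpret finite_measure N by fact
  have "integrable N w" by (rule integrable_const_bound[where B=C]) (use w in auto)
  then have "(\<integral>\<^sup>+x. ennreal (w x) \<partial>N) < \<infinity>" using w by (subst nn_integral_eq_integral) auto
  then have "finite_measure (density N (\<lambda>x. ennreal (w x)))"
    by (intro finite_measureI) (simp add: emeasure_density cong: nn_integral_cong)
  then show "finite_borel_measure law"
    unfolding law_def
    by (intro finite_borel_measure.intro finite_borel_measure_axioms.intro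
        finite_measure.finite_measure_distr) auto
  show "char law t = (\<integral>x. w x *\<^sub>R iexp (t * X x) \<partial>N)"
    unfolding char_def law_def using w by (subst integral_distr, simp, simp, subst integral_density) auto
  assume [measurable]: "D \<in> sets borel"
  have "measure law D = (\<integral>x. indicator D x \<partial>law)" by (simp add: law_def)
  also have "\<dots> = (\<integral>x. w x * indicator D (X x) \<partial>N)"
    unfolding law_def using w by (subst integral_distr, simp, simp, subst integral_density) auto
  finally show "measure law D = (\<integral>x. w x * indicator D (X x) \<partial>N)" .
qed

lemma weighted_law_eqI:
  fixes X w :: "'a \<Rightarrow> real" and Y v :: "'b \<Rightarrow> real"
  assumes "finite_measure M1" "X \<in> borel_measurable M1" "w \<in> borel_measurable M1"
    and w: "\<And>x. 0 \<le> w x" "\<And>x. w x \<le> C"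
    and "finite_measure M2" "Y \<in> borel_measurable M2" "v \<in> borel_measurable M2"
    and v: "\<And>x. 0 \<le> v x" "\<And>x. v x \<le> C"
    and char: "\<And>t. (\<integral>x. w x *\<^sub>R iexp (t * X x) \<partial>M1) = (\<integral>x. v x *\<^sub>R iexp (t * Y x) \<partial>M2)"
    and D: "D \<in> sets borel"
  shows "(\<integral>x. w x * indicator D (X x) \<partial>M1) = (\<integral>x. v x * indicator D (Y x) \<partial>M2)"
proof -
  note law_w = assms(1-3) w and law_v = assms(6-8) v
  have "distr (density M1 (\<lambda>x. ennreal (w x))) borel X = distr (density M2 (\<lambda>x. ennreal (v x))) borel Y"
    using char
    by (intro Levy_uniqueness_finite finite_borel_measure_weighted_law[OF law_w]
        finite_borel_measure_weighted_law[OF law_v])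
       (auto simp: char_weighted_law[OF law_w] char_weighted_law[OF law_v])
  then show ?thesis
    using measure_weighted_law[OF law_w D] measure_weighted_law[OF law_v D] by simp
qed

lemma iexp_cos_weight:
  fixes \<theta> t u l x :: real
  shows "(1 + cos (\<theta> + t * l)) *\<^sub>R iexp (u * x) =
    iexp (u * x + 0 * l) + (iexp \<theta> / 2) * iexp (u * x + t * l) + (iexp (- \<theta>) / 2) * iexp (u * x + - t * l)"
proof -
  have "complex_of_real (cos y) = (iexp y + iexp (- y)) / 2" for y
    by (simp add: cos_of_real[symmetric] cos_exp_eq)
  then show ?thesis
    by (simp add: scaleR_conv_of_real distrib_right distrib_left add_divide_distrib flip: exp_add)
       (simp add: algebra_simps)
qed

lemma integral_iexp_cos_weight:
  assumes "finite_measure N" and [measurable]: "Z \<in> borel_measurable N" "Q \<in> borel_measurable N"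
  shows "(\<integral>x. (1 + cos (\<theta> + t * Q x)) *\<^sub>R iexp (u * Z x) \<partial>N) = (\<integral>x. iexp (u * Z x + 0 * Q x) \<partial>N)
    + iexp \<theta> / 2 * (\<integral>x. iexp (u * Z x + t * Q x) \<partial>N) + iexp (- \<theta>) / 2 * (\<integral>x. iexp (u * Z x + - t * Q x) \<partial>N)"
proof -
  interpret finite_measure N by fact
  have "integrable N (\<lambda>x. iexp (u * Z x + t * Q x))" for u t
    by (auto intro!: integrable_const_bound[where B=1])
  then show ?thesis
    unfolding iexp_cos_weight
    by (simp only: Bochner_Integration.integral_add Bochner_Integration.integrable_add
        integrable_mult_right integral_mult_right_zero)
qed

lemma
  assumes "finite_measure N"
    and [measurable]: "Z \<in> borel_measurable N" "Q \<in> borel_measurable N" "D \<in> sets borel"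
  defines "I \<equiv> \<lambda>t. \<integral>x. indicator D (Z x) *\<^sub>R iexp (t * Q x) \<partial>N"
  shows integral_indicator_iexp: "Re (I t) = (\<integral>x. indicator D (Z x) * cos (0 + t * Q x) \<partial>N)"
    "Im (I t) = (\<integral>x. indicator D (Z x) * cos (- pi / 2 + t * Q x) \<partial>N)"
proof -
  interpret finite_measure N by fact
  have int: "integrable N (\<lambda>x. indicator D (Z x) *\<^sub>R iexp (t * Q x))"
    by (auto intro!: integrable_const_bound[where B=1] simp: indicator_def)
  show "Re (I t) = (\<integral>x. indicator D (Z x) * cos (0 + t * Q x) \<partial>N)"
    unfolding I_def integral_Re[OF int, symmetric] by (simp add: Re_exp)
  have "sin y = cos (- pi / 2 + y)" for y :: real by (simp add: cos_diff)
  then show "Im (I t) = (\<integral>x. indicator D (Z x) * cos (- pi / 2 + t * Q x) \<partial>N)"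
    unfolding I_def integral_Im[OF int, symmetric] by (simp add: Im_exp)
qed

text \<open>The weight \<open>1 + cos (\<theta> + t L)\<close> is nonnegative and its products with \<open>exp (i u X)\<close> are combinations of
  characters of \<open>(X, L)\<close>; varying \<open>\<theta>\<close> recovers the weights \<open>cos (t L)\<close> and \<open>sin (t L)\<close>.\<close>

lemma indicator_cos_integral_unique:
  fixes X L :: "'a \<Rightarrow> real" and X' L' :: "'b \<Rightarrow> real"
  assumes fin: "finite_measure M1" "finite_measure M2"
    and meas [measurable]: "X \<in> borel_measurable M1" "L \<in> borel_measurable M1"
      "X' \<in> borel_measurable M2" "L' \<in> borel_measurable M2"
    and lin: "\<And>u t. distr M1 borel (\<lambda>x. u * X x + t * L x) = distr M2 borel (\<lambda>x. u * X' x + t * L' x)"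
    and D [measurable]: "D \<in> sets borel"
  shows "(\<integral>x. indicator D (X x) * cos (\<theta> + t * L x) \<partial>M1)
    = (\<integral>x. indicator D (X' x) * cos (\<theta> + t * L' x) \<partial>M2)"
proof -
  have char: "(\<integral>x. iexp (u * X x + t * L x) \<partial>M1) = (\<integral>x. iexp (u * X' x + t * L' x) \<partial>M2)" for u t
    using arg_cong[OF lin, of "\<lambda>N. char N 1" u t] by (simp add: char_def integral_distr)
  have cos_bounds: "0 \<le> 1 + cos y" "1 + cos y \<le> 2" for y :: real
    using cos_ge_minus_one[of y] cos_le_one[of y] by linarith+
  have weighted: "(\<integral>x. (1 + cos (\<theta> + t * L x)) * indicator D (X x) \<partial>M1)
      = (\<integral>x. (1 + cos (\<theta> + t * L' x)) * indicator D (X' x) \<partial>M2)" for \<theta> t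
  proof (rule weighted_law_eqI[OF fin(1) meas(1) _ cos_bounds fin(2) meas(3) _ cos_bounds _ D])
    show "(\<integral>x. (1 + cos (\<theta> + t * L x)) *\<^sub>R iexp (u * X x) \<partial>M1)
        = (\<integral>x. (1 + cos (\<theta> + t * L' x)) *\<^sub>R iexp (u * X' x) \<partial>M2)" for u
      by (simp only: integral_iexp_cos_weight[OF fin(1) meas(1,2)]
          integral_iexp_cos_weight[OF fin(2) meas(3,4)] char)
  qed measurable
  have integrable: "integrable N (\<lambda>x. indicator D (Z x) * c x :: real)"
    if "finite_measure N" "Z \<in> borel_measurable N" "c \<in> borel_measurable N" "\<And>x. \<bar>c x\<bar> \<le> 1"
    for N :: "'c measure" and Z c
    using that D by (intro finite_measure.integrable_const_bound[where B=1]) (auto simp: indicator_def)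
  have "(\<integral>x. indicator D (X x) \<partial>M1) = (\<integral>x. indicator D (X' x) \<partial>M2 :: real)"
    using weighted[of "pi / 2" 0] by simp
  then show ?thesis
    using weighted[of \<theta> t] integrable[OF fin(1) meas(1), of "\<lambda>x. cos (\<theta> + t * L x)"]
      integrable[OF fin(2) meas(3), of "\<lambda>x. cos (\<theta> + t * L' x)"]
      integrable[OF fin(1) meas(1), of "\<lambda>_. 1"] integrable[OF fin(2) meas(3), of "\<lambda>_. 1"]
    by (simp add: ring_distribs mult.commute)
qed

lemma Cramer_Wold_pair:
  fixes X L :: "'a \<Rightarrow> real" and X' L' :: "'b \<Rightarrow> real"
  assumes fin: "finite_measure M1" "finite_measure M2"
    and meas [measurable]: "X \<in> borel_measurable M1" "L \<in> borel_measurable M1"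
      "X' \<in> borel_measurable M2" "L' \<in> borel_measurable M2"
    and lin: "\<And>u t. distr M1 borel (\<lambda>x. u * X x + t * L x) = distr M2 borel (\<lambda>x. u * X' x + t * L' x)"
    and sets [measurable]: "D \<in> sets borel" "B \<in> sets borel"
  shows "measure M1 {x \<in> space M1. X x \<in> D \<and> L x \<in> B} = measure M2 {x \<in> space M2. X' x \<in> D \<and> L' x \<in> B}"
proof -
  have "(\<integral>x. indicator D (X x) * indicator B (L x) \<partial>M1)
      = (\<integral>x. indicator D (X' x) * indicator B (L' x) \<partial>M2 :: real)"
  proof (rule weighted_law_eqI[OF fin(1) meas(2) _ _ _ fin(2) meas(4) _ _ _ _ sets(2), where C=1])
    show "(\<integral>x. indicator D (X x) *\<^sub>R iexp (t * L x) \<partial>M1)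
        = (\<integral>x. indicator D (X' x) *\<^sub>R iexp (t * L' x) \<partial>M2)" for t
      by (intro complex_eqI) (simp_all only: indicator_cos_integral_unique[OF fin meas lin sets(1)]
          integral_indicator_iexp[OF fin(1) meas(1,2) sets(1)]
          integral_indicator_iexp[OF fin(2) meas(3,4) sets(1)])
  qed (auto simp: indicator_def)
  moreover have "indicator D (X x) * indicator B (L x) = (indicator {x. X x \<in> D \<and> L x \<in> B} x :: real)"
    "indicator D (X' x') * indicator B (L' x') = (indicator {x. X' x \<in> D \<and> L' x \<in> B} x' :: real)" for x x'
    by (auto simp: indicator_def)
  ultimately show ?thesis by (simp add: Int_def conj_commute)
qed

lemma distr_restrict_vimage_eqI:
  fixes X L :: "'a \<Rightarrow> real" and X' L' :: "'b \<Rightarrow> real"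
  assumes fin: "finite_measure M1" "finite_measure M2"
    and [measurable]: "X \<in> borel_measurable M1" "L \<in> borel_measurable M1"
      "X' \<in> borel_measurable M2" "L' \<in> borel_measurable M2" "D \<in> sets borel"
    and lin: "\<And>u t. distr M1 borel (\<lambda>x. u * X x + t * L x) = distr M2 borel (\<lambda>x. u * X' x + t * L' x)"
  shows "distr (restrict_space M1 {x \<in> space M1. X x \<in> D}) borel L
    = distr (restrict_space M2 {x \<in> space M2. X' x \<in> D}) borel L'"
proof (rule measure_eqI)
  fix B :: "real set" assume "B \<in> sets (distr (restrict_space M1 {x \<in> space M1. X x \<in> D}) borel L)"
  then have [measurable]: "B \<in> sets borel" by simp
  have restricted: "emeasure (distr (restrict_space N {x \<in> space N. Z x \<in> D}) borel Q) B
      = ennreal (measure N {x \<in> space N. Z x \<in> D \<and> Q x \<in> B})"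
    if "finite_measure N" and [measurable]: "Z \<in> borel_measurable N" "Q \<in> borel_measurable N"
    for N :: "'c measure" and Z Q
  proof -
    interpret N: finite_measure N by fact
    have "emeasure (distr (restrict_space N {x \<in> space N. Z x \<in> D}) borel Q) B
        = emeasure N {x \<in> space N. Z x \<in> D \<and> Q x \<in> B}"
      by (subst emeasure_distr) (auto simp: measurable_restrict_space1 emeasure_restrict_space
          space_restrict_space intro!: arg_cong[where f="emeasure N"])
    then show ?thesis by (simp add: N.emeasure_eq_measure)
  qed
  show "emeasure (distr (restrict_space M1 {x \<in> space M1. X x \<in> D}) borel L) B
      = emeasure (distr (restrict_space M2 {x \<in> space M2. X' x \<in> D}) borel L') B"
    using fin lin by (simp add: restricted Cramer_Wold_pair[of M1 M2 X L X' L' D B])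
qed simp

lemma distr_linear_combination_restrict_eqI:
  fixes X :: "nat \<Rightarrow> 'a \<Rightarrow> real" and Y :: "nat \<Rightarrow> 'b \<Rightarrow> real"
  assumes "finite_measure M1" "finite_measure M2"
    and [measurable]: "\<And>i. i < Suc n \<Longrightarrow> X i \<in> borel_measurable M1"
      "\<And>i. i < Suc n \<Longrightarrow> Y i \<in> borel_measurable M2"
      "D \<in> sets borel"
    and eq: "\<And>c. distr M1 borel (\<lambda>x. \<Sum>i<Suc n. c i * X i x) = distr M2 borel (\<lambda>x. \<Sum>i<Suc n. c i * Y i x)"
  shows "distr (restrict_space M1 {x \<in> space M1. X n x \<in> D}) borel (\<lambda>x. \<Sum>i<n. c i * X i x)
    = distr (restrict_space M2 {x \<in> space M2. Y n x \<in> D}) borel (\<lambda>x. \<Sum>i<n. c i * Y i x)"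
proof (rule distr_restrict_vimage_eqI[OF assms(1,2)])
  show "distr M1 borel (\<lambda>x. u * X n x + t * (\<Sum>i<n. c i * X i x))
      = distr M2 borel (\<lambda>x. u * Y n x + t * (\<Sum>i<n. c i * Y i x))" for u t
  proof -
    have "(\<Sum>i<Suc n. ((\<lambda>i. t * c i)(n := u)) i * z i) = u * z n + t * (\<Sum>i<n. c i * z i)"
      for z :: "nat \<Rightarrow> real"
      by (simp add: sum_distrib_left mult.assoc)
    with eq[of "(\<lambda>i. t * c i)(n := u)"] show ?thesis by (simp only:)
  qed
qed (use assms(3-5) in \<open>auto intro!: borel_measurable_sum\<close>)

lemma Cramer_Wold:
  fixes X :: "nat \<Rightarrow> 'a \<Rightarrow> real" and Y :: "nat \<Rightarrow> 'b \<Rightarrow> real"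
  assumes "finite_measure M1" "finite_measure M2"
    and "\<And>i. i < n \<Longrightarrow> X i \<in> borel_measurable M1" "\<And>i. i < n \<Longrightarrow> Y i \<in> borel_measurable M2"
    and "\<And>c. distr M1 borel (\<lambda>x. \<Sum>i<n. c i * X i x) = distr M2 borel (\<lambda>x. \<Sum>i<n. c i * Y i x)"
    and "\<And>i. i < n \<Longrightarrow> D i \<in> sets borel"
  shows "measure M1 {x \<in> space M1. \<forall>i<n. X i x \<in> D i} = measure M2 {x \<in> space M2. \<forall>i<n. Y i x \<in> D i}"
  using assms
proof (induction n arbitrary: M1 M2)
  case 0
  have "measure (distr M1 borel (\<lambda>_. 0::real)) UNIV = measure (distr M2 borel (\<lambda>_. 0::real)) UNIV"
    using 0(5)[of "\<lambda>_. 0"] by simp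
  then show ?case by (simp add: measure_distr)
next
  case (Suc n)
  define E1 where "E1 = {x \<in> space M1. X n x \<in> D n}"
  define E2 where "E2 = {x \<in> space M2. Y n x \<in> D n}"
  note [measurable] = Suc.prems(3,4,6)
  have E [measurable]: "E1 \<in> sets M1" "E2 \<in> sets M2" unfolding E1_def E2_def by measurable
  have "measure (restrict_space M1 E1) {x \<in> space (restrict_space M1 E1). \<forall>i<n. X i x \<in> D i}
      = measure (restrict_space M2 E2) {x \<in> space (restrict_space M2 E2). \<forall>i<n. Y i x \<in> D i}"
  proof (rule Suc.IH)
    show "finite_measure (restrict_space M1 E1)" "finite_measure (restrict_space M2 E2)"
      using Suc.prems(1,2) E by (auto intro: finite_measure_restrict_space)
    show "distr (restrict_space M1 E1) borel (\<lambda>x. \<Sum>i<n. c i * X i x)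
        = distr (restrict_space M2 E2) borel (\<lambda>x. \<Sum>i<n. c i * Y i x)" for c
      unfolding E1_def E2_def using Suc.prems by (intro distr_linear_combination_restrict_eqI) auto
  qed (use Suc.prems in \<open>auto intro!: measurable_restrict_space1\<close>)
  moreover have
    "{x \<in> space M1. \<forall>i<Suc n. X i x \<in> D i} = {x \<in> space (restrict_space M1 E1). \<forall>i<n. X i x \<in> D i}"
    "{x \<in> space M2. \<forall>i<Suc n. Y i x \<in> D i} = {x \<in> space (restrict_space M2 E2). \<forall>i<n. Y i x \<in> D i}"
    by (auto simp: E1_def E2_def space_restrict_space less_Suc_eq)
  ultimately show ?case using E by (simp add: measure_restrict_space space_restrict_space)
qed

section \<open>Centred normal laws\<close>

definition centered_normal :: "real \<Rightarrow> real measure" where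
  "centered_normal v = distr std_normal_distribution borel (\<lambda>x. sqrt v * x)"

lemma prob_space_std_normal_distribution: "prob_space std_normal_distribution"
  by (rule prob_space_normal_density) simp

lemma real_distribution_centered_normal: "real_distribution (centered_normal v)"
proof -
  interpret prob_space std_normal_distribution by (rule prob_space_std_normal_distribution)
  show ?thesis unfolding centered_normal_def by (rule real_distribution_distr) simp
qed

lemma centered_normal_eq:
  assumes "v \<ge> 0"
  shows "centered_normal v =
    (if v = 0 then return borel 0 else density lborel (\<lambda>x. ennreal (normal_density 0 (sqrt v) x)))"
proof (cases "v = 0")
  case True
  interpret prob_space std_normal_distribution by (rule prob_space_std_normal_distribution)
  show ?thesis using True distr_const[of 0 borel] by (simp add: centered_normal_def)
next
  case False
  interpret prob_space std_normal_distribution by (rule prob_space_std_normal_distribution)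
  have "distributed std_normal_distribution lborel (\<lambda>x. x) std_normal_density"
    by (simp add: distributed_def distr_id2)
  from normal_density_affine[OF this, of "sqrt v" 0] False assms
  have "distr std_normal_distribution lborel (\<lambda>x. sqrt v * x) = density lborel (normal_density 0 (sqrt v))"
    by (simp add: distributed_def)
  moreover have "distr std_normal_distribution lborel (\<lambda>x. sqrt v * x) = centered_normal v"
    unfolding centered_normal_def by (rule distr_cong) auto
  ultimately show ?thesis using False by simp
qed

lemma char_centered_normal:
  assumes "v \<ge> 0"
  shows "char (centered_normal v) t = complex_of_real (exp (- (v * t\<^sup>2) / 2))"
proof -
  have "char (centered_normal v) t = char std_normal_distribution (t * sqrt v)"
    unfolding char_def centered_normal_def by (subst integral_distr) (auto simp: mult.assoc)
  then show ?thesis using assms by (simp add: char_std_normal_distribution power_mult_distrib mult.commute)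
qed

lemma centered_normal_eqI:
  assumes "real_distribution N" "v \<ge> 0" "\<And>t. char N t = complex_of_real (exp (- (v * t\<^sup>2) / 2))"
  shows "N = centered_normal v"
  using assms by (intro Levy_uniqueness real_distribution_centered_normal) (auto simp: char_centered_normal)

lemma
  assumes X [measurable]: "X \<in> borel_measurable N" and law: "distr N borel X = centered_normal v"
    and "v \<ge> 0"
  shows integrable_centered_normal_even_moment: "integrable N (\<lambda>x. X x ^ (2 * p))"
    and integral_centered_normal_even_moment:
      "(\<integral>x. X x ^ (2 * p) \<partial>N) = fact (2 * p) / (2 ^ p * fact p) * v ^ p"
proof -
  have scale: "(sqrt v * x) ^ (2 * p) = v ^ p * x ^ (2 * p)" for x
    using \<open>v \<ge> 0\<close> by (simp add: power_mult_distrib power_mult)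
  have "integrable (centered_normal v) (\<lambda>x. x ^ (2 * p))"
    unfolding centered_normal_def
    by (subst integrable_distr_eq) (simp_all add: scale std_normal_distribution_even_moments)
  then show "integrable N (\<lambda>x. X x ^ (2 * p))"
    unfolding law[symmetric] by (subst (asm) integrable_distr_eq) auto
  have "(\<integral>x. X x ^ (2 * p) \<partial>N) = (\<integral>x. x ^ (2 * p) \<partial>centered_normal v)"
    unfolding law[symmetric] by (subst integral_distr) auto
  also have "\<dots> = v ^ p * (fact (2 * p) / (2 ^ p * fact p))"
    unfolding centered_normal_def
    by (subst integral_distr) (simp_all add: scale std_normal_distribution_even_moments)
  finally show "(\<integral>x. X x ^ (2 * p) \<partial>N) = fact (2 * p) / (2 ^ p * fact p) * v ^ p" by simp
qed

lemma centered_normal_limit: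
  assumes "prob_space N" and meas: "\<And>m. X m \<in> borel_measurable N" "Z \<in> borel_measurable N"
    and law: "\<And>m. distr N borel (X m) = centered_normal (v m)" and v: "\<And>m. v m \<ge> 0" "v \<longlonglongrightarrow> w"
    and conv: "AE x in N. (\<lambda>m. X m x) \<longlonglongrightarrow> Z x"
  shows "distr N borel Z = centered_normal w"
proof (rule centered_normal_eqI)
  interpret prob_space N by fact
  show "real_distribution (distr N borel Z)" using meas(2) by simp
  show "w \<ge> 0" using v by (intro LIMSEQ_le_const[OF v(2)]) auto
  fix t
  have char_distr: "char (distr N borel U) t = (\<integral>x. iexp (t * U x) \<partial>N)" if "U \<in> borel_measurable N" for U
    unfolding char_def using that by (subst integral_distr) auto
  have "(\<lambda>m. \<integral>x. iexp (t * X m x) \<partial>N) \<longlonglongrightarrow> (\<integral>x. iexp (t * Z x) \<partial>N)"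
  proof (rule integral_dominated_convergence[where w="\<lambda>_. 1"])
    show "AE x in N. (\<lambda>m. iexp (t * X m x)) \<longlonglongrightarrow> iexp (t * Z x)"
      using conv by eventually_elim (auto intro!: tendsto_intros)
  qed (use meas in auto)
  then have "(\<lambda>m. complex_of_real (exp (- (v m * t\<^sup>2) / 2))) \<longlonglongrightarrow> char (distr N borel Z) t"
    using char_distr[OF meas(1)] char_distr[OF meas(2)] char_centered_normal[OF v(1)] by (simp add: law)
  moreover have "(\<lambda>m. complex_of_real (exp (- (v m * t\<^sup>2) / 2))) \<longlonglongrightarrow> complex_of_real (exp (- (w * t\<^sup>2) / 2))"
    by (intro tendsto_intros v) simp
  ultimately show "char (distr N borel Z) t = complex_of_real (exp (- (w * t\<^sup>2) / 2))"
    by (rule LIMSEQ_unique)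
qed

lemma measure_centered_normal_Icc_le:
  assumes "v > 0" "x \<ge> 0"
  shows "measure (centered_normal v) {-x..x} \<le> 2 * x / sqrt v"
proof -
  interpret real_distribution "centered_normal v" by (rule real_distribution_centered_normal)
  have density_le: "normal_density 0 (sqrt v) y \<le> 1 / sqrt v" for y
  proof -
    have "normal_density 0 (sqrt v) y = (1 / sqrt (2 * pi * v)) * exp (- (y\<^sup>2) / (2 * v))"
      using \<open>v > 0\<close> by (simp add: normal_density_def)
    also have "\<dots> \<le> (1 / sqrt (2 * pi * v)) * 1" using \<open>v > 0\<close> by (intro mult_left_mono) auto
    also have "\<dots> \<le> 1 / sqrt v"
      using \<open>v > 0\<close> mult_right_mono[of 1 "2 * pi" v] pi_ge_two by (simp add: frac_le)
    finally show ?thesis .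
  qed
  have "emeasure (centered_normal v) {-x..x}
      = (\<integral>\<^sup>+ y. ennreal (normal_density 0 (sqrt v) y) * indicator {-x..x} y \<partial>lborel)"
    using \<open>v > 0\<close> by (simp add: centered_normal_eq emeasure_density)
  also have "\<dots> \<le> (\<integral>\<^sup>+ y. ennreal (1 / sqrt v) * indicator {-x..x} y \<partial>lborel)"
    using density_le by (intro nn_integral_mono mult_right_mono ennreal_leI) auto
  also have "\<dots> = ennreal (2 * x / sqrt v)"
    using assms by (simp add: nn_integral_cmult_indicator flip: ennreal_mult)
  finally show ?thesis
    using assms unfolding emeasure_eq_measure by (subst (asm) ennreal_le_iff) auto
qed

section \<open>The supremum of a continuous Gaussian process\<close>

lemma
  assumes "centered_gp a b K N G"
  shows centered_gp_prob_space: "prob_space N"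
    and centered_gp_measurable: "t \<in> {a..b} \<Longrightarrow> G t \<in> borel_measurable N"
    and centered_gp_continuous: "\<omega> \<in> space N \<Longrightarrow> continuous_on {a..b} (\<lambda>t. G t \<omega>)"
  using assms by (auto simp: centered_gp_def)

lemma SUP_abs_le_iff_rational:
  fixes g :: "real \<Rightarrow> real"
  assumes "a < b" and cont: "continuous_on {a..b} g"
  shows "(SUP t\<in>{a..b}. \<bar>g t\<bar>) \<le> x \<longleftrightarrow> (\<forall>t\<in>{a..b}. \<bar>g t\<bar> \<le> x)"
    and "(SUP t\<in>{a..b}. \<bar>g t\<bar>) \<le> x \<longleftrightarrow> (\<forall>t\<in>\<rat> \<inter> {a..b}. \<bar>g t\<bar> \<le> x)"
proof -
  have "bdd_above ((\<lambda>t. \<bar>g t\<bar>) ` {a..b})"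
    using cont by (intro bounded_imp_bdd_above compact_imp_bounded compact_continuous_image continuous_intros) auto
  then show everywhere: "(SUP t\<in>{a..b}. \<bar>g t\<bar>) \<le> x \<longleftrightarrow> (\<forall>t\<in>{a..b}. \<bar>g t\<bar> \<le> x)"
    using \<open>a < b\<close> by (subst cSUP_le_iff) auto
  show "(SUP t\<in>{a..b}. \<bar>g t\<bar>) \<le> x \<longleftrightarrow> (\<forall>t\<in>\<rat> \<inter> {a..b}. \<bar>g t\<bar> \<le> x)"
    unfolding everywhere
    using continuous_within_Icc_le_rational[OF \<open>a < b\<close>] cont
    by (auto simp: continuous_on_eq_continuous_within)
qed

lemma sets_Collect_centered_gp_sup_le:
  assumes "a < b" and gp: "centered_gp a b K N G"
  shows "{\<omega> \<in> space N. (SUP t\<in>{a..b}. \<bar>G t \<omega>\<bar>) \<le> x} \<in> sets N"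
proof -
  have "{\<omega> \<in> space N. \<forall>t\<in>\<rat> \<inter> {a..b}. \<bar>G t \<omega>\<bar> \<le> x} \<in> sets N"
  proof (rule sets.sets_Collect_countable_All')
    fix t assume "t \<in> \<rat> \<inter> {a..b}"
    then have [measurable]: "G t \<in> borel_measurable N" by (intro centered_gp_measurable[OF gp]) auto
    show "{\<omega> \<in> space N. \<bar>G t \<omega>\<bar> \<le> x} \<in> sets N" by measurable
  qed (simp add: countable_rat)
  then show ?thesis
    by (simp add: SUP_abs_le_iff_rational(2)[OF \<open>a < b\<close> centered_gp_continuous[OF gp]] cong: conj_cong)
qed

lemma centered_gp_sup_tendsto:
  assumes "a < b" and gp: "centered_gp a b K N G" and q: "range q = \<rat> \<inter> {a..b}"
  shows "(\<lambda>n. measure N {\<omega> \<in> space N. \<forall>i<n. G (q i) \<omega> \<in> {-x..x}})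
    \<longlonglongrightarrow> measure N {\<omega> \<in> space N. (SUP t\<in>{a..b}. \<bar>G t \<omega>\<bar>) \<le> x}"
proof -
  interpret prob_space N by (rule centered_gp_prob_space[OF gp])
  define E where "E n = {\<omega> \<in> space N. \<forall>i\<in>{..<n}. G (q i) \<omega> \<in> {-x..x}}" for n :: nat
  have [measurable]: "G (q i) \<in> borel_measurable N" for i
    using q by (intro centered_gp_measurable[OF gp]) blast
  have "E n \<in> sets N" for n
    unfolding E_def by measurable
  then have "(\<lambda>n. measure N (E n)) \<longlonglongrightarrow> measure N (\<Inter>n. E n)"
    by (intro finite_Lim_measure_decseq) (auto simp: decseq_def E_def)
  moreover have "(\<Inter>n. E n) = {\<omega> \<in> space N. \<forall>i. \<bar>G (q i) \<omega>\<bar> \<le> x}"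
    by (auto simp: E_def abs_le_iff minus_le_iff)
  moreover have "(\<forall>i. \<bar>G (q i) \<omega>\<bar> \<le> x) \<longleftrightarrow> (\<forall>t\<in>\<rat> \<inter> {a..b}. \<bar>G t \<omega>\<bar> \<le> x)" for \<omega>
    unfolding q[symmetric] by auto
  ultimately show ?thesis
    using SUP_abs_le_iff_rational(2)[OF \<open>a < b\<close> centered_gp_continuous[OF gp]]
    by (simp add: E_def lessThan_def cong: conj_cong)
qed

lemma centered_gp_sup_law_unique:
  assumes "a < b" and gp1: "centered_gp a b K M1 G1" and gp2: "centered_gp a b K M2 G2"
  shows "measure M1 {\<omega> \<in> space M1. (SUP t\<in>{a..b}. \<bar>G1 t \<omega>\<bar>) \<le> x}
    = measure M2 {\<omega> \<in> space M2. (SUP t\<in>{a..b}. \<bar>G2 t \<omega>\<bar>) \<le> x}"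
proof -
  define q where "q = from_nat_into (\<rat> \<inter> {a..b})"
  have "\<rat> \<inter> {a..b} \<noteq> {}" using Rats_dense_in_real[OF \<open>a < b\<close>] by force
  then have q: "range q = \<rat> \<inter> {a..b}" unfolding q_def by (simp add: countable_rat)
  then have q_in: "q i \<in> {a..b}" for i by blast
  have "measure M1 {\<omega> \<in> space M1. \<forall>i<n. G1 (q i) \<omega> \<in> {-x..x}}
      = measure M2 {\<omega> \<in> space M2. \<forall>i<n. G2 (q i) \<omega> \<in> {-x..x}}" for n
  proof (rule Cramer_Wold)
    show "distr M1 borel (\<lambda>x. \<Sum>i<n. c i * G1 (q i) x) = distr M2 borel (\<lambda>x. \<Sum>i<n. c i * G2 (q i) x)" for c
      using gp1 gp2 q_in by (simp add: centered_gp_def)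
  qed (auto intro: prob_space.finite_measure centered_gp_prob_space[OF gp1] centered_gp_prob_space[OF gp2]
      centered_gp_measurable[OF gp1 q_in] centered_gp_measurable[OF gp2 q_in])
  with centered_gp_sup_tendsto[OF \<open>a < b\<close> gp1 q, of x]
  have "(\<lambda>n. measure M2 {\<omega> \<in> space M2. \<forall>i<n. G2 (q i) \<omega> \<in> {-x..x}})
      \<longlonglongrightarrow> measure M1 {\<omega> \<in> space M1. (SUP t\<in>{a..b}. \<bar>G1 t \<omega>\<bar>) \<le> x}" by (simp only:)
  then show ?thesis using centered_gp_sup_tendsto[OF \<open>a < b\<close> gp2 q] by (rule LIMSEQ_unique)
qed

section \<open>Positive semidefinite kernels\<close>

definition psd_kernel :: "'s set \<Rightarrow> ('s \<Rightarrow> 's \<Rightarrow> real) \<Rightarrow> bool" where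
  "psd_kernel S K \<longleftrightarrow> (\<forall>s\<in>S. \<forall>t\<in>S. K s t = K t s) \<and>
     (\<forall>(I::nat set) x c. finite I \<longrightarrow> x ` I \<subseteq> S \<longrightarrow> 0 \<le> (\<Sum>i\<in>I. \<Sum>j\<in>I. c i * c j * K (x i) (x j)))"

lemma psd_kernel_commute: "psd_kernel S K \<Longrightarrow> s \<in> S \<Longrightarrow> t \<in> S \<Longrightarrow> K s t = K t s"
  by (simp add: psd_kernel_def)

lemma psd_kernel_nonneg:
  fixes I :: "nat set"
  shows "psd_kernel S K \<Longrightarrow> finite I \<Longrightarrow> x ` I \<subseteq> S \<Longrightarrow> 0 \<le> (\<Sum>i\<in>I. \<Sum>j\<in>I. c i * c j * K (x i) (x j))"
  by (simp add: psd_kernel_def)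

lemma psd_kernel_subset: "psd_kernel S K \<Longrightarrow> S' \<subseteq> S \<Longrightarrow> psd_kernel S' K"
  by (auto simp: psd_kernel_def subset_iff image_subset_iff)

lemma psd_kernel_nonneg3:
  assumes K: "psd_kernel S K" and S: "r \<in> S" "s \<in> S" "t \<in> S"
  shows "0 \<le> u\<^sup>2 * K r r + v\<^sup>2 * K s s + w\<^sup>2 * K t t
    + 2 * u * v * K r s + 2 * u * w * K r t + 2 * v * w * K s t"
proof -
  let ?x = "\<lambda>i::nat. if i = 0 then r else if i = 1 then s else t"
  let ?c = "\<lambda>i::nat. if i = 0 then u else if i = 1 then v else w"
  have "0 \<le> (\<Sum>i\<in>{0, 1, 2}. \<Sum>j\<in>{0, 1, 2}. ?c i * ?c j * K (?x i) (?x j))"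
    by (rule psd_kernel_nonneg[OF K]) (use S in auto)
  then show ?thesis
    using psd_kernel_commute[OF K] S by (simp add: power2_eq_square algebra_simps)
qed

lemma psd_kernel_diag_nonneg: "psd_kernel S K \<Longrightarrow> t \<in> S \<Longrightarrow> 0 \<le> K t t"
  using psd_kernel_nonneg3[of S K t t t 1 0 0] by simp

lemma psd_kernel_diff_sq_le:
  assumes K: "psd_kernel S K" and S: "s \<in> S" "t \<in> S" "w \<in> S"
  shows "(K s w - K t w)\<^sup>2 \<le> (K s s - 2 * K s t + K t t) * K w w"
proof (rule nonneg_quadratic_form_discriminant)
  show "0 \<le> u\<^sup>2 * (K s s - 2 * K s t + K t t) + 2 * u * v * (K s w - K t w) + v\<^sup>2 * K w w" for u v
    using psd_kernel_nonneg3[OF K S, of u "- u" v] by (simp add: power2_eq_square algebra_simps)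
qed

lemma psd_kernel_Cauchy_Schwarz:
  assumes "psd_kernel S K" "s \<in> S" "t \<in> S"
  shows "(K s t)\<^sup>2 \<le> K s s * K t t"
proof (rule nonneg_quadratic_form_discriminant)
  show "0 \<le> u\<^sup>2 * K s s + 2 * u * v * K s t + v\<^sup>2 * K t t" for u v
    using psd_kernel_nonneg3[OF assms(1,2,3,3), of u v 0] by (simp add: algebra_simps)
qed

definition schur_complement :: "('s \<Rightarrow> 's \<Rightarrow> real) \<Rightarrow> 's \<Rightarrow> 's \<Rightarrow> 's \<Rightarrow> real" where
  "schur_complement K r s t = K s t - K s r * K t r / K r r"

lemma psd_kernel_schur_complement:
  assumes K: "psd_kernel S K" and r: "r \<in> S"
  shows "psd_kernel S (schur_complement K r)"
  unfolding psd_kernel_def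
proof (intro conjI ballI allI impI)
  fix I :: "nat set" and x c
  assume I: "finite I" "x ` I \<subseteq> S"
  define Q where "Q = (\<Sum>i\<in>I. \<Sum>j\<in>I. c i * c j * K (x i) (x j))"
  define b where "b = (\<Sum>i\<in>I. c i * K (x i) r)"
  have complement: "(\<Sum>i\<in>I. \<Sum>j\<in>I. c i * c j * schur_complement K r (x i) (x j)) = Q - b\<^sup>2 / K r r"
  proof -
    have "b\<^sup>2 = (\<Sum>i\<in>I. \<Sum>j\<in>I. c i * c j * (K (x i) r * K (x j) r))"
      by (simp add: b_def power2_eq_square sum_product mult_ac)
    then show ?thesis
      by (simp add: Q_def schur_complement_def right_diff_distrib sum_subtractf sum_divide_distrib)
  qed
  show "0 \<le> (\<Sum>i\<in>I. \<Sum>j\<in>I. c i * c j * schur_complement K r (x i) (x j))"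
  proof (cases "K r r = 0")
    case True
    then show ?thesis using psd_kernel_nonneg[OF K I] by (simp add: schur_complement_def)
  next
    case False
    obtain n where n: "n \<notin> I" using ex_new_if_finite[OF infinite_UNIV_nat I(1)] by blast
    define y where "y = x(n := r)"
    define d where "d = c(n := - b / K r r)"
    have old: "y i = x i" "d i = c i" if "i \<in> I" for i using that n by (auto simp: y_def d_def)
    have "y n = r" by (simp add: y_def)
    have "(\<Sum>i\<in>insert n I. \<Sum>j\<in>insert n I. d i * d j * K (y i) (y j))
        = (d n)\<^sup>2 * K r r + (\<Sum>j\<in>I. d n * (c j * K r (x j))) + (\<Sum>i\<in>I. d n * (c i * K (x i) r)) + Q"
      using I(1) n \<open>y n = r\<close>
      by (simp add: old sum.distrib Q_def power2_eq_square mult_ac cong: sum.cong)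
    also have "\<dots> = (d n)\<^sup>2 * K r r + d n * (\<Sum>j\<in>I. c j * K r (x j)) + (d n * b + Q)"
      by (simp add: b_def sum_distrib_left)
    also have "(\<Sum>j\<in>I. c j * K r (x j)) = b"
      unfolding b_def using I r psd_kernel_commute[OF K] by (intro sum.cong) auto
    also have "(d n)\<^sup>2 * K r r + d n * b + (d n * b + Q) = Q - b\<^sup>2 / K r r"
      using False by (simp add: d_def power2_eq_square field_simps)
    moreover have "0 \<le> (\<Sum>i\<in>insert n I. \<Sum>j\<in>insert n I. d i * d j * K (y i) (y j))"
      using I r by (intro psd_kernel_nonneg[OF K]) (auto simp: y_def)
    ultimately show ?thesis by (simp add: complement)
  qed
qed (use psd_kernel_commute[OF K] in \<open>simp add: schur_complement_def mult.commute\<close>)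

primrec cholesky_residual :: "(nat \<Rightarrow> nat \<Rightarrow> real) \<Rightarrow> nat \<Rightarrow> nat \<Rightarrow> nat \<Rightarrow> real" where
  "cholesky_residual K 0 = K"
| "cholesky_residual K (Suc k) = schur_complement (cholesky_residual K k) k"

definition cholesky_factor :: "(nat \<Rightarrow> nat \<Rightarrow> real) \<Rightarrow> nat \<Rightarrow> nat \<Rightarrow> real" where
  "cholesky_factor K i k = cholesky_residual K k i k / sqrt (cholesky_residual K k k k)"

lemma psd_kernel_cholesky_residual: "psd_kernel UNIV K \<Longrightarrow> psd_kernel UNIV (cholesky_residual K k)"
  by (induction k) (auto intro: psd_kernel_schur_complement)

lemma cholesky_residual_eliminated:
  assumes K: "psd_kernel UNIV K" and "i < k"
  shows "cholesky_residual K k i j = 0"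
proof -
  have off_diagonal: "cholesky_residual K k i j = 0" if "cholesky_residual K k i i = 0" for k j
    using psd_kernel_Cauchy_Schwarz[OF psd_kernel_cholesky_residual[OF K], of i j k] that by simp
  have "cholesky_residual K k i i = 0" using \<open>i < k\<close>
  proof (induction k)
    case (Suc k)
    show ?case
    proof (cases "i = k")
      case False
      then have "cholesky_residual K k i i = 0" using Suc by simp
      then show ?thesis using off_diagonal by (simp add: schur_complement_def)
    qed (simp add: schur_complement_def)
  qed simp
  then show ?thesis by (rule off_diagonal)
qed

lemma cholesky_factor_lower: "psd_kernel UNIV K \<Longrightarrow> i < k \<Longrightarrow> cholesky_factor K i k = 0"
  by (simp add: cholesky_factor_def cholesky_residual_eliminated)

lemma cholesky_factorization:
  assumes K: "psd_kernel UNIV K" and "i < n"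
  shows "K i j = (\<Sum>k<n. cholesky_factor K i k * cholesky_factor K j k)"
proof -
  have "K i j = (\<Sum>k<n. cholesky_factor K i k * cholesky_factor K j k) + cholesky_residual K n i j" for n
  proof (induction n)
    case (Suc n)
    have "cholesky_factor K i n * cholesky_factor K j n
        = cholesky_residual K n i n * cholesky_residual K n j n / cholesky_residual K n n n"
      using psd_kernel_diag_nonneg[OF psd_kernel_cholesky_residual[OF K], of n n]
      by (simp add: cholesky_factor_def)
    then show ?case using Suc by (simp add: schur_complement_def)
  qed simp
  from this[of n] show ?thesis by (simp add: cholesky_residual_eliminated[OF assms])
qed

section \<open>Gaussian fields on countable sets\<close>

abbreviation white_noise :: "(nat \<Rightarrow> real) measure" where
  "white_noise \<equiv> \<Pi>\<^sub>M i\<in>UNIV. std_normal_distribution"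

lemma prob_space_white_noise: "prob_space white_noise"
  by (intro prob_space_PiM prob_space_std_normal_distribution)

lemma borel_measurable_white_noise_coordinate [measurable]: "(\<lambda>\<omega>. \<omega> k) \<in> borel_measurable white_noise"
  using measurable_component_singleton[of k UNIV "\<lambda>_. std_normal_distribution"] by simp

lemma char_white_noise_coordinate:
  "char (distr white_noise borel (\<lambda>\<omega>. c * \<omega> k)) t = complex_of_real (exp (- (c\<^sup>2 * t\<^sup>2) / 2))"
proof -
  have law: "distr white_noise std_normal_distribution (\<lambda>\<omega>. \<omega> k) = std_normal_distribution"
    by (rule distr_PiM_component[where M="\<lambda>_. std_normal_distribution"])
       (auto intro: prob_space_std_normal_distribution)
  have "char (distr white_noise borel (\<lambda>\<omega>. c * \<omega> k)) t = (\<integral>\<omega>. iexp ((t * c) * \<omega> k) \<partial>white_noise)"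
    unfolding char_def by (subst integral_distr) (auto simp: mult.assoc)
  also have "\<dots> = (\<integral>x. iexp ((t * c) * x) \<partial>distr white_noise std_normal_distribution (\<lambda>\<omega>. \<omega> k))"
    by (rule integral_distr[symmetric]) (auto intro: measurable_component_singleton)
  also have "\<dots> = char std_normal_distribution (t * c)" unfolding law char_def ..
  finally show ?thesis by (simp add: char_std_normal_distribution power_mult_distrib mult.commute)
qed

lemma distr_white_noise_linear:
  assumes J: "finite J"
  shows "distr white_noise borel (\<lambda>\<omega>. \<Sum>k\<in>J. c k * \<omega> k) = centered_normal (\<Sum>k\<in>J. (c k)\<^sup>2)"
proof (rule centered_normal_eqI)
  interpret prob_space white_noise by (rule prob_space_white_noise)
  show "real_distribution (distr white_noise borel (\<lambda>\<omega>. \<Sum>k\<in>J. c k * \<omega> k))"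
    by (intro real_distribution_distr) auto
  show "(\<Sum>k\<in>J. (c k)\<^sup>2) \<ge> 0" by (intro sum_nonneg) auto
  fix t
  have "indep_vars (\<lambda>_. std_normal_distribution) (\<lambda>i \<omega>. \<omega> i) UNIV"
    by (rule indep_vars_PiM_coordinates[OF prob_space_std_normal_distribution]) simp
  then have "indep_vars (\<lambda>_. borel) (\<lambda>i \<omega>. c i * \<omega> i) UNIV" by (rule indep_vars_compose2) simp
  then have "indep_vars (\<lambda>_. borel) (\<lambda>i \<omega>. c i * \<omega> i) J" by (rule indep_vars_subset) simp
  then have "char (distr white_noise borel (\<lambda>\<omega>. \<Sum>k\<in>J. c k * \<omega> k)) t
      = (\<Prod>k\<in>J. complex_of_real (exp (- ((c k)\<^sup>2 * t\<^sup>2) / 2)))"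
    by (simp only: char_distr_sum char_white_noise_coordinate)
  also have "\<dots> = complex_of_real (exp (\<Sum>k\<in>J. - ((c k)\<^sup>2 * t\<^sup>2) / 2))" using J by (simp add: exp_sum)
  also have "(\<Sum>k\<in>J. - ((c k)\<^sup>2 * t\<^sup>2) / 2) = - ((\<Sum>k\<in>J. (c k)\<^sup>2) * t\<^sup>2) / 2"
    by (simp add: sum_negf sum_divide_distrib sum_distrib_right)
  finally show "char (distr white_noise borel (\<lambda>\<omega>. \<Sum>k\<in>J. c k * \<omega> k)) t
      = complex_of_real (exp (- ((\<Sum>k\<in>J. (c k)\<^sup>2) * t\<^sup>2) / 2))" .
qed

lemma sum_sq_linear_combination:
  fixes L :: "'i \<Rightarrow> 'k \<Rightarrow> real"
  shows "(\<Sum>k\<in>A. (\<Sum>i\<in>I. c i * L i k)\<^sup>2) = (\<Sum>i\<in>I. \<Sum>j\<in>I. c i * c j * (\<Sum>k\<in>A. L i k * L j k))"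
proof -
  have "(\<Sum>k\<in>A. (\<Sum>i\<in>I. c i * L i k)\<^sup>2) = (\<Sum>k\<in>A. \<Sum>i\<in>I. \<Sum>j\<in>I. c i * c j * (L i k * L j k))"
    by (intro sum.cong refl) (simp add: power2_eq_square sum_product mult_ac)
  also have "\<dots> = (\<Sum>i\<in>I. \<Sum>k\<in>A. \<Sum>j\<in>I. c i * c j * (L i k * L j k))" by (rule sum.swap)
  also have "\<dots> = (\<Sum>i\<in>I. \<Sum>j\<in>I. \<Sum>k\<in>A. c i * c j * (L i k * L j k))" by (intro sum.cong refl sum.swap)
  finally show ?thesis by (simp add: sum_distrib_left)
qed

definition gaussian_field :: "'s set \<Rightarrow> ('s \<Rightarrow> 's \<Rightarrow> real) \<Rightarrow> 'w measure \<Rightarrow> ('s \<Rightarrow> 'w \<Rightarrow> real) \<Rightarrow> bool" where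
  "gaussian_field S K N g \<longleftrightarrow> (\<forall>x. g x \<in> borel_measurable N) \<and>
     (\<forall>(I::nat set) x c. finite I \<longrightarrow> x ` I \<subseteq> S \<longrightarrow> distr N borel (\<lambda>\<omega>. \<Sum>i\<in>I. c i * g (x i) \<omega>)
        = centered_normal (\<Sum>i\<in>I. \<Sum>j\<in>I. c i * c j * K (x i) (x j)))"

lemma borel_measurable_gaussian_field: "gaussian_field S K N g \<Longrightarrow> g x \<in> borel_measurable N"
  by (simp add: gaussian_field_def)

lemma distr_gaussian_field:
  fixes I :: "nat set"
  shows "gaussian_field S K N g \<Longrightarrow> finite I \<Longrightarrow> x ` I \<subseteq> S \<Longrightarrow> distr N borel (\<lambda>\<omega>. \<Sum>i\<in>I. c i * g (x i) \<omega>)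
    = centered_normal (\<Sum>i\<in>I. \<Sum>j\<in>I. c i * c j * K (x i) (x j))"
  by (simp add: gaussian_field_def)

lemma distr_gaussian_field_diff:
  assumes g: "gaussian_field S K N g" and K: "psd_kernel S K" and st: "s \<in> S" "t \<in> S"
  shows "distr N borel (\<lambda>\<omega>. g s \<omega> - g t \<omega>) = centered_normal (K s s - 2 * K s t + K t t)"
proof -
  let ?x = "\<lambda>i::nat. if i = 0 then s else t" and ?c = "\<lambda>i::nat. if i = 0 then 1 else - 1 :: real"
  have "distr N borel (\<lambda>\<omega>. \<Sum>i\<in>{0, 1}. ?c i * g (?x i) \<omega>)
      = centered_normal (\<Sum>i\<in>{0, 1}. \<Sum>j\<in>{0, 1}. ?c i * ?c j * K (?x i) (?x j))"
    by (rule distr_gaussian_field[OF g]) (use st in auto)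
  then show ?thesis using psd_kernel_commute[OF K st(2,1)] by (simp add: algebra_simps)
qed

lemma gaussian_field_exists:
  fixes K :: "'s \<Rightarrow> 's \<Rightarrow> real"
  assumes S: "countable S" "S \<noteq> {}" and K: "psd_kernel S K"
  shows "\<exists>g. gaussian_field S K white_noise g"
proof -
  define pt where "pt = from_nat_into S"
  define ix where "ix = to_nat_on S"
  define L where "L = cholesky_factor (\<lambda>i j. K (pt i) (pt j))"
  have pt_in: "pt i \<in> S" for i unfolding pt_def using S by (intro from_nat_into)
  have pt_ix: "x \<in> S \<Longrightarrow> pt (ix x) = x" for x unfolding pt_def ix_def using S by simp
  have "psd_kernel UNIV (\<lambda>i j. K (pt i) (pt j))"
    unfolding psd_kernel_def
    using psd_kernel_commute[OF K] psd_kernel_nonneg[OF K, of _ "pt \<circ> _"] pt_in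
    by (auto simp: image_subset_iff)
  note lower = cholesky_factor_lower[OF this, folded L_def]
    and factorization = cholesky_factorization[OF this, folded L_def]
  define g where "g x \<omega> = (\<Sum>k\<le>ix x. L (ix x) k * \<omega> k)" for x and \<omega> :: "nat \<Rightarrow> real"
  have g_eq: "g x \<omega> = (\<Sum>k<n. L (ix x) k * \<omega> k)" if "ix x < n" for x \<omega> n
    unfolding g_def using that lower by (intro sum.mono_neutral_left) auto
  have "gaussian_field S K white_noise g"
    unfolding gaussian_field_def
  proof (intro conjI allI impI)
    show "g x \<in> borel_measurable white_noise" for x unfolding g_def[abs_def] by measurable
    fix I :: "nat set" and x :: "nat \<Rightarrow> 's" and c :: "nat \<Rightarrow> real"
    assume I: "finite I" "x ` I \<subseteq> S"
    define n where "n = Suc (Max (insert 0 ((\<lambda>i. ix (x i)) ` I)))"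
    have n: "ix (x i) < n" if "i \<in> I" for i
      unfolding n_def less_Suc_eq_le using I that by (intro Max_ge) auto
    have "(\<Sum>i\<in>I. c i * g (x i) \<omega>) = (\<Sum>k<n. (\<Sum>i\<in>I. c i * L (ix (x i)) k) * \<omega> k)" for \<omega>
    proof -
      have "(\<Sum>i\<in>I. c i * g (x i) \<omega>) = (\<Sum>i\<in>I. \<Sum>k<n. c i * L (ix (x i)) k * \<omega> k)"
        by (intro sum.cong refl) (simp add: g_eq[OF n] sum_distrib_left mult.assoc)
      then show ?thesis by (simp add: sum.swap[of _ _ I] sum_distrib_right)
    qed
    then have "distr white_noise borel (\<lambda>\<omega>. \<Sum>i\<in>I. c i * g (x i) \<omega>)
        = centered_normal (\<Sum>i\<in>I. \<Sum>j\<in>I. c i * c j * (\<Sum>k<n. L (ix (x i)) k * L (ix (x j)) k))"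
      by (simp add: distr_white_noise_linear sum_sq_linear_combination)
    moreover have "(\<Sum>k<n. L (ix (x i)) k * L (ix (x j)) k) = K (x i) (x j)" if "i \<in> I" "j \<in> I" for i j
      using factorization[OF n[OF that(1)], of "ix (x j)"] pt_ix I(2) that by (simp add: image_subset_iff)
    ultimately show "distr white_noise borel (\<lambda>\<omega>. \<Sum>i\<in>I. c i * g (x i) \<omega>)
        = centered_normal (\<Sum>i\<in>I. \<Sum>j\<in>I. c i * c j * K (x i) (x j))" by (simp cong: sum.cong)
  qed
  then show ?thesis by blast
qed

section \<open>Continuity by dyadic chaining\<close>

lemma
  fixes u :: "nat \<Rightarrow> real"
  assumes \<rho>: "0 < \<rho>" "\<rho> < 1" and step: "\<And>m. m \<ge> m0 \<Longrightarrow> \<bar>u (Suc m) - u m\<bar> \<le> \<rho> ^ m"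
  shows convergent_geometric_steps: "convergent u"
    and lim_geometric_steps: "m \<ge> m0 \<Longrightarrow> \<bar>lim u - u m\<bar> \<le> \<rho> ^ m / (1 - \<rho>)"
proof -
  have "summable (\<lambda>m. u (Suc m) - u m)"
    by (rule summable_comparison_test'[OF summable_geometric, of \<rho> m0]) (use \<rho> step in auto)
  then have "convergent (\<lambda>n. \<Sum>m<n. u (Suc m) - u m)" by (simp add: summable_iff_convergent)
  then have "convergent (\<lambda>n. u n - u 0)" by (simp add: sum_lessThan_telescope)
  then show conv: "convergent u" using convergent_diff_const_right_iff by blast
  assume m: "m \<ge> m0"
  have telescope: "\<bar>u (m + k) - u m\<bar> \<le> \<rho> ^ m * (1 - \<rho> ^ k) / (1 - \<rho>)" for k
  proof (induction k)
    case (Suc k)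
    have "\<bar>u (m + Suc k) - u m\<bar> \<le> \<rho> ^ (m + k) + \<rho> ^ m * (1 - \<rho> ^ k) / (1 - \<rho>)"
      using step[of "m + k"] Suc m by simp
    also have "\<dots> = \<rho> ^ m * (1 - \<rho> ^ Suc k) / (1 - \<rho>)" using \<rho> by (simp add: power_add field_simps)
    finally show ?case .
  qed simp
  have "\<bar>u n - u m\<bar> \<le> \<rho> ^ m / (1 - \<rho>)" if "n \<ge> m" for n
  proof -
    have "\<bar>u n - u m\<bar> \<le> \<rho> ^ m * (1 - \<rho> ^ (n - m)) / (1 - \<rho>)" using telescope[of "n - m"] that by simp
    also have "\<dots> \<le> \<rho> ^ m * 1 / (1 - \<rho>)" using \<rho> by (intro divide_right_mono mult_left_mono) auto
    finally show ?thesis by simp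
  qed
  moreover have "(\<lambda>n. \<bar>u n - u m\<bar>) \<longlonglongrightarrow> \<bar>lim u - u m\<bar>"
    using conv by (intro tendsto_intros) (simp add: convergent_LIMSEQ_iff)
  ultimately show "\<bar>lim u - u m\<bar> \<le> \<rho> ^ m / (1 - \<rho>)" by (intro LIMSEQ_le_const2) auto
qed

lemma (in prob_space) prob_UN_even_power_ge_le:
  fixes X :: "'i \<Rightarrow> 'a \<Rightarrow> real"
  assumes "finite I" "even q" "v > 0" and [measurable]: "\<And>i. i \<in> I \<Longrightarrow> X i \<in> borel_measurable M"
    and int: "\<And>i. i \<in> I \<Longrightarrow> integrable M (\<lambda>\<omega>. X i \<omega> ^ q)"
    and moment: "\<And>i. i \<in> I \<Longrightarrow> expectation (\<lambda>\<omega>. X i \<omega> ^ q) \<le> c"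
  shows "prob (\<Union>i\<in>I. {\<omega> \<in> space M. v \<le> X i \<omega> ^ q}) \<le> real (card I) * (c / v)"
proof -
  have "prob {\<omega> \<in> space M. v \<le> X i \<omega> ^ q} \<le> c / v" if "i \<in> I" for i
  proof -
    have "prob {\<omega> \<in> space M. v \<le> X i \<omega> ^ q} \<le> expectation (\<lambda>\<omega>. X i \<omega> ^ q) / v"
      by (rule integral_Markov_inequality_measure[where A="{}"])
         (use int[OF that] assms(2,3) in \<open>auto simp: zero_le_even_power\<close>)
    also have "\<dots> \<le> c / v" using moment[OF that] \<open>v > 0\<close> by (intro divide_right_mono) auto
    finally show ?thesis .
  qed
  then have "(\<Sum>i\<in>I. prob {\<omega> \<in> space M. v \<le> X i \<omega> ^ q}) \<le> real (card I) * (c / v)"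
    by (rule sum_bounded_above)
  moreover have "prob (\<Union>i\<in>I. {\<omega> \<in> space M. v \<le> X i \<omega> ^ q}) \<le> (\<Sum>i\<in>I. prob {\<omega> \<in> space M. v \<le> X i \<omega> ^ q})"
  proof (rule finite_measure_subadditive_finite[OF \<open>finite I\<close>])
    have "{\<omega> \<in> space M. v \<le> X i \<omega> ^ q} \<in> sets M" if [simp]: "i \<in> I" for i by measurable
    then show "(\<lambda>i. {\<omega> \<in> space M. v \<le> X i \<omega> ^ q}) ` I \<subseteq> sets M" by blast
  qed
  ultimately show ?thesis by linarith
qed

definition dyadic_point :: "real \<Rightarrow> real \<Rightarrow> nat \<Rightarrow> nat \<Rightarrow> real" where
  "dyadic_point a b m i = a + (b - a) * real i / 2 ^ m"

definition dyadic_index :: "real \<Rightarrow> real \<Rightarrow> nat \<Rightarrow> real \<Rightarrow> nat" where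
  "dyadic_index a b m t = nat \<lfloor>2 ^ m * ((t - a) / (b - a))\<rfloor>"

abbreviation dyadic_approx :: "real \<Rightarrow> real \<Rightarrow> nat \<Rightarrow> real \<Rightarrow> real" where
  "dyadic_approx a b m t \<equiv> dyadic_point a b m (dyadic_index a b m t)"

context
  fixes a b :: real
  assumes a_less_b: "a < b"
begin

lemma dyadic_point_in_Icc:
  assumes "i \<le> 2 ^ m"
  shows "dyadic_point a b m i \<in> {a..b}"
proof -
  have "real i \<le> 2 ^ m" using assms by (metis of_nat_le_iff of_nat_numeral of_nat_power)
  then have "(b - a) * (real i / 2 ^ m) \<le> (b - a) * 1" using a_less_b by (intro mult_left_mono) auto
  then show ?thesis using a_less_b by (simp add: dyadic_point_def)
qed

lemma dyadic_point_Suc_double: "dyadic_point a b (Suc m) (2 * i) = dyadic_point a b m i"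
  by (simp add: dyadic_point_def)

lemma dyadic_point_step: "\<bar>dyadic_point a b m (Suc i) - dyadic_point a b m i\<bar> = (b - a) / 2 ^ m"
  using a_less_b by (simp add: dyadic_point_def field_simps)

lemma dyadic_index_bounds:
  assumes "t \<in> {a..b}"
  shows "real (dyadic_index a b m t) \<le> 2 ^ m * ((t - a) / (b - a))"
    and "2 ^ m * ((t - a) / (b - a)) < real (dyadic_index a b m t) + 1"
    and "dyadic_index a b m t \<le> 2 ^ m"
proof -
  have "0 \<le> 2 ^ m * ((t - a) / (b - a))" using assms a_less_b by simp
  then show lower: "real (dyadic_index a b m t) \<le> 2 ^ m * ((t - a) / (b - a))"
    and "2 ^ m * ((t - a) / (b - a)) < real (dyadic_index a b m t) + 1"
    unfolding dyadic_index_def by (auto simp: of_nat_nat)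
  have "2 ^ m * ((t - a) / (b - a)) \<le> 2 ^ m * 1"
    using assms a_less_b by (intro mult_left_mono) (auto simp: field_simps)
  then have "real (dyadic_index a b m t) \<le> 2 ^ m" using lower by linarith
  then show "dyadic_index a b m t \<le> 2 ^ m" by (metis of_nat_le_iff of_nat_numeral of_nat_power)
qed

lemma dyadic_approx_in_Icc: "t \<in> {a..b} \<Longrightarrow> dyadic_approx a b m t \<in> {a..b}"
  by (intro dyadic_point_in_Icc dyadic_index_bounds)

lemma dyadic_index_Suc:
  assumes "t \<in> {a..b}"
  shows "dyadic_index a b (Suc m) t \<in> {2 * dyadic_index a b m t, Suc (2 * dyadic_index a b m t)}"
proof -
  have "real (dyadic_index a b (Suc m) t) < real (2 * dyadic_index a b m t + 2)"
    "real (2 * dyadic_index a b m t) < real (dyadic_index a b (Suc m) t + 1)"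
    using dyadic_index_bounds[OF assms, of m] dyadic_index_bounds[OF assms, of "Suc m"] by auto
  then show ?thesis unfolding of_nat_less_iff by auto
qed

lemma dyadic_index_near:
  assumes t: "t \<in> {a..b}" and u: "u \<in> {a..b}" and near: "\<bar>t - u\<bar> \<le> (b - a) / 2 ^ m"
  shows "dyadic_index a b m t \<le> Suc (dyadic_index a b m u)"
proof -
  define p where "p x = 2 ^ m * ((x - a) / (b - a))" for x
  have "p t - p u = (t - u) * (2 ^ m / (b - a))" by (simp add: p_def field_simps diff_divide_distrib)
  also have "\<dots> \<le> (b - a) / 2 ^ m * (2 ^ m / (b - a))"
    using a_less_b near by (intro mult_right_mono) auto
  also have "\<dots> = 1" using a_less_b by simp
  finally have "real (dyadic_index a b m t) < real (dyadic_index a b m u + 2)"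
    using dyadic_index_bounds[OF t, of m] dyadic_index_bounds[OF u, of m] unfolding p_def by auto
  then show ?thesis unfolding of_nat_less_iff by linarith
qed

lemma dyadic_approx_tendsto:
  assumes t: "t \<in> {a..b}"
  shows "(\<lambda>m. dyadic_approx a b m t) \<longlonglongrightarrow> t"
proof -
  have "\<bar>dyadic_approx a b m t - t\<bar> \<le> (b - a) / 2 ^ m" for m
  proof -
    define x where "x = 2 ^ m * ((t - a) / (b - a))"
    have "dyadic_approx a b m t - t = (real (dyadic_index a b m t) - x) * ((b - a) / 2 ^ m)"
      using a_less_b by (simp add: dyadic_point_def x_def field_simps)
    then have "\<bar>dyadic_approx a b m t - t\<bar> = \<bar>real (dyadic_index a b m t) - x\<bar> * ((b - a) / 2 ^ m)"
      using a_less_b by (simp add: abs_mult)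
    also have "\<dots> \<le> 1 * ((b - a) / 2 ^ m)"
      using dyadic_index_bounds[OF t, of m] a_less_b unfolding x_def[symmetric]
      by (intro mult_right_mono) auto
    finally show ?thesis by simp
  qed
  moreover have "(\<lambda>m. (b - a) / 2 ^ m) \<longlonglongrightarrow> 0" by (rule LIMSEQ_divide_realpow_zero) simp
  ultimately have "(\<lambda>m. dyadic_approx a b m t - t) \<longlonglongrightarrow> 0"
    by (intro Lim_null_comparison[of "\<lambda>m. dyadic_approx a b m t - t"] always_eventually allI)
       (simp_all only: real_norm_def)
  then show ?thesis by (simp add: LIM_zero_iff)
qed

definition chained :: "real \<Rightarrow> nat \<Rightarrow> (real \<Rightarrow> real) \<Rightarrow> bool" where
  "chained \<rho> m0 x \<longleftrightarrow>
     (\<forall>m\<ge>m0. \<forall>i<2 ^ m. \<bar>x (dyadic_point a b m (Suc i)) - x (dyadic_point a b m i)\<bar> \<le> \<rho> ^ m)"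

lemma chained_level_step:
  assumes x: "chained \<rho> m0 x" and \<rho>: "0 < \<rho>" "\<rho> < 1" and t: "t \<in> {a..b}" and "m \<ge> m0"
  shows "\<bar>x (dyadic_approx a b (Suc m) t) - x (dyadic_approx a b m t)\<bar> \<le> \<rho> ^ m"
proof (cases "dyadic_index a b (Suc m) t = 2 * dyadic_index a b m t")
  case True
  then show ?thesis using \<rho> by (simp add: dyadic_point_Suc_double)
next
  case False
  let ?i = "2 * dyadic_index a b m t"
  have index: "dyadic_index a b (Suc m) t = Suc ?i" using False dyadic_index_Suc[OF t, of m] by simp
  then have "?i < 2 ^ Suc m" using dyadic_index_bounds(3)[OF t, of "Suc m"] by simp
  then have "\<bar>x (dyadic_point a b (Suc m) (Suc ?i)) - x (dyadic_point a b (Suc m) ?i)\<bar> \<le> \<rho> ^ Suc m"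
    using x \<open>m \<ge> m0\<close> unfolding chained_def by (meson le_SucI)
  also have "\<dots> \<le> \<rho> ^ m" using \<rho> by (intro power_decreasing) auto
  finally show ?thesis by (simp only: index dyadic_point_Suc_double)
qed

lemma chained_convergent:
  assumes "chained \<rho> m0 x" "0 < \<rho>" "\<rho> < 1" "t \<in> {a..b}"
  shows "convergent (\<lambda>m. x (dyadic_approx a b m t))"
  using assms by (intro convergent_geometric_steps[of \<rho> m0] chained_level_step)

lemma chained_same_level:
  assumes x: "chained \<rho> m0 x" and "0 < \<rho>" and t: "t \<in> {a..b}" and u: "u \<in> {a..b}" and "m \<ge> m0"
    and near: "\<bar>t - u\<bar> \<le> (b - a) / 2 ^ m"
  shows "\<bar>x (dyadic_approx a b m t) - x (dyadic_approx a b m u)\<bar> \<le> \<rho> ^ m"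
proof -
  let ?i = "dyadic_index a b m"
  have step: "\<bar>x (dyadic_point a b m (Suc i)) - x (dyadic_point a b m i)\<bar> \<le> \<rho> ^ m" if "Suc i \<le> 2 ^ m" for i
    using x \<open>m \<ge> m0\<close> that by (simp add: chained_def Suc_le_eq)
  consider (equal) "?i t = ?i u" | (after) "?i t = Suc (?i u)" | (before) "?i u = Suc (?i t)"
    using dyadic_index_near[OF t u near] dyadic_index_near[OF u t, of m] near
    by (auto simp: abs_minus_commute le_Suc_eq)
  then show ?thesis
  proof cases
    case equal
    then show ?thesis using \<open>0 < \<rho>\<close> by simp
  next
    case after
    then show ?thesis using step[of "?i u"] dyadic_index_bounds(3)[OF t, of m] by simp
  next
    case before
    then show ?thesis using step[of "?i t"] dyadic_index_bounds(3)[OF u, of m]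
      by (simp add: abs_minus_commute)
  qed
qed

lemma chained_lim_modulus:
  assumes x: "chained \<rho> m0 x" and \<rho>: "0 < \<rho>" "\<rho> < 1" and t: "t \<in> {a..b}" and u: "u \<in> {a..b}"
    and "m \<ge> m0" and near: "\<bar>t - u\<bar> \<le> (b - a) / 2 ^ m"
  shows "\<bar>lim (\<lambda>m. x (dyadic_approx a b m t)) - lim (\<lambda>m. x (dyadic_approx a b m u))\<bar>
    \<le> (1 + 2 / (1 - \<rho>)) * \<rho> ^ m"
proof -
  have "\<bar>lim (\<lambda>m. x (dyadic_approx a b m v)) - x (dyadic_approx a b m v)\<bar> \<le> \<rho> ^ m / (1 - \<rho>)"
    if "v \<in> {a..b}" for v
    using chained_level_step[OF x \<rho> that] \<open>m \<ge> m0\<close> by (rule lim_geometric_steps[OF \<rho>])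
  from this[OF t] this[OF u] chained_same_level[OF x \<rho>(1) t u \<open>m \<ge> m0\<close> near]
  have "\<bar>lim (\<lambda>m. x (dyadic_approx a b m t)) - lim (\<lambda>m. x (dyadic_approx a b m u))\<bar>
      \<le> \<rho> ^ m + \<rho> ^ m / (1 - \<rho>) + \<rho> ^ m / (1 - \<rho>)" by linarith
  then show ?thesis by (simp add: algebra_simps)
qed

lemma continuous_on_chained_lim:
  assumes x: "chained \<rho> m0 x" and \<rho>: "0 < \<rho>" "\<rho> < 1"
  shows "continuous_on {a..b} (\<lambda>t. lim (\<lambda>m. x (dyadic_approx a b m t)))"
  unfolding continuous_on_iff
proof (intro ballI allI impI)
  fix t \<epsilon> :: real assume t: "t \<in> {a..b}" and "\<epsilon> > 0"
  have "(\<lambda>m. (1 + 2 / (1 - \<rho>)) * \<rho> ^ m) \<longlonglongrightarrow> (1 + 2 / (1 - \<rho>)) * 0"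
    using \<rho> by (intro tendsto_intros LIMSEQ_power_zero) auto
  then have "eventually (\<lambda>m. (1 + 2 / (1 - \<rho>)) * \<rho> ^ m < \<epsilon>) sequentially"
    using \<open>\<epsilon> > 0\<close> by (intro order_tendstoD(2)) auto
  then have "eventually (\<lambda>m. (1 + 2 / (1 - \<rho>)) * \<rho> ^ m < \<epsilon> \<and> m \<ge> m0) sequentially"
    using eventually_ge_at_top by (rule eventually_conj)
  then obtain m where m: "(1 + 2 / (1 - \<rho>)) * \<rho> ^ m < \<epsilon>" "m \<ge> m0" by (auto simp: eventually_sequentially)
  show "\<exists>d>0. \<forall>u\<in>{a..b}. dist u t < d \<longrightarrow>
      dist (lim (\<lambda>m. x (dyadic_approx a b m u))) (lim (\<lambda>m. x (dyadic_approx a b m t))) < \<epsilon>"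
  proof (intro exI[of _ "(b - a) / 2 ^ m"] conjI ballI impI)
    show "0 < (b - a) / 2 ^ m" using a_less_b by simp
    fix u assume "u \<in> {a..b}" "dist u t < (b - a) / 2 ^ m"
    then show "dist (lim (\<lambda>m. x (dyadic_approx a b m u))) (lim (\<lambda>m. x (dyadic_approx a b m t))) < \<epsilon>"
      using chained_lim_modulus[OF x \<rho> _ t m(2), of u] m(1) by (simp add: dist_real_def)
  qed
qed

section \<open>Existence of continuous Gaussian processes\<close>

text \<open>A union bound over the \<open>2 ^ m\<close> increments of level \<open>m\<close> and Borel--Cantelli: since \<open>\<rho> ^ q = 3 / 4\<close>, the
  bad events of level \<open>m\<close> have total probability at most \<open>2 ^ m * (C / 4 ^ m) / (3 / 4) ^ m = C * (2 / 3) ^ m\<close>.\<close>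

lemma AE_chained:
  fixes g :: "real \<Rightarrow> 'w \<Rightarrow> real"
  assumes N: "prob_space N" and g [measurable]: "\<And>x. g x \<in> borel_measurable N"
    and q: "even q" and \<rho>: "0 < \<rho>" "\<rho> ^ q = 3 / 4"
    and int: "\<And>m i. i < 2 ^ m \<Longrightarrow>
      integrable N (\<lambda>\<omega>. (g (dyadic_point a b m (Suc i)) \<omega> - g (dyadic_point a b m i) \<omega>) ^ q)"
    and moment: "\<And>m i. i < 2 ^ m \<Longrightarrow>
      (\<integral>\<omega>. (g (dyadic_point a b m (Suc i)) \<omega> - g (dyadic_point a b m i) \<omega>) ^ q \<partial>N) \<le> C / 4 ^ m"
  shows "AE \<omega> in N. \<exists>m0. chained \<rho> m0 (\<lambda>t. g t \<omega>)"
proof -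
  interpret prob_space N by fact
  define \<Delta> where "\<Delta> m i \<omega> = g (dyadic_point a b m (Suc i)) \<omega> - g (dyadic_point a b m i) \<omega>" for m i \<omega>
  have [measurable]: "\<Delta> m i \<in> borel_measurable N" for m i unfolding \<Delta>_def[abs_def] by measurable
  define bad where "bad m = (\<Union>i\<in>{..<2 ^ m}. {\<omega> \<in> space N. (3 / 4) ^ m \<le> \<Delta> m i \<omega> ^ q})" for m
  have prob_bad: "prob (bad m) \<le> C * (2 / 3) ^ m" for m
  proof -
    have "prob (bad m) \<le> real (card {..<(2::nat) ^ m}) * (C / 4 ^ m / (3 / 4) ^ m)"
      unfolding bad_def by (rule prob_UN_even_power_ge_le) (use q int moment in \<open>auto simp: \<Delta>_def\<close>)
    then show ?thesis by (simp add: power_divide mult.commute)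
  qed
  have "AE \<omega> in N. eventually (\<lambda>m. \<omega> \<in> space N - bad m) sequentially"
  proof (rule borel_cantelli_AE1)
    show "summable (\<lambda>m. prob (bad m))"
      by (rule summable_comparison_test[OF _ summable_mult[OF summable_geometric[of "2 / 3"]]])
         (use prob_bad in auto)
    show "bad m \<in> sets N" for m unfolding bad_def by measurable
  qed (auto simp: emeasure_eq_measure)
  then show ?thesis
  proof eventually_elim
    case (elim \<omega>)
    then obtain m0 where "\<And>m. m \<ge> m0 \<Longrightarrow> \<omega> \<in> space N - bad m" by (auto simp: eventually_sequentially)
    then have small: "\<Delta> m i \<omega> ^ q < (3 / 4) ^ m" if "m \<ge> m0" "i < 2 ^ m" for m i
      using that by (fastforce simp: bad_def not_le)
    have "\<bar>\<Delta> m i \<omega>\<bar> \<le> \<rho> ^ m" if "m \<ge> m0" "i < 2 ^ m" for m i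
    proof (rule power_le_imp_le_base[of _ "q - 1"])
      have "q > 0" using \<rho>(2) by (cases q) auto
      moreover have "(\<rho> ^ m) ^ q = (3 / 4) ^ m" using \<rho>(2) by (metis power_mult mult.commute)
      ultimately show "\<bar>\<Delta> m i \<omega>\<bar> ^ Suc (q - 1) \<le> (\<rho> ^ m) ^ Suc (q - 1)"
        using small[OF that] q by (simp add: power_even_abs)
    qed (use \<rho> in simp)
    then show ?case unfolding chained_def \<Delta>_def by blast
  qed
qed

lemma continuous_version:
  fixes g :: "real \<Rightarrow> 'w \<Rightarrow> real"
  assumes N: "prob_space N" and g: "\<And>x. g x \<in> borel_measurable N" and q: "even q" "q > 0"
    and int: "\<And>m i. i < 2 ^ m \<Longrightarrow>
      integrable N (\<lambda>\<omega>. (g (dyadic_point a b m (Suc i)) \<omega> - g (dyadic_point a b m i) \<omega>) ^ q)"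
    and moment: "\<And>m i. i < 2 ^ m \<Longrightarrow>
      (\<integral>\<omega>. (g (dyadic_point a b m (Suc i)) \<omega> - g (dyadic_point a b m i) \<omega>) ^ q \<partial>N) \<le> C / 4 ^ m"
  obtains X :: "real \<Rightarrow> 'w \<Rightarrow> real" where "\<And>t. t \<in> {a..b} \<Longrightarrow> X t \<in> borel_measurable N"
    and "\<And>\<omega>. continuous_on {a..b} (\<lambda>t. X t \<omega>)"
    and "AE \<omega> in N. \<forall>t\<in>{a..b}. (\<lambda>m. g (dyadic_approx a b m t) \<omega>) \<longlonglongrightarrow> X t \<omega>"
proof
  define \<rho> where "\<rho> = root q (3 / 4)"
  have \<rho>: "0 < \<rho>" "\<rho> < 1" "\<rho> ^ q = 3 / 4" unfolding \<rho>_def using q by auto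
  define good where "good = {\<omega>. \<exists>m0. chained \<rho> m0 (\<lambda>t. g t \<omega>)}"
  define X where "X t \<omega> = (if \<omega> \<in> good then lim (\<lambda>m. g (dyadic_approx a b m t) \<omega>) else 0)" for t \<omega>
  have lim: "(\<lambda>m. g (dyadic_approx a b m t) \<omega>) \<longlonglongrightarrow> X t \<omega>" if "\<omega> \<in> good" "t \<in> {a..b}" for t \<omega>
    using chained_convergent[OF _ \<rho>(1,2) that(2)] that(1)
    by (auto simp: good_def X_def convergent_LIMSEQ_iff)
  show "AE \<omega> in N. \<forall>t\<in>{a..b}. (\<lambda>m. g (dyadic_approx a b m t) \<omega>) \<longlonglongrightarrow> X t \<omega>"
  proof -
    have "AE \<omega> in N. \<exists>m0. chained \<rho> m0 (\<lambda>t. g t \<omega>)"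
      by (rule AE_chained[OF N g q(1) \<rho>(1,3)]) (use int moment in auto)
    then show ?thesis by eventually_elim (use lim in \<open>auto simp: good_def\<close>)
  qed
  have "{\<omega> \<in> space N. \<omega> \<in> good} \<in> sets N"
    using g unfolding good_def chained_def mem_Collect_eq by measurable
  then have measurable_approx:
    "(\<lambda>\<omega>. if \<omega> \<in> good then g (dyadic_approx a b m t) \<omega> else 0) \<in> borel_measurable N" for m t
    using g by (intro measurable_If) auto
  show "X t \<in> borel_measurable N" if "t \<in> {a..b}" for t
  proof (rule borel_measurable_LIMSEQ_real[OF _ measurable_approx])
    show "(\<lambda>m. if \<omega> \<in> good then g (dyadic_approx a b m t) \<omega> else 0) \<longlonglongrightarrow> X t \<omega>" for \<omega>
      using lim[OF _ that, of \<omega>] by (cases "\<omega> \<in> good") (auto simp: X_def)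
  qed
  show "continuous_on {a..b} (\<lambda>t. X t \<omega>)" for \<omega>
    using continuous_on_chained_lim[OF _ \<rho>(1,2)] by (cases "\<omega> \<in> good") (auto simp: X_def good_def)
qed

lemma dyadic_increment_power_le:
  assumes "0 \<le> v" "v \<le> C * ((b - a) / 2 ^ m) powr \<kappa>" "real p * \<kappa> \<ge> 2"
  shows "v ^ p \<le> \<bar>C\<bar> ^ p * (b - a) powr (real p * \<kappa>) / 4 ^ m"
proof -
  have "v \<le> \<bar>C\<bar> * ((b - a) / 2 ^ m) powr \<kappa>"
    using assms(2) by (rule order_trans) (intro mult_right_mono, auto)
  then have "v ^ p \<le> (\<bar>C\<bar> * ((b - a) / 2 ^ m) powr \<kappa>) ^ p" using \<open>0 \<le> v\<close> by (intro power_mono)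
  also have "\<dots> = \<bar>C\<bar> ^ p * ((b - a) / 2 ^ m) powr (real p * \<kappa>)"
    using a_less_b by (simp add: power_mult_distrib powr_power mult.commute)
  also have "\<dots> = \<bar>C\<bar> ^ p * ((b - a) powr (real p * \<kappa>) / (2 ^ m) powr (real p * \<kappa>))"
    using a_less_b by (simp add: powr_divide)
  also have "\<dots> \<le> \<bar>C\<bar> ^ p * ((b - a) powr (real p * \<kappa>) / 4 ^ m)"
  proof -
    have "(4::real) ^ m = (2 ^ m) powr 2"
      by (simp add: powr_numeral power2_eq_square power_mult_distrib[symmetric])
    also have "\<dots> \<le> (2 ^ m) powr (real p * \<kappa>)" using assms(3) by (intro powr_mono) auto
    finally show ?thesis using a_less_b by (intro mult_left_mono divide_left_mono) auto
  qed
  finally show ?thesis by simp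
qed

definition dyadic_points :: "real set" where
  "dyadic_points = {dyadic_point a b m i | m i. i \<le> 2 ^ m}"

lemma dyadic_points_subset: "dyadic_points \<subseteq> {a..b}"
  using dyadic_point_in_Icc by (auto simp: dyadic_points_def)

lemma dyadic_approx_in_dyadic_points: "t \<in> {a..b} \<Longrightarrow> dyadic_approx a b m t \<in> dyadic_points"
  using dyadic_index_bounds(3) by (auto simp: dyadic_points_def)

lemma countable_dyadic_points: "countable dyadic_points"
proof (rule countable_subset)
  show "dyadic_points \<subseteq> (\<lambda>(m, i). dyadic_point a b m i) ` UNIV" by (auto simp: dyadic_points_def)
qed simp

context
  fixes K :: "real \<Rightarrow> real \<Rightarrow> real" and \<kappa> C :: real
  assumes K: "psd_kernel {a..b} K" and "\<kappa> > 0"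
    and incr: "\<And>t u. t \<in> {a..b} \<Longrightarrow> u \<in> {a..b} \<Longrightarrow> K t t - 2 * K t u + K u u \<le> C * \<bar>t - u\<bar> powr \<kappa>"
begin

lemma Hoelder_kernel_bounded:
  assumes t: "t \<in> {a..b}"
  shows "K t t \<le> 2 * K a a + 2 * (\<bar>C\<bar> * (b - a) powr \<kappa>)"
proof -
  have a: "a \<in> {a..b}" using a_less_b by simp
  have "K t t - 2 * K t a + K a a \<le> C * \<bar>t - a\<bar> powr \<kappa>" by (rule incr[OF t a])
  also have "\<dots> \<le> \<bar>C\<bar> * (b - a) powr \<kappa>"
    using t \<open>\<kappa> > 0\<close> by (intro mult_mono powr_mono2) auto
  finally have "K t t - 2 * K t a + K a a \<le> \<bar>C\<bar> * (b - a) powr \<kappa>" .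
  moreover have "0 \<le> K t t + 4 * K a a - 4 * K t a"
    using psd_kernel_nonneg3[OF K t a a, of 1 "- 2" 0] by simp
  ultimately show ?thesis by argo
qed

lemma Hoelder_kernel_tendsto:
  assumes x: "x \<longlonglongrightarrow> s" "\<And>m. x m \<in> {a..b}" "s \<in> {a..b}" and y: "y \<longlonglongrightarrow> t" "\<And>m. y m \<in> {a..b}" "t \<in> {a..b}"
  shows "(\<lambda>m. K (x m) (y m)) \<longlonglongrightarrow> K s t"
proof -
  define B where "B = 2 * K a a + 2 * (\<bar>C\<bar> * (b - a) powr \<kappa>)"
  have diff_le: "\<bar>K u w - K u' w\<bar> \<le> sqrt (\<bar>C\<bar> * \<bar>u - u'\<bar> powr \<kappa> * B)"
    if "u \<in> {a..b}" "u' \<in> {a..b}" "w \<in> {a..b}" for u u' w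
  proof (rule real_le_rsqrt)
    have "K u u - 2 * K u u' + K u' u' \<le> \<bar>C\<bar> * \<bar>u - u'\<bar> powr \<kappa>"
      by (rule order_trans[OF incr[OF that(1,2)]]) (intro mult_right_mono, auto)
    moreover have "0 \<le> K w w" "K w w \<le> B"
      unfolding B_def using psd_kernel_diag_nonneg[OF K that(3)]
        Hoelder_kernel_bounded[OF that(3)] by auto
    ultimately have "(K u u - 2 * K u u' + K u' u') * K w w \<le> \<bar>C\<bar> * \<bar>u - u'\<bar> powr \<kappa> * B"
      by (intro mult_mono) auto
    then show "\<bar>K u w - K u' w\<bar>\<^sup>2 \<le> \<bar>C\<bar> * \<bar>u - u'\<bar> powr \<kappa> * B"
      using psd_kernel_diff_sq_le[OF K that] by simp
  qed
  have modulus: "(\<lambda>m. sqrt (\<bar>C\<bar> * \<bar>x m - s\<bar> powr \<kappa> * B)) \<longlonglongrightarrow> 0" if "x \<longlonglongrightarrow> s" for x :: "nat \<Rightarrow> real" and s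
  proof -
    have "(\<lambda>m. \<bar>x m - s\<bar>) \<longlonglongrightarrow> 0" using that by (simp add: LIM_zero_iff tendsto_rabs_zero_iff)
    then have "(\<lambda>m. \<bar>x m - s\<bar> powr \<kappa>) \<longlonglongrightarrow> 0 powr \<kappa>" using \<open>\<kappa> > 0\<close> by (intro tendsto_powr2) auto
    then have "(\<lambda>m. sqrt (\<bar>C\<bar> * \<bar>x m - s\<bar> powr \<kappa> * B)) \<longlonglongrightarrow> sqrt (\<bar>C\<bar> * 0 powr \<kappa> * B)"
      by (intro tendsto_real_sqrt tendsto_mult tendsto_const)
    then show ?thesis by simp
  qed
  have "\<bar>K (x m) (y m) - K s t\<bar>
      \<le> sqrt (\<bar>C\<bar> * \<bar>x m - s\<bar> powr \<kappa> * B) + sqrt (\<bar>C\<bar> * \<bar>y m - t\<bar> powr \<kappa> * B)" for m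
    using diff_le[OF x(2)[of m] x(3) y(2)[of m]] diff_le[OF y(2)[of m] y(3) x(3)]
      psd_kernel_commute[OF K x(3) y(2)[of m]] psd_kernel_commute[OF K x(3) y(3)] by linarith
  moreover have "(\<lambda>m. sqrt (\<bar>C\<bar> * \<bar>x m - s\<bar> powr \<kappa> * B) + sqrt (\<bar>C\<bar> * \<bar>y m - t\<bar> powr \<kappa> * B)) \<longlonglongrightarrow> 0"
    using tendsto_add[OF modulus[OF x(1)] modulus[OF y(1)]] by simp
  ultimately have "(\<lambda>m. K (x m) (y m) - K s t) \<longlonglongrightarrow> 0"
    by (intro Lim_null_comparison[of "\<lambda>m. K (x m) (y m) - K s t"
          "\<lambda>m. sqrt (\<bar>C\<bar> * \<bar>x m - s\<bar> powr \<kappa> * B) + sqrt (\<bar>C\<bar> * \<bar>y m - t\<bar> powr \<kappa> * B)"])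
       (simp_all only: real_norm_def always_eventually simp_thms eventually_True)
  then show ?thesis by (simp add: LIM_zero_iff)
qed

lemma centered_gpI_approx:
  assumes N: "prob_space N"
    and g: "gaussian_field dyadic_points K N g"
    and X: "\<And>t. t \<in> {a..b} \<Longrightarrow> X t \<in> borel_measurable N" "\<And>\<omega>. continuous_on {a..b} (\<lambda>t. X t \<omega>)"
    and lim: "AE \<omega> in N. \<forall>t\<in>{a..b}. (\<lambda>m. g (dyadic_approx a b m t) \<omega>) \<longlonglongrightarrow> X t \<omega>"
  shows "centered_gp a b K N X"
  unfolding centered_gp_def Let_def
proof (intro conjI ballI allI impI)
  fix I :: "nat set" and t c :: "nat \<Rightarrow> real"
  assume I: "finite I" and t: "\<forall>i\<in>I. t i \<in> {a..b}"
  define x where "x m i = dyadic_approx a b m (t i)" for m i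
  define V where "V = (\<Sum>i\<in>I. \<Sum>j\<in>I. c i * c j * K (t i) (t j))"
  have x: "x m i \<in> {a..b}" "(\<lambda>m. x m i) \<longlonglongrightarrow> t i" if "i \<in> I" for m i
    unfolding x_def using t that dyadic_approx_in_Icc dyadic_approx_tendsto by auto
  have "distr N borel (\<lambda>\<omega>. \<Sum>i\<in>I. c i * X (t i) \<omega>) = centered_normal V"
  proof (rule centered_normal_limit[OF N])
    show "distr N borel (\<lambda>\<omega>. \<Sum>i\<in>I. c i * g (x m i) \<omega>)
        = centered_normal (\<Sum>i\<in>I. \<Sum>j\<in>I. c i * c j * K (x m i) (x m j))" for m
      unfolding x_def using t dyadic_approx_in_dyadic_points by (intro distr_gaussian_field[OF g I]) auto
    show "(\<lambda>\<omega>. \<Sum>i\<in>I. c i * g (x m i) \<omega>) \<in> borel_measurable N" for m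
      by (intro borel_measurable_sum borel_measurable_times borel_measurable_const
          borel_measurable_gaussian_field[OF g])
    show "(\<lambda>\<omega>. \<Sum>i\<in>I. c i * X (t i) \<omega>) \<in> borel_measurable N"
      using X(1) t by (intro borel_measurable_sum borel_measurable_times) auto
    show "0 \<le> (\<Sum>i\<in>I. \<Sum>j\<in>I. c i * c j * K (x m i) (x m j))" for m
      using x by (intro psd_kernel_nonneg[OF K I]) auto
    show "(\<lambda>m. \<Sum>i\<in>I. \<Sum>j\<in>I. c i * c j * K (x m i) (x m j)) \<longlonglongrightarrow> V"
      unfolding V_def using t x
      by (intro tendsto_sum tendsto_mult tendsto_const Hoelder_kernel_tendsto) auto
    show "AE \<omega> in N. (\<lambda>m. \<Sum>i\<in>I. c i * g (x m i) \<omega>) \<longlonglongrightarrow> (\<Sum>i\<in>I. c i * X (t i) \<omega>)"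
      using lim by eventually_elim (use t in \<open>auto simp: x_def intro!: tendsto_intros\<close>)
  qed
  moreover have "0 \<le> V" unfolding V_def using t by (intro psd_kernel_nonneg[OF K I]) auto
  ultimately show "distr N borel (\<lambda>\<omega>. \<Sum>i\<in>I. c i * X (t i) \<omega>) = (if V = 0 then return borel 0
      else density lborel (\<lambda>x. ennreal (normal_density 0 (sqrt V) x)))"
    by (simp add: centered_normal_eq)
qed (use N X in auto)

lemma gaussian_field_dyadic_moment:
  assumes g: "gaussian_field dyadic_points K N g" and p: "real p * \<kappa> \<ge> 2" and i: "i < 2 ^ m"
  defines "\<Delta> \<equiv> \<lambda>\<omega>. g (dyadic_point a b m (Suc i)) \<omega> - g (dyadic_point a b m i) \<omega>"
  shows "integrable N (\<lambda>\<omega>. \<Delta> \<omega> ^ (2 * p))"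
    and "(\<integral>\<omega>. \<Delta> \<omega> ^ (2 * p) \<partial>N) \<le>
      fact (2 * p) / (2 ^ p * fact p) * (\<bar>C\<bar> ^ p * (b - a) powr (real p * \<kappa>)) / 4 ^ m"
proof -
  define s t where "s = dyadic_point a b m (Suc i)" and "t = dyadic_point a b m i"
  define V where "V = K s s - 2 * K s t + K t t"
  have "s \<in> dyadic_points" "t \<in> dyadic_points"
    unfolding s_def t_def dyadic_points_def using i by force+
  note st = this subsetD[OF dyadic_points_subset this(1)] subsetD[OF dyadic_points_subset this(2)]
  have law: "distr N borel \<Delta> = centered_normal V"
    unfolding \<Delta>_def V_def s_def[symmetric] t_def[symmetric]
    by (rule distr_gaussian_field_diff[OF g psd_kernel_subset[OF K dyadic_points_subset] st(1,2)])
  have V: "0 \<le> V" "V \<le> C * ((b - a) / 2 ^ m) powr \<kappa>"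
    unfolding V_def using psd_kernel_nonneg3[OF K st(3,4,4), of 1 "- 1" 0]
      incr[OF st(3,4)] dyadic_point_step[of m i] by (simp_all flip: s_def t_def)
  have \<Delta>: "\<Delta> \<in> borel_measurable N"
    unfolding \<Delta>_def by (intro borel_measurable_diff borel_measurable_gaussian_field[OF g])
  show "integrable N (\<lambda>\<omega>. \<Delta> \<omega> ^ (2 * p))" by (rule integrable_centered_normal_even_moment[OF \<Delta> law V(1)])
  have "(\<integral>\<omega>. \<Delta> \<omega> ^ (2 * p) \<partial>N) = fact (2 * p) / (2 ^ p * fact p) * V ^ p"
    by (rule integral_centered_normal_even_moment[OF \<Delta> law V(1)])
  also have "\<dots> \<le> fact (2 * p) / (2 ^ p * fact p) * (\<bar>C\<bar> ^ p * (b - a) powr (real p * \<kappa>) / 4 ^ m)"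
    by (intro mult_left_mono dyadic_increment_power_le V p) simp
  finally show "(\<integral>\<omega>. \<Delta> \<omega> ^ (2 * p) \<partial>N) \<le>
      fact (2 * p) / (2 ^ p * fact p) * (\<bar>C\<bar> ^ p * (b - a) powr (real p * \<kappa>)) / 4 ^ m" by simp
qed

theorem centered_gp_exists: "\<exists>X. centered_gp a b K white_noise X"
proof -
  have "dyadic_points \<noteq> {}" using dyadic_approx_in_dyadic_points[of a] a_less_b by auto
  then obtain g where g: "gaussian_field dyadic_points K white_noise g"
    using gaussian_field_exists[OF countable_dyadic_points _ psd_kernel_subset[OF K dyadic_points_subset]] by blast
  define p where "p = nat \<lceil>2 / \<kappa>\<rceil>"
  have "2 / \<kappa> \<le> real p" unfolding p_def by (simp add: real_nat_ceiling_ge)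
  then have p: "real p * \<kappa> \<ge> 2" using \<open>\<kappa> > 0\<close> by (simp add: field_simps)
  then have "p > 0" by (cases p) auto
  then have even: "even (2 * p)" "2 * p > 0" by auto
  obtain X where "\<And>t. t \<in> {a..b} \<Longrightarrow> X t \<in> borel_measurable white_noise"
    "\<And>\<omega>. continuous_on {a..b} (\<lambda>t. X t \<omega>)"
    "AE \<omega> in white_noise. \<forall>t\<in>{a..b}. (\<lambda>m. g (dyadic_approx a b m t) \<omega>) \<longlonglongrightarrow> X t \<omega>"
  proof (rule continuous_version[OF prob_space_white_noise borel_measurable_gaussian_field[OF g] even])
    fix m i :: nat
    assume i: "i < 2 ^ m"
    note moment = gaussian_field_dyadic_moment[OF g p i]
    show "integrable white_noise
        (\<lambda>\<omega>. (g (dyadic_point a b m (Suc i)) \<omega> - g (dyadic_point a b m i) \<omega>) ^ (2 * p))"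
      by (rule moment(1))
    show "(\<integral>\<omega>. (g (dyadic_point a b m (Suc i)) \<omega> - g (dyadic_point a b m i) \<omega>) ^ (2 * p) \<partial>white_noise)
        \<le> fact (2 * p) / (2 ^ p * fact p) * (\<bar>C\<bar> ^ p * (b - a) powr (real p * \<kappa>)) / 4 ^ m"
      by (rule moment(2))
  qed (rule that)
  with centered_gpI_approx[OF prob_space_white_noise g] show ?thesis by blast
qed

end

end

section \<open>Quantiles of the supremum of a Gaussian process\<close>

lemma gauss_sup_quantile_eq:
  fixes N :: "(nat \<Rightarrow> real) measure"
  assumes "a < b" and gp: "centered_gp a b K N G"
  shows "gauss_sup_quantile a b K \<gamma>
    = Inf {x. 1 - \<gamma> \<le> measure N {\<omega> \<in> space N. (SUP t\<in>{a..b}. \<bar>G t \<omega>\<bar>) \<le> x}}"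
  unfolding gauss_sup_quantile_def
proof (rule the_equality)
  show "\<forall>(M::(nat \<Rightarrow> real) measure) G'. centered_gp a b K M G' \<longrightarrow>
      Inf {x. 1 - \<gamma> \<le> measure N {\<omega> \<in> space N. (SUP t\<in>{a..b}. \<bar>G t \<omega>\<bar>) \<le> x}}
        = Inf {x. 1 - \<gamma> \<le> measure M {\<omega> \<in> space M. (SUP t\<in>{a..b}. \<bar>G' t \<omega>\<bar>) \<le> x}}"
  proof (intro allI impI)
    fix M :: "(nat \<Rightarrow> real) measure" and G'
    assume gp': "centered_gp a b K M G'"
    show "Inf {x. 1 - \<gamma> \<le> measure N {\<omega> \<in> space N. (SUP t\<in>{a..b}. \<bar>G t \<omega>\<bar>) \<le> x}}
        = Inf {x. 1 - \<gamma> \<le> measure M {\<omega> \<in> space M. (SUP t\<in>{a..b}. \<bar>G' t \<omega>\<bar>) \<le> x}}"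
      unfolding centered_gp_sup_law_unique[OF \<open>a < b\<close> gp gp'] ..
  qed
qed (use gp in blast)

lemma centered_gp_sup_quantile_nonempty:
  assumes "a < b" and gp: "centered_gp a b K N G" and "\<gamma> > 0"
  shows "\<exists>x. 1 - \<gamma> \<le> measure N {\<omega> \<in> space N. (SUP t\<in>{a..b}. \<bar>G t \<omega>\<bar>) \<le> x}"
proof -
  interpret prob_space N by (rule centered_gp_prob_space[OF gp])
  let ?E = "\<lambda>n::nat. {\<omega> \<in> space N. (SUP t\<in>{a..b}. \<bar>G t \<omega>\<bar>) \<le> real n}"
  have "(\<lambda>n. prob (?E n)) \<longlonglongrightarrow> prob (\<Union>n. ?E n)"
    using sets_Collect_centered_gp_sup_le[OF \<open>a < b\<close> gp]
    by (intro finite_Lim_measure_incseq) (auto simp: incseq_def elim: order_trans)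
  also have "(\<Union>n. ?E n) = space N" using real_arch_simple by blast
  finally have "(\<lambda>n. prob (?E n)) \<longlonglongrightarrow> 1" by (simp add: prob_space)
  then have "eventually (\<lambda>n. 1 - \<gamma> < prob (?E n)) sequentially"
    using \<open>\<gamma> > 0\<close> by (intro order_tendstoD(1)) auto
  then show ?thesis by (auto simp: eventually_sequentially intro: less_imp_le)
qed

lemma distr_centered_gp:
  assumes gp: "centered_gp a b K N G" and t: "t \<in> {a..b}" and "K t t \<ge> 0"
  shows "distr N borel (G t) = centered_normal (K t t)"
proof -
  have "distr N borel (\<lambda>\<omega>. \<Sum>i\<in>{0::nat}. 1 * G t \<omega>) =
      (let v = \<Sum>i\<in>{0::nat}. \<Sum>j\<in>{0::nat}. 1 * 1 * K t t in
       if v = 0 then return borel 0 else density lborel (\<lambda>x. ennreal (normal_density 0 (sqrt v) x)))"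
    using gp t unfolding centered_gp_def
    by (elim conjE allE[of _ "{0::nat}"] allE[of _ "\<lambda>_. t"] allE[of _ "\<lambda>_. 1"]) auto
  then show ?thesis using \<open>K t t \<ge> 0\<close> by (simp add: centered_normal_eq)
qed

lemma prob_centered_gp_sup_le:
  assumes "a < b" and gp: "centered_gp a b K N G" and t: "t \<in> {a..b}" and "K t t \<ge> 0"
  shows "measure N {\<omega> \<in> space N. (SUP t\<in>{a..b}. \<bar>G t \<omega>\<bar>) \<le> x} \<le> measure (centered_normal (K t t)) {-x..x}"
proof -
  interpret prob_space N by (rule centered_gp_prob_space[OF gp])
  note [measurable] = centered_gp_measurable[OF gp t]
  have "\<bar>G t \<omega>\<bar> \<le> x" if "\<omega> \<in> space N" "(SUP t\<in>{a..b}. \<bar>G t \<omega>\<bar>) \<le> x" for \<omega>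
    using SUP_abs_le_iff_rational(1)[OF \<open>a < b\<close> centered_gp_continuous[OF gp that(1)]] that(2) t by blast
  then have "prob {\<omega> \<in> space N. (SUP t\<in>{a..b}. \<bar>G t \<omega>\<bar>) \<le> x} \<le> prob (G t -` {-x..x} \<inter> space N)"
    by (intro finite_measure_mono) (auto simp: abs_le_iff minus_le_iff)
  also have "\<dots> = measure (centered_normal (K t t)) {-x..x}"
    unfolding distr_centered_gp[OF assms(2-4), symmetric] by (simp add: measure_distr)
  finally show ?thesis .
qed

lemma gauss_sup_quantile_ge:
  fixes N :: "(nat \<Rightarrow> real) measure"
  assumes "a < b" and gp: "centered_gp a b K N G" and t: "t \<in> {a..b}" "K t t > 0" and \<gamma>: "0 < \<gamma>" "\<gamma> < 1"
  shows "sqrt (K t t) * ((1 - \<gamma>) / 2) \<le> gauss_sup_quantile a b K \<gamma>"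
  unfolding gauss_sup_quantile_eq[OF \<open>a < b\<close> gp]
proof (rule cInf_greatest)
  show "{x. 1 - \<gamma> \<le> measure N {\<omega> \<in> space N. (SUP t\<in>{a..b}. \<bar>G t \<omega>\<bar>) \<le> x}} \<noteq> {}"
    using centered_gp_sup_quantile_nonempty[OF \<open>a < b\<close> gp \<gamma>(1)] by blast
  fix x
  assume "x \<in> {x. 1 - \<gamma> \<le> measure N {\<omega> \<in> space N. (SUP t\<in>{a..b}. \<bar>G t \<omega>\<bar>) \<le> x}}"
  then have mass: "1 - \<gamma> \<le> measure (centered_normal (K t t)) {-x..x}"
    using prob_centered_gp_sup_le[OF \<open>a < b\<close> gp t(1) less_imp_le[OF t(2)], of x] by simp
  then have "x \<ge> 0" using \<gamma>(2) by (cases "x \<ge> 0") auto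
  then have "1 - \<gamma> \<le> 2 * x / sqrt (K t t)"
    using mass measure_centered_normal_Icc_le[OF t(2)] by (blast intro: order_trans)
  then show "sqrt (K t t) * ((1 - \<gamma>) / 2) \<le> x" using t(2) by (simp add: field_simps)
qed

section \<open>The covariance of the Gaussian band\<close>

context deconvolution_model
begin

lemma cov_G2_P: "cov_G2 a b f \<phi> u v = (\<integral>y. f (y - u) * f (y - v) \<partial>P)"
  unfolding cov_G2_def by (subst integral_P_lborel) (auto simp: mult.assoc)

lemma integrable_P_f: "integrable P (\<lambda>y. f (y - u))"
  by (rule integrable_P_bounded[where c=M]) (auto simp: abs_f_le)

lemma integrable_P_f_mult: "integrable P (\<lambda>y. f (y - u) * f (y - v))"
  by (rule integrable_P_bounded[where c="M * M"]) (auto simp: abs_mult abs_f_le M_nonneg intro!: mult_mono)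

lemma psd_kernel_cov_G2: "psd_kernel S (cov_G2 a b f \<phi>)"
  unfolding psd_kernel_def
proof (intro conjI ballI allI impI)
  show "cov_G2 a b f \<phi> u v = cov_G2 a b f \<phi> v u" for u v
    by (simp add: cov_G2_P mult.commute)
  fix I :: "nat set" and x :: "nat \<Rightarrow> real" and c :: "nat \<Rightarrow> real"
  have "(\<Sum>i\<in>I. \<Sum>j\<in>I. c i * c j * cov_G2 a b f \<phi> (x i) (x j))
      = (\<integral>y. (\<Sum>i\<in>I. \<Sum>j\<in>I. c i * c j * (f (y - x i) * f (y - x j))) \<partial>P)"
    by (simp add: cov_G2_P integrable_P_f_mult)
  also have "\<dots> = (\<integral>y. (\<Sum>i\<in>I. c i * f (y - x i))\<^sup>2 \<partial>P)"
    by (simp add: power2_eq_square sum_product mult_ac)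
  finally show "0 \<le> (\<Sum>i\<in>I. \<Sum>j\<in>I. c i * c j * cov_G2 a b f \<phi> (x i) (x j))" by simp
qed

lemma cov_G2_increment:
  "cov_G2 a b f \<phi> t t - 2 * cov_G2 a b f \<phi> t u + cov_G2 a b f \<phi> u u = (\<integral>y. (f (y - t) - f (y - u))\<^sup>2 \<partial>P)"
proof -
  have "(f (y - t) - f (y - u))\<^sup>2
      = f (y - t) * f (y - t) - 2 * (f (y - t) * f (y - u)) + f (y - u) * f (y - u)" for y
    by (simp add: power2_eq_square algebra_simps)
  then show ?thesis by (simp add: cov_G2_P integrable_P_f_mult)
qed

definition cov_Hoelder_const :: real where
  "cov_Hoelder_const = M\<^sup>2 * (2 * (b - a) powr s + 8 * M * (b - a) powr (1 - s))"

lemma sq_modulus_le_Hoelder: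
  assumes "0 \<le> d" "d \<le> b - a"
  shows "sq_modulus d \<le> cov_Hoelder_const * d powr s"
proof -
  have "(d powr s)\<^sup>2 \<le> (b - a) powr s * d powr s"
    unfolding power2_eq_square using assms s by (intro mult_right_mono powr_mono2) auto
  moreover have "d \<le> (b - a) powr (1 - s) * d powr s"
  proof (cases "d = 0")
    case False
    then have "d = d powr (1 - s) * d powr s" using assms by (simp flip: powr_add)
    also have "\<dots> \<le> (b - a) powr (1 - s) * d powr s" using assms s
      by (intro mult_right_mono powr_mono2) auto
    finally show ?thesis .
  qed simp
  ultimately have "M\<^sup>2 * (2 * (d powr s)\<^sup>2 + 8 * M * d)
      \<le> M\<^sup>2 * (2 * ((b - a) powr s * d powr s) + 8 * M * ((b - a) powr (1 - s) * d powr s))"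
    using M_pos by (intro mult_left_mono add_mono) auto
  then show ?thesis by (simp add: sq_modulus_def cov_Hoelder_const_def algebra_simps)
qed

lemma cov_G2_increment_le:
  assumes "t \<in> {a..b}" "u \<in> {a..b}"
  shows "cov_G2 a b f \<phi> t t - 2 * cov_G2 a b f \<phi> t u + cov_G2 a b f \<phi> u u
    \<le> cov_Hoelder_const * \<bar>t - u\<bar> powr s"
proof -
  have "(\<integral>y. (f (y - t) - f (y - u))\<^sup>2 \<partial>P) \<le> sq_modulus \<bar>t - u\<bar>"
  proof (rule second_moment_le_sq_modulus)
    show "AE y in P. \<bar>f (y - t) - f (y - u)\<bar>
        \<le> M * \<bar>t - u\<bar> powr s + M * indicator (jump_strip \<bar>t - u\<bar> t) y"
      by (intro AE_I2 f_modulus_jump_strip) simp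
  qed (auto simp: abs_f_diff_le)
  also have "\<dots> \<le> cov_Hoelder_const * \<bar>t - u\<bar> powr s"
    using assms by (intro sq_modulus_le_Hoelder) auto
  finally show ?thesis by (simp add: cov_G2_increment)
qed

lemma cov_G2_gp_exists: "\<exists>X. centered_gp a b (cov_G2 a b f \<phi>) white_noise X"
  by (rule centered_gp_exists[OF a_less_b psd_kernel_cov_G2 s(1) cov_G2_increment_le])

lemma T'T_\<phi>_ge: "\<exists>t\<in>{a..b}. T'T \<phi> t \<ge> 1 / (b - a)"
proof -
  have L2_r: "L2 r" by (rule L2_T[OF L2_\<phi>])
  have "(\<integral>y. r y \<partial>lborel_Icc a b) = 1"
    using integral_P_Icc[of "\<lambda>_. 1"] Y.prob_space by simp
  then have "1 \<le> (nrm r * nrm (\<lambda>_. 1))\<^sup>2"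
    using L2inner_Cauchy_Schwarz[OF L2_r L2fun_const, of 1] by (simp add: L2inner_eq)
  also have "\<dots> = ip r r * (b - a)"
    using a_less_b by (simp add: power_mult_distrib L2norm_sq) (simp add: L2inner_eq measure_lborel_Icc)
  also have "ip r r = ip \<phi> (T'T \<phi>)" using ip_T_left[OF L2_\<phi> L2_r] by (simp add: T'T_eq)
  finally have ge: "1 / (b - a) \<le> ip \<phi> (T'T \<phi>)" using a_less_b by (simp add: field_simps)
  obtain t where t: "t \<in> {a..b}" "\<And>u. u \<in> {a..b} \<Longrightarrow> T'T \<phi> u \<le> T'T \<phi> t"
    using continuous_attains_sup[OF compact_Icc _ continuous_on_T'T[OF L2_\<phi>]] a_less_b by auto
  have "ip \<phi> (T'T \<phi>) \<le> (\<integral>u. \<phi> u * T'T \<phi> t \<partial>lborel_Icc a b)"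
    unfolding L2inner_eq
    using t \<phi>_nonneg L2fun_integrable_mult[OF L2_\<phi> L2_T'T[OF L2_\<phi>]] L2fun_integrable[OF L2_\<phi>]
    by (intro integral_mono mult_left_mono) auto
  also have "\<dots> = T'T \<phi> t" by (simp add: integral_\<phi>_Icc)
  finally show ?thesis using ge t(1) by (intro bexI[of _ t]) auto
qed

lemma cov_G2_diag_ge: "\<exists>t\<in>{a..b}. cov_G2 a b f \<phi> t t \<ge> (1 / (b - a))\<^sup>2"
proof -
  obtain t where t: "t \<in> {a..b}" "T'T \<phi> t \<ge> 1 / (b - a)" using T'T_\<phi>_ge by blast
  have "(1 / (b - a))\<^sup>2 \<le> (T'T \<phi> t)\<^sup>2" using t a_less_b by (intro power_mono) auto
  also have "\<dots> \<le> cov_G2 a b f \<phi> t t"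
  proof -
    have "integrable P (\<lambda>y. (f (y - t))\<^sup>2)" using integrable_P_f_mult by (simp add: power2_eq_square)
    then have "0 \<le> Y.expectation (\<lambda>y. (f (y - t))\<^sup>2) - (Y.expectation (\<lambda>y. f (y - t)))\<^sup>2"
      using Y.variance_positive[of "\<lambda>y. f (y - t)"] by (simp only: Y.variance_eq[OF integrable_P_f])
    then show ?thesis by (simp add: cov_G2_P T'T_\<phi> power2_eq_square)
  qed
  finally show ?thesis using t(1) by blast
qed

lemma gauss_sup_quantile_cov_G2_ge:
  assumes "0 < \<gamma>" "\<gamma> < 1"
  shows "(1 - \<gamma>) / (2 * (b - a)) \<le> gauss_sup_quantile a b (cov_G2 a b f \<phi>) \<gamma>"
proof -
  obtain t where t: "t \<in> {a..b}" "(1 / (b - a))\<^sup>2 \<le> cov_G2 a b f \<phi> t t" using cov_G2_diag_ge by blast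
  moreover have "0 < (1 / (b - a))\<^sup>2" using a_less_b by simp
  ultimately have pos: "0 < cov_G2 a b f \<phi> t t" by linarith
  obtain X where X: "centered_gp a b (cov_G2 a b f \<phi>) white_noise X" using cov_G2_gp_exists by blast
  have "1 / (b - a) \<le> sqrt (cov_G2 a b f \<phi> t t)" using t(2) by (rule real_le_rsqrt)
  then have "1 / (b - a) * ((1 - \<gamma>) / 2) \<le> sqrt (cov_G2 a b f \<phi> t t) * ((1 - \<gamma>) / 2)"
    using assms by (intro mult_right_mono) auto
  also have "\<dots> \<le> gauss_sup_quantile a b (cov_G2 a b f \<phi>) \<gamma>"
    by (rule gauss_sup_quantile_ge[OF a_less_b X t(1) pos assms])
  finally show ?thesis by (simp add: mult.commute)
qed

section \<open>Lower bounds for the radii of the bands\<close>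

lemma kernel_bound_pos: "kernel_bound > 0"
  using a_less_b M_pos by (simp add: kernel_bound_def)

lemma supnorm_T'_bounds:
  assumes "L2 g"
  shows "z \<in> {a..b} \<Longrightarrow> T' g z \<le> supnorm a b (T' g)" and "supnorm a b (T' g) \<le> kernel_bound * nrm g"
proof -
  have "bdd_above ((\<lambda>z. \<bar>T' g z\<bar>) ` {a..b})"
    using abs_T'_le[OF assms] by (intro bdd_aboveI[where M="kernel_bound * nrm g"]) auto
  then show "T' g z \<le> supnorm a b (T' g)" if "z \<in> {a..b}"
    unfolding supnorm_def by (rule cSUP_upper2[OF _ that]) auto
  show "supnorm a b (T' g) \<le> kernel_bound * nrm g"
    unfolding supnorm_def using a_less_b abs_T'_le[OF assms] by (intro cSUP_least) auto
qed

lemma supnorm_T'_le_Tadj_norm_2inf: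
  assumes "L2 g" "nrm g \<le> 1"
  shows "supnorm a b (T' g) \<le> Tadj_norm_2inf a b f"
  unfolding Tadj_norm_2inf_def
proof (rule cSUP_upper)
  show "bdd_above ((\<lambda>\<psi>. supnorm a b (T' \<psi>)) ` {\<psi>. L2 \<psi> \<and> nrm \<psi> \<le> 1})"
  proof (rule bdd_aboveI2)
    show "supnorm a b (T' \<psi>) \<le> kernel_bound" if "\<psi> \<in> {\<psi>. L2 \<psi> \<and> nrm \<psi> \<le> 1}" for \<psi>
      using supnorm_T'_bounds(2)[of \<psi>] mult_left_mono[of "nrm \<psi>" 1 kernel_bound] kernel_bound_nonneg that
      by simp
  qed
qed (use assms in simp)

lemma Tadj_norm_2inf_ge: "1 / ((b - a) * kernel_bound) \<le> Tadj_norm_2inf a b f"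
proof -
  have L2_r: "L2 r" by (rule L2_T[OF L2_\<phi>])
  have "nrm r \<le> kernel_bound"
    unfolding kernel_bound_def using a_less_b r_nonneg r_le by (intro L2norm_bounded) auto
  moreover obtain t where t: "t \<in> {a..b}" "T'T \<phi> t \<ge> 1 / (b - a)" using T'T_\<phi>_ge by blast
  moreover have nrm_r: "nrm r > 0"
  proof (rule ccontr)
    assume "\<not> nrm r > 0"
    then have "T'T \<phi> t \<le> 0" using abs_T'T_le_nrm_T[OF L2_\<phi>, of t] L2norm_nonneg[of a b r] by simp
    moreover have "1 / (b - a) > 0" using a_less_b by simp
    ultimately show False using t(2) by linarith
  qed
  ultimately have "1 / kernel_bound * (1 / (b - a)) \<le> (1 / nrm r) * T'T \<phi> t"
    using a_less_b by (intro mult_mono divide_left_mono) auto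
  then have "1 / ((b - a) * kernel_bound) \<le> (1 / nrm r) * T'T \<phi> t" by (simp add: mult.commute)
  also have "\<dots> = T' (\<lambda>y. (1 / nrm r) * r y) t" by (simp only: T'_scale T'T_eq)
  also have "\<dots> \<le> supnorm a b (T' (\<lambda>y. (1 / nrm r) * r y))"
    by (rule supnorm_T'_bounds(1)[OF L2fun_scale[OF L2_r] t(1)])
  also have "\<dots> \<le> Tadj_norm_2inf a b f"
    by (intro supnorm_T'_le_Tadj_norm_2inf L2fun_scale[OF L2_r])
       (use L2norm_scale[of a b "1 / nrm r" r] nrm_r in simp)
  finally show ?thesis .
qed

lemma sup_f_ge: "1 / (b - a) \<le> (SUP x. \<bar>f x\<bar>)"
proof -
  have "bdd_above (range (\<lambda>x. \<bar>f x\<bar>))" using abs_f_le by (intro bdd_aboveI[where M=M]) auto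
  then have le: "f x \<le> (SUP x. \<bar>f x\<bar>)" for x by (rule cSUP_upper2[OF _ UNIV_I[of x]]) auto
  have "1 = (\<integral>x. f x \<partial>lborel_Icc a b)" using integral_lborel_Icc_eq_lborel[OF f_zero] integral_f by simp
  also have "\<dots> \<le> (\<integral>x. (SUP x. \<bar>f x\<bar>) \<partial>lborel_Icc a b)"
    using le L2fun_integrable[OF L2fun_bounded[OF f_measurable abs_f_le]] L2fun_integrable[OF L2fun_const]
    by (intro integral_mono) auto
  also have "\<dots> = (b - a) * (SUP x. \<bar>f x\<bar>)" using a_less_b by (simp add: measure_lborel_Icc)
  finally show ?thesis using a_less_b by (simp add: field_simps)
qed

lemma bdd_above_resolvent_kernel_mean:
  assumes "\<alpha> > 0"
  shows "bdd_above ((\<lambda>z. \<bar>resolvent a b f \<alpha> (kernel_mean f n v y) z\<bar>) ` {a..b})"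
proof (rule bdd_aboveI2)
  let ?h = "kernel_mean f n v y" and ?c = "(\<Sum>i<n. \<bar>v i\<bar> * M) / real n"
  fix z assume "z \<in> {a..b}"
  have "\<bar>\<Sum>i<n. v i * f (y i - z)\<bar> \<le> (\<Sum>i<n. \<bar>v i\<bar> * M)"
    by (rule order_trans[OF sum_abs sum_mono]) (auto simp: abs_mult abs_f_le intro!: mult_left_mono)
  then have "\<bar>?h z\<bar> \<le> ?c" by (simp add: kernel_mean_def divide_right_mono)
  then show "\<bar>resolvent a b f \<alpha> ?h z\<bar> \<le> (?c + kernel_bound * nrm (T (resolvent a b f \<alpha> ?h))) / \<alpha>"
    using abs_tikhonov_solution_le[OF \<open>\<alpha> > 0\<close> tikhonov_solution_resolvent[OF \<open>\<alpha> > 0\<close> L2_kernel_mean]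
        \<open>z \<in> {a..b}\<close>, of n v y] \<open>\<alpha> > 0\<close>
    by (elim order_trans) (intro divide_right_mono, auto)
qed

lemma supnorm_nu_eps_le_iff:
  assumes "\<alpha> > 0"
  shows "supnorm a b (nu_eps a b f \<alpha> n y v) \<le> x \<longleftrightarrow>
    (\<forall>z\<in>{a..b}. \<bar>resolvent a b f \<alpha> (kernel_mean f n v y) z\<bar> \<le> x)"
  unfolding supnorm_def nu_eps_eq
  using a_less_b bdd_above_resolvent_kernel_mean[OF assms] by (intro cSUP_le_iff) auto

lemma supnorm_nu_eps_nonneg:
  assumes "\<alpha> > 0"
  shows "0 \<le> supnorm a b (nu_eps a b f \<alpha> n y v)"
  using supnorm_nu_eps_le_iff[OF assms, of n y v "supnorm a b (nu_eps a b f \<alpha> n y v)"] a_less_b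
  by (meson abs_ge_zero atLeastAtMost_iff less_imp_le order_refl order_trans)

definition radius_const :: "real \<Rightarrow> real" where
  "radius_const \<gamma> = (1 - \<gamma>) / (2 * (b - a)) * (1 / ((b - a) * kernel_bound) / 2)"

lemma radius_const_pos: "\<gamma> < 1 \<Longrightarrow> radius_const \<gamma> > 0"
  using a_less_b kernel_bound_pos by (simp add: radius_const_def)

lemma radius_factor_ge: "\<alpha> > 0 \<Longrightarrow> 1 / ((b - a) * kernel_bound) / 2 \<le> Tadj_norm_2inf a b f / 2 + sqrt \<alpha>"
  using divide_right_mono[OF Tadj_norm_2inf_ge, of 2] real_sqrt_ge_zero[of \<alpha>] by linarith

lemma q_g_ge:
  assumes "\<alpha> > 0" "0 < \<gamma>" "\<gamma> < 1"
  shows "radius_const \<gamma> / (\<alpha> powr (3/2) * sqrt (real n)) \<le> q_g a b f \<phi> \<alpha> \<gamma> n"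
proof -
  have "0 \<le> (1 - \<gamma>) / (2 * (b - a))" using assms a_less_b by simp
  then have "radius_const \<gamma> \<le> gauss_sup_quantile a b (cov_G2 a b f \<phi>) \<gamma> * (Tadj_norm_2inf a b f / 2 + sqrt \<alpha>)"
    unfolding radius_const_def
    using gauss_sup_quantile_cov_G2_ge[OF assms(2,3)] radius_factor_ge[OF assms(1)] a_less_b kernel_bound_pos
    by (intro mult_mono) auto
  then show ?thesis unfolding q_g_def using assms by (intro divide_right_mono) auto
qed

lemma q_ci_ge:
  assumes "\<alpha> > 0" "0 < \<gamma>" "\<gamma> < 1"
  shows "radius_const \<gamma> / (\<alpha> powr (3/2) * sqrt (real n)) \<le> q_ci a b f \<alpha> \<gamma> n y v"
proof -
  let ?F = "SUP x. \<bar>f x\<bar>"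
  have "(1::real) \<le> 2 * ln 2" using ln2_ge_two_thirds by simp
  also have "\<dots> \<le> 2 * ln (2 / \<gamma>)" using assms by (simp add: field_simps)
  finally have "1 \<le> sqrt (2 * ln (2 / \<gamma>))" by simp
  moreover have "(1 - \<gamma>) / (2 * (b - a)) \<le> 3 * ?F"
  proof -
    have "(1 - \<gamma>) / 2 * (1 / (b - a)) \<le> 3 * (1 / (b - a))"
      using assms a_less_b by (intro mult_right_mono) auto
    then show ?thesis using sup_f_ge by simp
  qed
  moreover have "0 \<le> (1 - \<gamma>) / (2 * (b - a))" "0 \<le> 1 / ((b - a) * kernel_bound) / 2"
    using assms a_less_b kernel_bound_pos by auto
  ultimately have "radius_const \<gamma> * 1 \<le> 3 * ?F * (Tadj_norm_2inf a b f / 2 + sqrt \<alpha>) * sqrt (2 * ln (2 / \<gamma>))"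
    unfolding radius_const_def using radius_factor_ge[OF assms(1)]
    by (intro mult_mono mult_nonneg_nonneg) linarith+
  then have "radius_const \<gamma> / (\<alpha> powr (3/2) * sqrt (real n)) \<le>
      3 * ?F * (Tadj_norm_2inf a b f / 2 + sqrt \<alpha>) * sqrt (2 * ln (2 / \<gamma>)) / (\<alpha> powr (3/2) * sqrt (real n))"
    by (intro divide_right_mono) auto
  then show ?thesis unfolding q_ci_def using supnorm_nu_eps_nonneg[OF assms(1), of n y v] by linarith
qed

section \<open>Coverage of the bands\<close>

lemma in_band_iff: "in_band a b \<phi> c q \<longleftrightarrow> (\<forall>z\<in>{a..b}. \<bar>c z - \<phi> z\<bar> \<le> q)"
  unfolding in_band_def by (intro ball_cong refl) (auto simp: abs_le_iff)

lemma sets_Collect_band: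
  fixes N :: "'w measure" and y v :: "nat \<Rightarrow> 'w \<Rightarrow> real"
  assumes "\<alpha> > 0" "continuous_on {a..b} g" "g \<in> borel_measurable borel"
    and "\<And>i. i < n \<Longrightarrow> y i \<in> borel_measurable N" "\<And>i. i < n \<Longrightarrow> v i \<in> borel_measurable N" "q \<in> borel_measurable N"
  shows "{\<omega> \<in> space N. \<forall>z\<in>{a..b}.
      \<bar>resolvent a b f \<alpha> (kernel_mean f n (\<lambda>i. v i \<omega>) (\<lambda>i. y i \<omega>)) z - g z\<bar> \<le> q \<omega>} \<in> sets N"
  using assms by (intro sets_Collect_resolvent_band isCont_off_endpoints[OF continuous_on_f f_zero])

lemma coverage_g_ge:
  assumes "\<alpha> > 0" and q: "q \<le> q_g a b f \<phi> \<alpha> \<gamma> n"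
    and within: "holds_up_to_prob (Y.sample n) \<delta> (\<lambda>\<omega>. \<forall>z\<in>{a..b}. \<bar>phihat a b f \<alpha> n \<omega> z - \<phi> z\<bar> \<le> q)"
  shows "1 - \<delta> \<le> coverage_g a b f \<phi> \<alpha> \<gamma> n"
  unfolding coverage_g_def sample_Y_def
proof (rule prob_space.prob_ge_of_holds_up_to_prob[OF Y.prob_space_sample])
  show "holds_up_to_prob (Y.sample n) \<delta> (\<lambda>\<omega>. in_band a b \<phi> (phihat a b f \<alpha> n \<omega>) (q_g a b f \<phi> \<alpha> \<gamma> n))"
    by (rule holds_up_to_prob_mono[OF within order_refl])
       (use q in \<open>auto simp: in_band_iff intro: order_trans\<close>)
  show "{\<omega> \<in> space (Y.sample n). in_band a b \<phi> (phihat a b f \<alpha> n \<omega>) (q_g a b f \<phi> \<alpha> \<gamma> n)} \<in> sets (Y.sample n)"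
    unfolding in_band_iff phihat_eq
    by (rule sets_Collect_band[OF \<open>\<alpha> > 0\<close> continuous_on_\<phi> \<phi>_measurable,
          where y="\<lambda>i \<omega>. \<omega> i" and v="\<lambda>i \<omega>. 1"]) auto
qed

lemma
  assumes "i < n"
  shows borel_measurable_fst_coordinate:
      "(\<lambda>p. fst p i) \<in> borel_measurable (sample_space a b f \<phi> n)"
    and borel_measurable_snd_coordinate:
      "(\<lambda>p. snd p i) \<in> borel_measurable (sample_space a b f \<phi> n)"
proof -
  have "(\<lambda>\<omega>. \<omega> i) \<in> borel_measurable (Y.sample n)" using assms by simp
  then show "(\<lambda>p. fst p i) \<in> borel_measurable (sample_space a b f \<phi> n)"
    unfolding sample_space_def by (rule measurable_compose[OF measurable_fst])
  have "(\<lambda>\<omega>. \<omega> i) \<in> measurable (\<Pi>\<^sub>M i\<in>{..<n}. rademacher) rademacher"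
    using assms by (intro measurable_component_singleton) auto
  moreover have "(\<lambda>x. x) \<in> borel_measurable rademacher" unfolding rademacher_def by simp
  ultimately have "(\<lambda>\<omega>. \<omega> i) \<in> borel_measurable (\<Pi>\<^sub>M i\<in>{..<n}. rademacher)" by (rule measurable_compose)
  then show "(\<lambda>p. snd p i) \<in> borel_measurable (sample_space a b f \<phi> n)"
    unfolding sample_space_def by (rule measurable_compose[OF measurable_snd])
qed

lemma borel_measurable_q_ci:
  assumes "\<alpha> > 0"
  shows "(\<lambda>p. q_ci a b f \<alpha> \<gamma> n (fst p) (snd p)) \<in> borel_measurable (sample_space a b f \<phi> n)"
proof -
  let ?S = "sample_space a b f \<phi> n"
  have "(\<lambda>p. supnorm a b (nu_eps a b f \<alpha> n (fst p) (snd p))) \<in> borel_measurable ?S"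
    unfolding borel_measurable_iff_le
  proof
    fix x :: real
    have "{p \<in> space ?S. \<forall>z\<in>{a..b}.
        \<bar>resolvent a b f \<alpha> (kernel_mean f n (\<lambda>i. snd p i) (\<lambda>i. fst p i)) z - 0\<bar> \<le> x} \<in> sets ?S"
      by (rule sets_Collect_band[OF assms, where y="\<lambda>i p. fst p i" and v="\<lambda>i p. snd p i"])
         (auto intro: borel_measurable_fst_coordinate borel_measurable_snd_coordinate)
    then show "{p \<in> space ?S. supnorm a b (nu_eps a b f \<alpha> n (fst p) (snd p)) \<le> x} \<in> sets ?S"
      by (simp add: supnorm_nu_eps_le_iff[OF assms])
  qed
  then show ?thesis
    unfolding q_ci_def by (intro borel_measurable_add borel_measurable_times borel_measurable_const)
qed

lemma coverage_ci_ge: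
  assumes "\<alpha> > 0" and q: "\<And>y v. q \<le> q_ci a b f \<alpha> \<gamma> n y v"
    and within: "holds_up_to_prob (Y.sample n) \<delta> (\<lambda>\<omega>. \<forall>z\<in>{a..b}. \<bar>phihat a b f \<alpha> n \<omega> z - \<phi> z\<bar> \<le> q)"
  shows "1 - \<delta> \<le> coverage_ci a b f \<phi> \<alpha> \<gamma> n"
proof -
  let ?S = "sample_space a b f \<phi> n" and ?R = "\<Pi>\<^sub>M i\<in>{..<n}. rademacher"
  have R: "prob_space ?R"
    unfolding rademacher_def by (intro prob_space_PiM prob_space_measure_pmf)
  interpret pair_prob_space "Y.sample n" ?R
    by (intro pair_prob_space.intro pair_sigma_finite.intro prob_space_imp_sigma_finite Y.prob_space_sample R)
  have "prob_space ?S" unfolding sample_space_def by unfold_locales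
  moreover have "holds_up_to_prob ?S \<delta>
      (\<lambda>p. \<forall>z\<in>{a..b}. \<bar>phihat a b f \<alpha> n (fst p) z - \<phi> z\<bar> \<le> q_ci a b f \<alpha> \<gamma> n (fst p) (snd p))"
    unfolding sample_space_def
    by (rule holds_up_to_prob_mono[OF holds_up_to_prob_fst[OF R within] order_refl])
       (auto intro: order_trans q)
  moreover have "{p \<in> space ?S.
      \<forall>z\<in>{a..b}. \<bar>phihat a b f \<alpha> n (fst p) z - \<phi> z\<bar> \<le> q_ci a b f \<alpha> \<gamma> n (fst p) (snd p)} \<in> sets ?S"
    unfolding phihat_eq
    by (rule sets_Collect_band[OF \<open>\<alpha> > 0\<close> continuous_on_\<phi> \<phi>_measurable,
          where y="\<lambda>i p. fst p i" and v="\<lambda>i p. 1"])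
       (auto intro: borel_measurable_fst_coordinate borel_measurable_q_ci[OF \<open>\<alpha> > 0\<close>])
  ultimately have "1 - \<delta> \<le> measure ?S {p \<in> space ?S.
      \<forall>z\<in>{a..b}. \<bar>phihat a b f \<alpha> n (fst p) z - \<phi> z\<bar> \<le> q_ci a b f \<alpha> \<gamma> n (fst p) (snd p)}"
    by (rule prob_space.prob_ge_of_holds_up_to_prob)
  then show ?thesis unfolding coverage_ci_def in_band_iff by (simp add: case_prod_beta')
qed

end

section \<open>Uniform asymptotics\<close>

context deconvolution_model
begin

definition noise_const :: real where
  "noise_const = sup_noise_const + 3 / 2 * kernel_bound"

definition error_tail :: "real \<Rightarrow> real \<Rightarrow> nat \<Rightarrow> nat \<Rightarrow> real" where
  "error_tail \<epsilon> \<alpha> n N =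
     (real n powr (1 / (2 * s)) + 1) * (2 * exp (- 2 * (\<epsilon>\<^sup>2 / \<alpha>) / M\<^sup>2) + 2 * exp (- 2 * (\<epsilon>\<^sup>2 / \<alpha>)))
     + M * real N * \<alpha> / \<epsilon>\<^sup>2 + (b - a) * sq_modulus (cell_width N) / \<epsilon>\<^sup>2"

lemma noise_const_pos: "noise_const > 0"
  using M_pos a_less_b kernel_bound_pos by (simp add: noise_const_def sup_noise_const_def add_pos_nonneg)

lemma noise_tail:
  assumes "\<alpha> > 0" "n > 0" "N > 0" "\<epsilon> > 0" "sqrt \<alpha> \<le> \<epsilon>"
  shows "holds_up_to_prob (Y.sample n) (error_tail \<epsilon> \<alpha> n N) 
    (\<lambda>\<omega>. \<forall>z\<in>{a..b}. resolvent_noise_bound \<alpha> N n \<omega> z \<le> noise_const * \<epsilon> / (\<alpha> powr (3/2) * sqrt (real n)))"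
proof -
  define t \<tau>\<^sub>1 \<tau>\<^sub>2 where "t = \<epsilon> / sqrt \<alpha>" and "\<tau>\<^sub>1 = \<epsilon> / (sqrt \<alpha> * sqrt (real n))" and "\<tau>\<^sub>2 = \<epsilon> / sqrt (real n)"
  have pos: "t \<ge> 1" "\<tau>\<^sub>1 > 0" "\<tau>\<^sub>2 > 0" using assms by (simp_all add: t_def \<tau>\<^sub>1_def \<tau>\<^sub>2_def)
  have powr: "\<alpha> powr (3/2) = \<alpha> * sqrt \<alpha>"
    using powr_add[of \<alpha> 1 "1/2"] \<open>\<alpha> > 0\<close> by (simp add: powr_half_sqrt)
  have tail: "(real n powr (1 / (2 * s)) + 1) * (2 * exp (- 2 * t\<^sup>2 / M\<^sup>2) + 2 * exp (- 2 * t\<^sup>2))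
      + (M * real N / (real n * \<tau>\<^sub>1\<^sup>2) + (b - a) * sq_modulus (cell_width N) / (real n * \<tau>\<^sub>2\<^sup>2))
      = error_tail \<epsilon> \<alpha> n N"
    using assms by (simp add: error_tail_def t_def \<tau>\<^sub>1_def \<tau>\<^sub>2_def power_divide power_mult_distrib)
  note noise_tails = holds_up_to_prob_conj[OF sup_noise_tail[OF assms(2) pos(1)] holds_up_to_prob_conj[OF
        noise_weight_tail[OF assms(2,3) pos(2)] noise_remainder_tail[OF assms(2,3) pos(3)]]]
  show ?thesis
  proof (rule holds_up_to_prob_mono[OF noise_tails eq_refl[OF tail]], safe)
    fix \<omega> z
    assume z: "z \<in> {a..b}" and sup: "\<forall>z\<in>{a..b}. \<bar>noise n \<omega> z\<bar> \<le> sup_noise_const * t / sqrt (real n)"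
      and weight: "nrm (noise_weight N n \<omega>) \<le> \<tau>\<^sub>1" and remainder: "nrm (noise_remainder N n \<omega>) \<le> \<tau>\<^sub>2"
    have "resolvent_noise_bound \<alpha> N n \<omega> z
        \<le> (sup_noise_const * t / sqrt (real n) + kernel_bound * (\<tau>\<^sub>1 + \<tau>\<^sub>2 / (2 * sqrt \<alpha>))) / \<alpha>"
      unfolding resolvent_noise_bound_def using sup z weight remainder kernel_bound_nonneg \<open>\<alpha> > 0\<close>
      by (intro divide_right_mono add_mono mult_left_mono) auto
    also have "\<dots> = noise_const * \<epsilon> / (\<alpha> powr (3/2) * sqrt (real n))"
      using assms unfolding powr by (simp add: noise_const_def t_def \<tau>\<^sub>1_def \<tau>\<^sub>2_def field_simps)
    finally show "resolvent_noise_bound \<alpha> N n \<omega> z \<le> noise_const * \<epsilon> / (\<alpha> powr (3/2) * sqrt (real n))" .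
  qed
qed

definition bias_const :: "real \<Rightarrow> real" where
  "bias_const \<beta> = kernel_bound * qualification_const \<beta>"

lemma estimation_error_tail:
  assumes "\<alpha> > 0" "\<beta> \<ge> 0" "n > 0" "N > 0" "\<epsilon> > 0" "sqrt \<alpha> \<le> \<epsilon>"
    and \<psi>: "L2 \<psi>" "nrm \<psi> \<le> C" and source: "spectral_source a b f lam e \<beta> \<phi> \<psi>"
    and q: "bias_const \<beta> * C * (\<alpha> powr (3/2 + min \<beta> 1) * sqrt (real n)) + noise_const * \<epsilon> \<le> q"
  shows "holds_up_to_prob (Y.sample n) (error_tail \<epsilon> \<alpha> n N)
    (\<lambda>\<omega>. \<forall>z\<in>{a..b}. \<bar>phihat a b f \<alpha> n \<omega> z - \<phi> z\<bar> \<le> q / (\<alpha> powr (3/2) * sqrt (real n)))"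
proof (rule holds_up_to_prob_mono[OF noise_tail[OF assms(1,3-6)] order_refl], safe)
  fix \<omega> z
  assume \<omega>: "\<omega> \<in> space (Y.sample n)" and z: "z \<in> {a..b}"
    and noise: "\<forall>z\<in>{a..b}. resolvent_noise_bound \<alpha> N n \<omega> z \<le> noise_const * \<epsilon> / (\<alpha> powr (3/2) * sqrt (real n))"
  let ?d = "\<alpha> powr (3/2) * sqrt (real n)"
  have "?d > 0" using assms by simp
  have "kernel_bound * (\<alpha> powr (min \<beta> 1) * qualification_const \<beta> * nrm \<psi>)
      \<le> bias_const \<beta> * C * \<alpha> powr (min \<beta> 1)"
  proof -
    have "kernel_bound * qualification_const \<beta> * \<alpha> powr (min \<beta> 1) * nrm \<psi>
        \<le> kernel_bound * qualification_const \<beta> * \<alpha> powr (min \<beta> 1) * C"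
      using \<psi>(2) kernel_bound_nonneg by (intro mult_left_mono) (auto simp: qualification_const_def)
    then show ?thesis by (simp add: bias_const_def mult_ac)
  qed
  also have "\<dots> = bias_const \<beta> * C * (\<alpha> powr (3/2 + min \<beta> 1) * sqrt (real n)) / ?d"
    using assms by (simp add: powr_add)
  finally have "\<bar>phihat a b f \<alpha> n \<omega> z - \<phi> z\<bar> \<le>
      bias_const \<beta> * C * (\<alpha> powr (3/2 + min \<beta> 1) * sqrt (real n)) / ?d + noise_const * \<epsilon> / ?d"
    using estimation_error_le[OF assms(1,2) \<psi>(1) source \<omega> z, of N] noise z by fastforce
  also have "\<dots> \<le> q / ?d"
    unfolding add_divide_distrib[symmetric] using q \<open>?d > 0\<close> by (intro divide_right_mono) auto
  finally show "\<bar>phihat a b f \<alpha> n \<omega> z - \<phi> z\<bar> \<le> q / ?d" .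
qed

lemma sq_modulus_cell_width_tendsto: "(\<lambda>N. sq_modulus (cell_width N)) \<longlonglongrightarrow> 0"
proof -
  have width: "(\<lambda>N. cell_width N) \<longlonglongrightarrow> 0" unfolding cell_width_def by real_asymp
  then have "(\<lambda>N. cell_width N powr s) \<longlonglongrightarrow> 0 powr s"
    using s cell_width_nonneg by (intro tendsto_powr2) auto
  then have "(\<lambda>N. M\<^sup>2 * (2 * (cell_width N powr s)\<^sup>2 + 8 * M * cell_width N))
      \<longlonglongrightarrow> M\<^sup>2 * (2 * (0 powr s)\<^sup>2 + 8 * M * 0)"
    by (intro tendsto_mult tendsto_add tendsto_power tendsto_const width)
  then show ?thesis by (simp add: sq_modulus_def[abs_def])
qed

lemma sup_noise_tail_eventually_less:
  fixes \<alpha> :: "nat \<Rightarrow> real"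
  assumes growth: "\<forall>\<^sub>F n in sequentially. real n powr (1/5) \<le> 1 / \<alpha> n" and "\<epsilon> > 0" "\<eta> > 0"
  shows "\<forall>\<^sub>F n in sequentially. (real n powr (1 / (2 * s)) + 1) *
    (2 * exp (- 2 * (\<epsilon>\<^sup>2 / \<alpha> n) / M\<^sup>2) + 2 * exp (- 2 * (\<epsilon>\<^sup>2 / \<alpha> n))) < \<eta>"
proof -
  define p c\<^sub>1 c\<^sub>2 where "p = 1 / (2 * s)" and "c\<^sub>1 = 2 * \<epsilon>\<^sup>2 / M\<^sup>2" and "c\<^sub>2 = 2 * \<epsilon>\<^sup>2"
  have pos: "p > 0" "c\<^sub>1 > 0" "c\<^sub>2 > 0" using s \<open>\<epsilon> > 0\<close> M_pos by (simp_all add: p_def c\<^sub>1_def c\<^sub>2_def)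
  then have "(\<lambda>n. (real n powr p + 1) * (2 * exp (- c\<^sub>1 * real n powr (1/5)))) \<longlonglongrightarrow> 0"
    "(\<lambda>n. (real n powr p + 1) * (2 * exp (- c\<^sub>2 * real n powr (1/5)))) \<longlonglongrightarrow> 0"
    by real_asymp+
  from tendsto_add[OF this]
  have "(\<lambda>n. (real n powr p + 1) *
      (2 * exp (- c\<^sub>1 * real n powr (1/5)) + 2 * exp (- c\<^sub>2 * real n powr (1/5)))) \<longlonglongrightarrow> 0"
    by (simp add: distrib_left)
  then have "\<forall>\<^sub>F n in sequentially. (real n powr p + 1) *
      (2 * exp (- c\<^sub>1 * real n powr (1/5)) + 2 * exp (- c\<^sub>2 * real n powr (1/5))) < \<eta>"
    using \<open>\<eta> > 0\<close> by (intro order_tendstoD(2)) auto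
  then show ?thesis
    using growth
  proof eventually_elim
    case (elim n)
    have "- 2 * (\<epsilon>\<^sup>2 / \<alpha> n) / M\<^sup>2 \<le> - c\<^sub>1 * real n powr (1/5)" "- 2 * (\<epsilon>\<^sup>2 / \<alpha> n) \<le> - c\<^sub>2 * real n powr (1/5)"
      using mult_left_mono[OF elim(2), of c\<^sub>1] mult_left_mono[OF elim(2), of c\<^sub>2] pos
      by (simp_all add: c\<^sub>1_def c\<^sub>2_def mult.commute)
    then show ?case
      unfolding p_def[symmetric] by (intro le_less_trans[OF _ elim(1)] mult_left_mono add_mono) auto
  qed
qed

lemma error_tail_eventually_le:
  fixes \<alpha> :: "nat \<Rightarrow> real"
  assumes \<alpha>: "\<alpha> \<longlonglongrightarrow> 0" and growth: "\<forall>\<^sub>F n in sequentially. real n powr (1/5) \<le> 1 / \<alpha> n"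
    and "\<epsilon> > 0" "\<eta> > 0"
  shows "\<exists>N>0. \<forall>\<^sub>F n in sequentially. error_tail \<epsilon> (\<alpha> n) n N \<le> \<eta>"
proof -
  have "(\<lambda>N. (b - a) * sq_modulus (cell_width N) / \<epsilon>\<^sup>2) \<longlonglongrightarrow> (b - a) * 0 / \<epsilon>\<^sup>2"
    using \<open>\<epsilon> > 0\<close> by (intro tendsto_divide tendsto_mult tendsto_const sq_modulus_cell_width_tendsto) auto
  then have "\<forall>\<^sub>F N in sequentially. (b - a) * sq_modulus (cell_width N) / \<epsilon>\<^sup>2 < \<eta> / 3"
    using \<open>\<eta> > 0\<close> by (intro order_tendstoD(2)) auto
  with eventually_gt_at_top[of 0]
  have "\<forall>\<^sub>F N in sequentially. N > 0 \<and> (b - a) * sq_modulus (cell_width N) / \<epsilon>\<^sup>2 < \<eta> / 3"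
    by (rule eventually_conj)
  then obtain N where N: "N > 0" "(b - a) * sq_modulus (cell_width N) / \<epsilon>\<^sup>2 < \<eta> / 3"
    by (auto dest: eventually_happens)
  have "(\<lambda>n. M * real N * \<alpha> n / \<epsilon>\<^sup>2) \<longlonglongrightarrow> M * real N * 0 / \<epsilon>\<^sup>2"
    using \<open>\<epsilon> > 0\<close> by (intro tendsto_divide tendsto_mult tendsto_const \<alpha>) auto
  then have "\<forall>\<^sub>F n in sequentially. M * real N * \<alpha> n / \<epsilon>\<^sup>2 < \<eta> / 3"
    using \<open>\<eta> > 0\<close> by (intro order_tendstoD(2)) auto
  moreover have "\<forall>\<^sub>F n in sequentially. (real n powr (1 / (2 * s)) + 1) *
      (2 * exp (- 2 * (\<epsilon>\<^sup>2 / \<alpha> n) / M\<^sup>2) + 2 * exp (- 2 * (\<epsilon>\<^sup>2 / \<alpha> n))) < \<eta> / 3"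
    using \<open>\<eta> > 0\<close> by (intro sup_noise_tail_eventually_less[OF growth \<open>\<epsilon> > 0\<close>]) simp
  ultimately have "\<forall>\<^sub>F n in sequentially. error_tail \<epsilon> (\<alpha> n) n N \<le> \<eta>"
    by eventually_elim (use N(2) in \<open>simp only: error_tail_def\<close>)
  with N(1) show ?thesis by blast
qed

lemma estimation_error_tail_eventually:
  fixes \<alpha> :: "nat \<Rightarrow> real"
  assumes \<alpha>: "\<alpha> \<longlonglongrightarrow> 0" and growth: "\<forall>\<^sub>F n in sequentially. real n powr (1/5) \<le> 1 / \<alpha> n"
    and rate: "(\<lambda>n. \<alpha> n powr (3/2 + min \<beta> 1) * sqrt (real n)) \<longlonglongrightarrow> 0" and "\<kappa> > 0" "\<eta> > 0"
  obtains \<epsilon> N where "\<epsilon> > 0" "N > 0" "\<forall>\<^sub>F n in sequentially. sqrt (\<alpha> n) \<le> \<epsilon> \<and>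
    bias_const \<beta> * C * (\<alpha> n powr (3/2 + min \<beta> 1) * sqrt (real n)) + noise_const * \<epsilon> \<le> \<kappa> \<and>
    error_tail \<epsilon> (\<alpha> n) n N \<le> \<eta>"
proof -
  define \<epsilon> where "\<epsilon> = \<kappa> / 2 / noise_const"
  have \<epsilon>: "\<epsilon> > 0" "noise_const * \<epsilon> = \<kappa> / 2" using noise_const_pos \<open>\<kappa> > 0\<close> by (simp_all add: \<epsilon>_def)
  obtain N where N: "N > 0" "\<forall>\<^sub>F n in sequentially. error_tail \<epsilon> (\<alpha> n) n N \<le> \<eta>"
    using error_tail_eventually_le[OF \<alpha> growth \<epsilon>(1) \<open>\<eta> > 0\<close>] by blast
  have "(\<lambda>n. bias_const \<beta> * C * (\<alpha> n powr (3/2 + min \<beta> 1) * sqrt (real n))) \<longlonglongrightarrow> bias_const \<beta> * C * 0"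
    by (intro tendsto_mult tendsto_const rate)
  then have "\<forall>\<^sub>F n in sequentially. bias_const \<beta> * C * (\<alpha> n powr (3/2 + min \<beta> 1) * sqrt (real n)) < \<kappa> / 2"
    using \<open>\<kappa> > 0\<close> by (intro order_tendstoD(2)) auto
  moreover have "\<forall>\<^sub>F n in sequentially. sqrt (\<alpha> n) < \<epsilon>"
    using tendsto_real_sqrt[OF \<alpha>] \<epsilon>(1) by (intro order_tendstoD(2)) auto
  ultimately have "\<forall>\<^sub>F n in sequentially. sqrt (\<alpha> n) \<le> \<epsilon> \<and>
      bias_const \<beta> * C * (\<alpha> n powr (3/2 + min \<beta> 1) * sqrt (real n)) + noise_const * \<epsilon> \<le> \<kappa> \<and>
    error_tail \<epsilon> (\<alpha> n) n N \<le> \<eta>"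
    using N(2) by eventually_elim (use \<epsilon>(2) in linarith)
  with \<epsilon>(1) N(1) show ?thesis by (rule that)
qed

end

lemma inverse_bandwidth_growth:
  fixes \<alpha> :: "nat \<Rightarrow> real"
  assumes \<alpha>: "\<And>n. \<alpha> n > 0" "\<alpha> \<longlonglongrightarrow> 0" and "m \<le> 1"
    and rate: "(\<lambda>n. \<alpha> n powr (3/2 + m) * sqrt (real n)) \<longlonglongrightarrow> 0"
  shows "\<forall>\<^sub>F n in sequentially. real n powr (1/5) \<le> 1 / \<alpha> n"
proof -
  have "\<forall>\<^sub>F n in sequentially. \<alpha> n powr (3/2 + m) * sqrt (real n) < 1"
    using rate by (rule order_tendstoD) simp
  moreover have "\<forall>\<^sub>F n in sequentially. \<alpha> n < 1" using \<alpha>(2) by (rule order_tendstoD) simp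
  ultimately show ?thesis
  proof eventually_elim
    case (elim n)
    have "\<alpha> n powr (5/2) * sqrt (real n) \<le> \<alpha> n powr (3/2 + m) * sqrt (real n)"
      using elim(2) \<open>m \<le> 1\<close> \<alpha>(1) by (intro mult_right_mono powr_mono') (auto intro: less_imp_le)
    then have "\<alpha> n powr (5/2) * real n powr (1/2) \<le> 1" using elim(1) by (simp add: powr_half_sqrt)
    then have "(\<alpha> n powr (5/2) * real n powr (1/2)) powr (2/5) \<le> 1 powr (2/5)" by (intro powr_mono2) auto
    then have "\<alpha> n * real n powr (1/5) \<le> 1" using \<alpha>(1)[of n] by (simp add: powr_mult powr_powr)
    then show ?case using \<alpha>(1) by (simp add: pos_le_divide_eq mult.commute)
  qed
qed

lemma in_class_model:
  assumes "a < b" "0 < s" "s \<le> 1" and cls: "in_class a b M s \<beta> C \<phi> f"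
  obtains lam e \<psi> where "deconvolution_model a b M f lam e s \<phi>" "L2fun a b \<psi>" "L2norm a b \<psi> \<le> C"
    "spectral_source a b f lam e \<beta> \<phi> \<psi>"
proof -
  obtain \<psi> lam e where \<psi>: "L2fun a b \<psi>" "L2norm a b \<psi> \<le> C"
    and lam_e: "spectral_system a b f lam e" "spectral_source a b f lam e \<beta> \<phi> \<psi>"
    using cls unfolding in_class_def source_condition_def spectral_source_def by blast
  have f_abs_Icc: "\<And>x. x \<in> {a..b} \<Longrightarrow> \<bar>f x\<bar> \<le> M" and f_zero: "\<And>x. x \<notin> {a..b} \<Longrightarrow> f x = 0"
    using cls unfolding in_class_def by blast+
  have "\<bar>f x\<bar> \<le> M" for x
    using f_abs_Icc[of x] f_abs_Icc[of a] f_zero[of x] \<open>a < b\<close> by (cases "x \<in> {a..b}") auto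
  then have "deconvolution_model a b M f lam e s \<phi>"
    by unfold_locales (use cls assms(1-3) lam_e in \<open>auto simp: in_class_def\<close>)
  then show ?thesis using \<psi> lam_e(2) by (rule that)
qed

context
  fixes a b M s \<beta> C :: real and \<alpha> :: "nat \<Rightarrow> real"
  assumes a_less_b: "a < b" and s: "0 < s" "s \<le> 1" and "0 \<le> \<beta>"
    and \<alpha>: "\<And>n. \<alpha> n > 0" "\<alpha> \<longlonglongrightarrow> 0"
    and rate: "(\<lambda>n. \<alpha> n powr (3/2 + min \<beta> 1) * sqrt (real n)) \<longlonglongrightarrow> 0"
begin

lemma coverage_eventually_ge:
  assumes \<gamma>: "0 < \<gamma>" "\<gamma> < 1" and "\<eta> > 0"
  shows "\<forall>\<^sub>F n in sequentially. \<forall>\<phi> f. in_class a b M s \<beta> C \<phi> f \<longrightarrow>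
    1 - \<eta> \<le> coverage_ci a b f \<phi> (\<alpha> n) \<gamma> n \<and> 1 - \<eta> \<le> coverage_g a b f \<phi> (\<alpha> n) \<gamma> n"
proof (cases "\<exists>\<phi> f. in_class a b M s \<beta> C \<phi> f")
  case True
  then obtain \<phi>\<^sub>0 f\<^sub>0 lam\<^sub>0 e\<^sub>0 where "deconvolution_model a b M f\<^sub>0 lam\<^sub>0 e\<^sub>0 s \<phi>\<^sub>0"
    using in_class_model[OF a_less_b s] by metis
  then interpret m\<^sub>0: deconvolution_model a b M f\<^sub>0 lam\<^sub>0 e\<^sub>0 s \<phi>\<^sub>0 .
  define \<kappa> where "\<kappa> = m\<^sub>0.radius_const \<gamma>"
  have "\<kappa> > 0" using m\<^sub>0.radius_const_pos[OF \<gamma>(2)] by (simp add: \<kappa>_def)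
  txt \<open>The constants of the error bound depend on \<open>a\<close>, \<open>b\<close>, \<open>M\<close>, \<open>s\<close>, \<open>\<beta>\<close> and \<open>C\<close> only, so the rate found for
    one member of the class holds for all of them.\<close>
  obtain \<epsilon> N where "\<epsilon> > 0" "N > 0" and bounds: "\<forall>\<^sub>F n in sequentially. sqrt (\<alpha> n) \<le> \<epsilon> \<and>
      m\<^sub>0.bias_const \<beta> * C * (\<alpha> n powr (3/2 + min \<beta> 1) * sqrt (real n)) + m\<^sub>0.noise_const * \<epsilon> \<le> \<kappa> \<and>
      m\<^sub>0.error_tail \<epsilon> (\<alpha> n) n N \<le> \<eta>"
    by (rule m\<^sub>0.estimation_error_tail_eventually[OF \<alpha>(2) inverse_bandwidth_growth[OF \<alpha> _ rate]
          rate \<open>\<kappa> > 0\<close> \<open>\<eta> > 0\<close>]) auto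
  show ?thesis
    using bounds eventually_gt_at_top[of 0]
  proof eventually_elim
    case (elim n)
    show ?case
    proof (intro allI impI)
      fix \<phi> f
      assume "in_class a b M s \<beta> C \<phi> f"
      then obtain lam e \<psi> where model: "deconvolution_model a b M f lam e s \<phi>"
        and \<psi>: "L2fun a b \<psi>" "L2norm a b \<psi> \<le> C" "spectral_source a b f lam e \<beta> \<phi> \<psi>"
        by (rule in_class_model[OF a_less_b s])
      interpret m: deconvolution_model a b M f lam e s \<phi> by (rule model)
      have "holds_up_to_prob (m.Y.sample n) (m\<^sub>0.error_tail \<epsilon> (\<alpha> n) n N)
          (\<lambda>\<omega>. \<forall>z\<in>{a..b}. \<bar>phihat a b f (\<alpha> n) n \<omega> z - \<phi> z\<bar> \<le> \<kappa> / (\<alpha> n powr (3/2) * sqrt (real n)))"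
        using elim \<psi> by (intro m.estimation_error_tail[OF \<alpha>(1) \<open>0 \<le> \<beta>\<close> _ \<open>N > 0\<close> \<open>\<epsilon> > 0\<close>]) auto
      note m.coverage_ci_ge[OF \<alpha>(1) m.q_ci_ge[OF \<alpha>(1) \<gamma>] this[unfolded \<kappa>_def]]
        m.coverage_g_ge[OF \<alpha>(1) m.q_g_ge[OF \<alpha>(1) \<gamma>] this[unfolded \<kappa>_def]]
      with elim(1) show "1 - \<eta> \<le> coverage_ci a b f \<phi> (\<alpha> n) \<gamma> n \<and> 1 - \<eta> \<le> coverage_g a b f \<phi> (\<alpha> n) \<gamma> n"
        by linarith
    qed
  qed
qed simp

end

lemma uniform_rate:
  fixes c :: "nat \<Rightarrow> 'i \<Rightarrow> real"
  assumes c: "\<And>n x. x \<in> S \<Longrightarrow> 0 \<le> c n x"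
    and lim: "\<And>\<eta>. \<eta> > 0 \<Longrightarrow> \<forall>\<^sub>F n in sequentially. \<forall>x\<in>S. 1 - \<eta> \<le> c n x"
  obtains \<delta> where "\<delta> \<longlonglongrightarrow> 0" "\<And>n x. x \<in> S \<Longrightarrow> 1 - \<delta> n \<le> c n x"
proof
  define \<delta> where "\<delta> n = Sup (insert 0 ((\<lambda>x. 1 - c n x) ` S))" for n
  have bdd: "bdd_above (insert 0 ((\<lambda>x. 1 - c n x) ` S))" for n
    using c by (intro bdd_aboveI[where M=1]) auto
  have "\<delta> n \<ge> 0" for n unfolding \<delta>_def by (rule cSup_upper[OF _ bdd]) simp
  show "1 - \<delta> n \<le> c n x" if "x \<in> S" for n x
    using cSup_upper[OF _ bdd, of "1 - c n x" n] that by (simp add: \<delta>_def algebra_simps)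
  show "\<delta> \<longlonglongrightarrow> 0"
  proof (rule LIMSEQ_I)
    fix y :: real
    assume "y > 0"
    then have "\<forall>\<^sub>F n in sequentially. \<forall>x\<in>S. 1 - y / 2 \<le> c n x" by (intro lim) simp
    then have "\<forall>\<^sub>F n in sequentially. norm (\<delta> n - 0) < y"
    proof eventually_elim
      case (elim n)
      then have "\<delta> n \<le> y / 2" unfolding \<delta>_def using \<open>y > 0\<close> by (intro cSup_least) auto
      then show ?case using \<open>\<delta> n \<ge> 0\<close> \<open>y > 0\<close> by simp
    qed
    then show "\<exists>no. \<forall>n\<ge>no. norm (\<delta> n - 0) < y" by (simp add: eventually_sequentially)
  qed
qed

theorem theorem8:
  fixes a b M s \<beta> C \<gamma> :: real and \<alpha> :: "nat \<Rightarrow> real"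
  assumes "a < b"
    and "0 < s" and "s \<le> 1"
    and "0 \<le> \<beta>"
    and "\<forall>n. \<alpha> n > 0" and "\<alpha> \<longlonglongrightarrow> 0"
    and "(\<lambda>n. \<alpha> n powr (3/2 + min \<beta> 1) * sqrt (real n)) \<longlonglongrightarrow> 0"
    and "0 < \<gamma>" and "\<gamma> < 1"
  shows "(\<exists>\<delta>::nat \<Rightarrow> real. \<delta> \<longlonglongrightarrow> 0 \<and>
            (\<forall>n \<phi> f. in_class a b M s \<beta> C \<phi> f \<longrightarrow>
               coverage_ci a b f \<phi> (\<alpha> n) \<gamma> n \<ge> 1 - \<gamma> - \<delta> n))
       \<and> (\<exists>(K::real) (\<delta>::nat \<Rightarrow> real). \<delta> \<longlonglongrightarrow> 0 \<and>
            (\<forall>n \<phi> f. in_class a b M s \<beta> C \<phi> f \<longrightarrow>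
               coverage_g a b f \<phi> (\<alpha> n) \<gamma> n \<ge> 1 - \<gamma> - K * real n powr (-1/6) - \<delta> n))"
proof -
  let ?S = "{(\<phi>, f). in_class a b M s \<beta> C \<phi> f}"
  note coverage = coverage_eventually_ge[OF assms(1-4) assms(5)[rule_format] assms(6-9)]
  obtain \<delta>\<^sub>1 where \<delta>\<^sub>1: "\<delta>\<^sub>1 \<longlonglongrightarrow> 0" "\<And>n \<phi> f. in_class a b M s \<beta> C \<phi> f \<Longrightarrow> 1 - \<delta>\<^sub>1 n \<le> coverage_ci a b f \<phi> (\<alpha> n) \<gamma> n"
    by (rule uniform_rate[of ?S "\<lambda>n (\<phi>, f). coverage_ci a b f \<phi> (\<alpha> n) \<gamma> n"])
       (use eventually_mono[OF coverage[of _ M C]] in \<open>auto simp: coverage_ci_def\<close>)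
  obtain \<delta>\<^sub>2 where \<delta>\<^sub>2: "\<delta>\<^sub>2 \<longlonglongrightarrow> 0" "\<And>n \<phi> f. in_class a b M s \<beta> C \<phi> f \<Longrightarrow> 1 - \<delta>\<^sub>2 n \<le> coverage_g a b f \<phi> (\<alpha> n) \<gamma> n"
    by (rule uniform_rate[of ?S "\<lambda>n (\<phi>, f). coverage_g a b f \<phi> (\<alpha> n) \<gamma> n"])
       (use eventually_mono[OF coverage[of _ M C]] in \<open>auto simp: coverage_g_def\<close>)
  have "\<forall>n \<phi> f. in_class a b M s \<beta> C \<phi> f \<longrightarrow> coverage_ci a b f \<phi> (\<alpha> n) \<gamma> n \<ge> 1 - \<gamma> - \<delta>\<^sub>1 n"
    using \<open>0 < \<gamma>\<close> by (auto intro!: order_trans[OF _ \<delta>\<^sub>1(2)])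
  moreover have "\<forall>n \<phi> f. in_class a b M s \<beta> C \<phi> f \<longrightarrow>
      coverage_g a b f \<phi> (\<alpha> n) \<gamma> n \<ge> 1 - \<gamma> - 0 * real n powr (-1/6) - \<delta>\<^sub>2 n"
    using \<open>0 < \<gamma>\<close> by (auto intro!: order_trans[OF _ \<delta>\<^sub>2(2)])
  ultimately show ?thesis using \<delta>\<^sub>1(1) \<delta>\<^sub>2(1) by blast
qed

end
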